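(* Suppose that $W_2^{(M,N)}(z)$ is one-dimensional and that the eigenspaces $U_2^{(M)}(\xi(-N,z))$ and $U_2^{(M)}(\xi(-N+\delta,z))$, for small $\delta>0$, are one-dimensional. Then $$\|\hat f_{n,\xi(\delta,z),M,N}-\hat f_{n,z,M,N}\|_1\to 0\quad\text{as }\delta\to 0.$$
   Context: Setting. $\mathcal M\subset\mathbb R^D$ is a smooth compact $d$-dimensional manifold ($D\ge d$), and $m$ is normalised Lebesgue measure on $\mathcal M$. $\|\cdot\|_1$ is the norm of $L^1(\mathcal M,m)$. (The letter $M$ denotes a flow duration, not the manifold.) Driving system. $\Xi\subset\mathbb R^{d_1}$, $d_1\ge 3$, and $\xi:\mathbb R\times\Xi\to\Xi$ is the flow of an autonomous ODE $\dot z=g(z)$ on $\Xi$. It preserves a probability measure $\mathbb P$ on $\Xi$ and is ergodic with respect to it. Points $z\in\Xi$ represent generalised time. Nonautonomous flow. $F$ is a vector field on $\mathcal M$ depending on $z\in\Xi$, and $\phi:\mathbb R\times\Xi\times\mathcal M\to\mathcal M$ is the flow of $\dot x(t)=F(\xi(t,z),x(t))$, i.e. $\frac{d}{dt}\phi(t,z,x)=F(\xi(t,z),\phi(t,z,x))$ and $\phi(0,z,x)=x$. $F$ is assumed regular enough that classical solutions exist for all times, and that for each fixed $z$ the maps $\phi(t,z,\cdot)$ are $C^1$ with derivative $D\phi(t,z,x)$ in $x$ continuous in $(t,x)$. Perron–Frobenius operators. For $t\ge 0$, $z\in\Xi$ and $f\in L^1(\mathcal M,m)$, $$\mathcal P_z^{(t)}f(x)=f(\phi(-t,\xi(t,z),x))\cdot|\det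 D\phi(-t,\xi(t,z),x)|.$$ Projection and matrices. $\{B_1,\dots,B_n\}$ is a fixed partition of $\mathcal M$ into connected sets of positive Lebesgue measure, and $\mathcal B_n$ is the linear span of $\chi_{B_1},\dots,\chi_{B_n}$. The projection $\pi_n:L^1(\mathcal M,m)\to\mathcal B_n$ is $\pi_nf=\sum_{i=1}^n\frac{\int_{B_i}f\,dm}{m(B_i)}\chi_{B_i}$. For $t\ge0$, $P^{(t)}(z)$ is the $n\times n$ matrix of the restriction of $\pi_n\mathcal P_z^{(t)}$ to $\mathcal B_n$ in the basis $\chi_{B_1},\dots,\chi_{B_n}$: $P^{(t)}(z)_{ij}=m(B_j\cap\phi(-t,\xi(t,z),B_i))/m(B_i)$. Approximate Oseledets functions. $M>0$ and $N\ge0$ are flow durations and $z\in\Xi$. For $y\in\Xi$ put $\Psi^{(M)}(y)=\left(P^{(M)}(y)^\top P^{(M)}(y)\right)^{1/2M}$, and let $U_j^{(M)}(y)\subset\mathbb R^n$, $j=1,\dots,\ell$, be the eigenspaces in the orthonormal eigenspace decomposition of $\Psi^{(M)}(y)$, ordered so that low values of $j$ correspond to large eigenvalues. Put $W_2^{(M,N)}(z)=P^{(N)}(\xi(-N,z))\,U_2^{(M)}(\xi(-N,z))$. Define $f_{n,\xi(-N,z),M}=\sum_{i=1}^n(u_2^{(M)}(\xi(-N,z)))_i\,\chi_{B_i}\in L^1(\mathcal M,m)$, where $u_2^{(M)}(\xi(-N,z))\in U_2^{(M)}(\xi(-N,z))$ is scaled so that $\|f_{n,\xi(-N,z),M}\|_1=1$,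 and let $$\hat f_{n,z,M,N}=\pi_n\mathcal P^{(N)}_{\xi(-N,z)}f_{n,\xi(-N,z),M}.$$ The function $\hat f_{n,\xi(\delta,z),M,N}$ is defined in the same way with $z$ replaced by $\xi(\delta,z)$, i.e. $\hat f_{n,\xi(\delta,z),M,N}=\pi_n\mathcal P^{(N)}_{\xi(-N+\delta,z)}f_{n,\xi(-N+\delta,z),M}$. Here $\delta>0$ is small.
   Formalization: The normalised vector u_2 is fixed only up to sign, so convergence is shown after a suitable choice of signs; and the number ℓ of distinct eigenvalues of Ψ^(M) is taken to be the same at ξ(-N,z) and at ξ(-N+δ,z) for small δ>0, without which the claim can fail. *)

theory Defs
  imports "HOL-Analysis.Analysis" "HOL-Probability.Probability_Measure"
begin

section \<open>Compact submanifolds of Euclidean space and their normalised Lebesgue measure\<close>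

text \<open>Meant for open \<open>U\<close>, where \<open>C_on k f U\<close> says that \<open>f\<close> is \<open>k\<close> times continuously differentiable.\<close>

primrec C_on :: "nat \<Rightarrow> ('a::euclidean_space \<Rightarrow> 'b::euclidean_space) \<Rightarrow> 'a set \<Rightarrow> bool" where
  "C_on 0 f U \<longleftrightarrow> continuous_on U f"
| "C_on (Suc k) f U \<longleftrightarrow>
     f differentiable_on U \<and> (\<forall>v. C_on k (\<lambda>x. frechet_derivative f (at x) v) U)"

definition local_param ::
    "(real^'D) set \<Rightarrow> (real^'d) set \<Rightarrow> (real^'d \<Rightarrow> real^'D) \<Rightarrow> bool" where
  "local_param \<M> U \<psi> \<longleftrightarrow>
     open U \<and> (\<forall>k. C_on k \<psi> U) \<and>
     (\<forall>u\<in>U. inj (frechet_derivative \<psi> (at u))) \<and>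
     openin (top_of_set \<M>) (\<psi> ` U) \<and>
     (\<exists>h. homeomorphism U (\<psi> ` U) \<psi> h)"

text \<open>The dimension of the manifold is carried by the type argument: it is \<open>CARD('d)\<close>.\<close>

definition compact_manifold :: "'d::finite itself \<Rightarrow> (real^'D) set \<Rightarrow> bool" where
  "compact_manifold _ \<M> \<longleftrightarrow>
     compact \<M> \<and> (\<forall>x\<in>\<M>. \<exists>U (\<psi> :: real^'d \<Rightarrow> real^'D). local_param \<M> U \<psi> \<and> x \<in> \<psi> ` U)"

definition volume_density :: "(real^'d \<Rightarrow> real^'D) \<Rightarrow> real^'d \<Rightarrow> real" where
  "volume_density \<psi> u =
     sqrt (det (\<chi> i j. frechet_derivative \<psi> (at u) (axis i 1) \<bullet>
                        frechet_derivative \<psi> (at u) (axis j 1)))"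

text \<open>
  The Riemannian volume measure of \<open>\<M>\<close> (on the Lebesgue measurable sets of \<open>\<M>\<close>, so it is complete),
  divided by the total volume. The constant \<open>c\<close> is the reciprocal of that total volume, being
  determined by \<open>emeasure m \<M> = 1\<close>; the conditions below determine \<open>m\<close> uniquely.
\<close>

definition normalised_lebesgue ::
    "'d::finite itself \<Rightarrow> (real^'D) set \<Rightarrow> (real^'D) measure \<Rightarrow> bool" where
  "normalised_lebesgue _ \<M> m \<longleftrightarrow>
     space m = \<M> \<and>
     sets m = {A. A \<subseteq> \<M> \<and> (\<forall>U (\<psi> :: real^'d \<Rightarrow> real^'D).
                   local_param \<M> U \<psi> \<longrightarrow> U \<inter> \<psi> -` A \<in> sets lebesgue)} \<and>
     emeasure m \<M> = 1 \<and>
     (\<exists>c>0. \<forall>U (\<psi> :: real^'d \<Rightarrow> real^'D) A.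
        local_param \<M> U \<psi> \<longrightarrow> A \<in> sets lebesgue \<longrightarrow> A \<subseteq> U \<longrightarrow>
        emeasure m (\<psi> ` A) = ennreal c * (\<integral>\<^sup>+u\<in>A. ennreal (volume_density \<psi> u) \<partial>lebesgue))"

definition L1_norm :: "'a measure \<Rightarrow> ('a \<Rightarrow> real) \<Rightarrow> real" where
  "L1_norm m f = (LINT x|m. \<bar>f x\<bar>)"

definition tangent_space :: "'d::finite itself \<Rightarrow> (real^'D) set \<Rightarrow> real^'D \<Rightarrow> (real^'D) set" where
  "tangent_space _ \<M> x =
     {v. \<exists>U (\<psi> :: real^'d \<Rightarrow> real^'D) u.
           local_param \<M> U \<psi> \<and> u \<in> U \<and> \<psi> u = x \<and> v \<in> range (frechet_derivative \<psi> (at u))}"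

text \<open>
  A derivative of \<open>g\<close> at \<open>x\<close> within \<open>\<M>\<close> is determined only on the tangent space at \<open>x\<close>. The map
  below is the derivative on the tangent space, extended by zero on its orthogonal complement.
  Continuity of the derivative as a map of the tangent bundle is the same as continuity of this
  extension.
\<close>

definition tangent_map ::
    "'d::finite itself \<Rightarrow> (real^'D) set \<Rightarrow> (real^'D \<Rightarrow> real^'D) \<Rightarrow> real^'D \<Rightarrow> real^'D \<Rightarrow> real^'D" where
  "tangent_map d \<M> g x =
     (THE L. (g has_derivative L) (at x within \<M>) \<and>
             (\<forall>v. (\<forall>w\<in>tangent_space d \<M> x. v \<bullet> w = 0) \<longrightarrow> L v = 0))"

definition orthonormal_frame :: "('d \<Rightarrow> real^'D) \<Rightarrow> (real^'D) set \<Rightarrow> bool" where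
  "orthonormal_frame e V \<longleftrightarrow>
     (\<forall>i j. e i \<bullet> e j = (if i = j then 1 else 0)) \<and> span (range e) = V"

text \<open>
  \<open>\<bar>det (D g x)\<bar>\<close>, where the derivative from the tangent space at \<open>x\<close> to the one at \<open>g x\<close> is written
  as a matrix in orthonormal bases; the absolute value does not depend on the bases.
\<close>

definition abs_det_deriv ::
    "'d::finite itself \<Rightarrow> (real^'D) set \<Rightarrow> (real^'D \<Rightarrow> real^'D) \<Rightarrow> real^'D \<Rightarrow> real" where
  "abs_det_deriv d \<M> g x =
     (THE r. \<exists>(e :: 'd \<Rightarrow> real^'D) e'.
        orthonormal_frame e (tangent_space d \<M> x) \<and>
        orthonormal_frame e' (tangent_space d \<M> (g x)) \<and>
        r = \<bar>det ((\<chi> i j. e' i \<bullet> tangent_map d \<M> g x (e j)) :: real^'d^'d)\<bar>)"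

section \<open>The driving system and the nonautonomous flow\<close>

definition ode_flow_on ::
    "'z set \<Rightarrow> ('z \<Rightarrow> 'z) \<Rightarrow> (real \<Rightarrow> 'z \<Rightarrow> 'z::real_normed_vector) \<Rightarrow> bool" where
  "ode_flow_on \<Xi> g \<xi> \<longleftrightarrow>
     (\<forall>t. \<forall>z\<in>\<Xi>. \<xi> t z \<in> \<Xi>) \<and>
     (\<forall>z\<in>\<Xi>. \<xi> 0 z = z) \<and>
     (\<forall>s t. \<forall>z\<in>\<Xi>. \<xi> (s + t) z = \<xi> s (\<xi> t z)) \<and>
     (\<forall>t. \<forall>z\<in>\<Xi>. ((\<lambda>t. \<xi> t z) has_vector_derivative g (\<xi> t z)) (at t))"

definition ergodic_flow ::
    "'z::topological_space set \<Rightarrow> (real \<Rightarrow> 'z \<Rightarrow> 'z) \<Rightarrow> 'z measure \<Rightarrow> bool" where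
  "ergodic_flow \<Xi> \<xi> \<P> \<longleftrightarrow>
     prob_space \<P> \<and> space \<P> = \<Xi> \<and> sets \<P> = sets (restrict_space borel \<Xi>) \<and>
     (\<forall>t. \<xi> t \<in> measurable \<P> \<P> \<and> distr \<P> \<P> (\<xi> t) = \<P>) \<and>
     (\<forall>A\<in>sets \<P>. (\<forall>t. \<xi> t -` A \<inter> \<Xi> = A) \<longrightarrow> measure \<P> A = 0 \<or> measure \<P> A = 1)"

text \<open>
  The third condition (the cocycle identity) follows from the ODE when solutions are unique; it is
  what makes the solution operators a flow over \<open>\<xi>\<close>.
\<close>

definition nonautonomous_flow ::
    "'d::finite itself \<Rightarrow> (real^'D) set \<Rightarrow> 'z set \<Rightarrow> (real \<Rightarrow> 'z \<Rightarrow> 'z) \<Rightarrow>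
     ('z \<Rightarrow> real^'D \<Rightarrow> real^'D) \<Rightarrow> (real \<Rightarrow> 'z \<Rightarrow> real^'D \<Rightarrow> real^'D) \<Rightarrow> bool" where
  "nonautonomous_flow d \<M> \<Xi> \<xi> F \<phi> \<longleftrightarrow>
     (\<forall>z\<in>\<Xi>. \<forall>x\<in>\<M>. F z x \<in> tangent_space d \<M> x) \<and>
     (\<forall>t. \<forall>z\<in>\<Xi>. \<forall>x\<in>\<M>. \<phi> t z x \<in> \<M>) \<and>
     (\<forall>s t. \<forall>z\<in>\<Xi>. \<forall>x\<in>\<M>. \<phi> (s + t) z x = \<phi> s (\<xi> t z) (\<phi> t z x)) \<and>
     (\<forall>z\<in>\<Xi>. \<forall>x\<in>\<M>. \<phi> 0 z x = x) \<and>
     (\<forall>t. \<forall>z\<in>\<Xi>. \<forall>x\<in>\<M>. ((\<lambda>t. \<phi> t z x) has_vector_derivative F (\<xi> t z) (\<phi> t z x)) (at t)) \<and>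
     (\<forall>t. \<forall>z\<in>\<Xi>. \<phi> t z differentiable_on \<M>) \<and>
     (\<forall>z\<in>\<Xi>. continuous_on (UNIV \<times> \<M>) (\<lambda>(t, x). matrix (tangent_map d \<M> (\<phi> t z) x)))"

section \<open>Perron--Frobenius operators and their finite-rank approximations\<close>

definition perron_frobenius ::
    "'d::finite itself \<Rightarrow> (real^'D) set \<Rightarrow> (real \<Rightarrow> 'z \<Rightarrow> 'z) \<Rightarrow> (real \<Rightarrow> 'z \<Rightarrow> real^'D \<Rightarrow> real^'D) \<Rightarrow>
     real \<Rightarrow> 'z \<Rightarrow> (real^'D \<Rightarrow> real) \<Rightarrow> real^'D \<Rightarrow> real" where
  "perron_frobenius d \<M> \<xi> \<phi> t z f x =
     f (\<phi> (-t) (\<xi> t z) x) * abs_det_deriv d \<M> (\<phi> (-t) (\<xi> t z)) x"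

definition connected_partition :: "'a::topological_space measure \<Rightarrow> ('n \<Rightarrow> 'a set) \<Rightarrow> bool" where
  "connected_partition m B \<longleftrightarrow>
     disjoint_family B \<and> (\<Union>i. B i) = space m \<and>
     (\<forall>i. connected (B i) \<and> B i \<in> sets m \<and> measure m (B i) > 0)"

definition step_function :: "('n::finite \<Rightarrow> 'a set) \<Rightarrow> real^'n \<Rightarrow> 'a \<Rightarrow> real" where
  "step_function B u x = (\<Sum>i\<in>UNIV. u $ i * indicator (B i) x)"

definition step_projection ::
    "'a measure \<Rightarrow> ('n::finite \<Rightarrow> 'a set) \<Rightarrow> ('a \<Rightarrow> real) \<Rightarrow> 'a \<Rightarrow> real" where
  "step_projection m B f x =
     (\<Sum>i\<in>UNIV. (LINT y:B i|m. f y) / measure m (B i) * indicator (B i) x)"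

definition pf_matrix ::
    "'a measure \<Rightarrow> ('n::finite \<Rightarrow> 'a set) \<Rightarrow> (real \<Rightarrow> 'z \<Rightarrow> 'z) \<Rightarrow> (real \<Rightarrow> 'z \<Rightarrow> 'a \<Rightarrow> 'a) \<Rightarrow>
     real \<Rightarrow> 'z \<Rightarrow> real^'n^'n" where
  "pf_matrix m B \<xi> \<phi> t z =
     (\<chi> i j. measure m (B j \<inter> \<phi> (-t) (\<xi> t z) ` B i) / measure m (B i))"

section \<open>Real powers and ordered eigenspaces of symmetric matrices\<close>

definition diagonal :: "('n \<Rightarrow> real) \<Rightarrow> real^'n^'n" where
  "diagonal l = (\<chi> i j. if i = j then l i else 0)"

text \<open>
  For positive semidefinite \<open>A\<close> and \<open>s > 0\<close>; the result does not depend on the orthogonal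
  diagonalisation.
\<close>

definition psd_powr :: "real^'n^'n \<Rightarrow> real \<Rightarrow> real^'n^'n" where
  "psd_powr A s =
     (THE X. \<exists>Q l. orthogonal_matrix Q \<and> A = Q ** diagonal l ** transpose Q \<and>
                   X = Q ** diagonal (\<lambda>i. l i powr s) ** transpose Q)"

definition eigenvalues :: "real^'n^'n \<Rightarrow> real set" where
  "eigenvalues A = {r. \<exists>v. v \<noteq> 0 \<and> A *v v = r *\<^sub>R v}"

text \<open>
  The eigenspace of the \<open>j\<close>-th largest of the distinct eigenvalues, \<open>j \<ge> 1\<close>; it is empty (and so of
  dimension 0) if there are fewer than \<open>j\<close> eigenvalues.
\<close>

definition eigenspace :: "real^'n^'n \<Rightarrow> nat \<Rightarrow> (real^'n) set" where
  "eigenspace A j =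
     {v. \<exists>r\<in>eigenvalues A. card {s\<in>eigenvalues A. r \<le> s} = j \<and> A *v v = r *\<^sub>R v}"

section \<open>Approximate Oseledets spaces and functions\<close>

definition Psi ::
    "'a measure \<Rightarrow> ('n::finite \<Rightarrow> 'a set) \<Rightarrow> (real \<Rightarrow> 'z \<Rightarrow> 'z) \<Rightarrow> (real \<Rightarrow> 'z \<Rightarrow> 'a \<Rightarrow> 'a) \<Rightarrow>
     real \<Rightarrow> 'z \<Rightarrow> real^'n^'n" where
  "Psi m B \<xi> \<phi> M y =
     psd_powr (transpose (pf_matrix m B \<xi> \<phi> M y) ** pf_matrix m B \<xi> \<phi> M y) (1 / (2 * M))"

definition U_space ::
    "'a measure \<Rightarrow> ('n::finite \<Rightarrow> 'a set) \<Rightarrow> (real \<Rightarrow> 'z \<Rightarrow> 'z) \<Rightarrow> (real \<Rightarrow> 'z \<Rightarrow> 'a \<Rightarrow> 'a) \<Rightarrow>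
     real \<Rightarrow> nat \<Rightarrow> 'z \<Rightarrow> (real^'n) set" where
  "U_space m B \<xi> \<phi> M j y = eigenspace (Psi m B \<xi> \<phi> M y) j"

definition W_space ::
    "'a measure \<Rightarrow> ('n::finite \<Rightarrow> 'a set) \<Rightarrow> (real \<Rightarrow> 'z \<Rightarrow> 'z) \<Rightarrow> (real \<Rightarrow> 'z \<Rightarrow> 'a \<Rightarrow> 'a) \<Rightarrow>
     real \<Rightarrow> real \<Rightarrow> nat \<Rightarrow> 'z \<Rightarrow> (real^'n) set" where
  "W_space m B \<xi> \<phi> M N j z =
     (\<lambda>v. pf_matrix m B \<xi> \<phi> N (\<xi> (-N) z) *v v) ` U_space m B \<xi> \<phi> M j (\<xi> (-N) z)"

text \<open>
  A unit-norm element \<open>u\<close> of the second eigenspace at \<open>y\<close>. If that eigenspace is one-dimensional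
  there are exactly two of them, \<open>u\<close> and \<open>- u\<close>.
\<close>

definition normalised_second_vector ::
    "(real^'D) measure \<Rightarrow> ('n::finite \<Rightarrow> (real^'D) set) \<Rightarrow> (real \<Rightarrow> 'z \<Rightarrow> 'z) \<Rightarrow>
     (real \<Rightarrow> 'z \<Rightarrow> real^'D \<Rightarrow> real^'D) \<Rightarrow> real \<Rightarrow> 'z \<Rightarrow> real^'n \<Rightarrow> bool" where
  "normalised_second_vector m B \<xi> \<phi> M y u \<longleftrightarrow>
     u \<in> U_space m B \<xi> \<phi> M 2 y \<and> L1_norm m (step_function B u) = 1"

text \<open>The argument \<open>u\<close> is the selection \<open>y \<mapsto> u\<^sub>2(y)\<close> of normalised vectors.\<close>

definition f_hat ::
    "'d::finite itself \<Rightarrow> (real^'D) set \<Rightarrow> (real^'D) measure \<Rightarrow> ('n::finite \<Rightarrow> (real^'D) set) \<Rightarrow>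
     (real \<Rightarrow> 'z \<Rightarrow> 'z) \<Rightarrow> (real \<Rightarrow> 'z \<Rightarrow> real^'D \<Rightarrow> real^'D) \<Rightarrow> real \<Rightarrow>
     ('z \<Rightarrow> real^'n) \<Rightarrow> 'z \<Rightarrow> real^'D \<Rightarrow> real" where
  "f_hat d \<M> m B \<xi> \<phi> N u z =
     step_projection m B
       (perron_frobenius d \<M> \<xi> \<phi> N (\<xi> (-N) z) (step_function B (u (\<xi> (-N) z))))"

end

theory Submission
  imports Defs
begin

text \<open>
  In the basis of indicator functions \<open>f_hat\<close> at the base point \<open>\<xi> \<delta> z\<close> has coefficients that are
  finite sums of products of two factors: the coordinates of the normalised eigenvector \<open>u\<^sub>2\<close> at
  \<open>\<xi> (-N + \<delta>) z\<close>, and integrals of \<open>(\<chi> \<circ> \<psi>\<^sub>\<delta>) \<bar>det D\<psi>\<^sub>\<delta>\<bar>\<close> over a member of the partition, where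
  \<open>\<psi>\<^sub>\<delta> = \<phi> (-N) (\<xi> \<delta> z)\<close> and \<open>\<chi>\<close> is the indicator of another member. It suffices that both factors
  converge as \<open>\<delta> \<rightarrow> 0\<close>, for a suitable choice of the sign of \<open>u\<^sub>2\<close>.

  \<^bold>\<open>Moving the base point.\<close> Regularity of the flow is known for one base point \<open>w\<close> at a time, whereas
  the maps of interest have the form \<open>\<phi> s (\<xi> \<delta> w)\<close>. The cocycle identity gives
  \<open>\<phi> s (\<xi> \<delta> w) = \<phi> (s + \<delta>) w \<circ> (\<phi> \<delta> w)\<inverse>\<close>. For small \<open>\<delta>\<close> the derivative of \<open>\<phi> \<delta> w\<close> is uniformly
  close to the identity on tangent vectors, which controls the derivative of the inverse
  (\<open>D_shifted_flow\<close>). Hence the derivatives of \<open>\<phi> s (\<xi> \<delta> w)\<close> are bounded uniformly in \<open>\<delta>\<close> and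
  converge pointwise, and the maps themselves converge uniformly. The inverse of \<open>\<phi> s (\<xi> \<delta> w)\<close> is a
  map of the same form, based on the orbit point \<open>\<xi> s w\<close>, so the same holds for the inverses.

  \<^bold>\<open>Convergence of indicators.\<close> A map whose derivative along the manifold is bounded by \<open>K\<close> increases
  measure by at most a factor that depends only on \<open>K\<close> and the manifold
  (\<open>emeasure_image_le_of_tangent_bound\<close>; the proof uses a finite atlas and Vitali's covering lemma). Applied to the inverses, this bounds the
  measure of preimages uniformly in \<open>\<delta>\<close>. Together with inner regularity and uniform convergence it
  yields \<open>\<chi> \<circ> \<psi>\<^sub>\<delta> \<rightarrow> \<chi> \<circ> \<psi>\<^sub>0\<close> in \<open>L\<^sup>1\<close> for the indicator \<open>\<chi>\<close> of an arbitrary measurable set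
  (\<open>measure_symmetric_difference_tendsto\<close>). Consequently the matrices \<open>P\<^sup>(\<^sup>M\<^sup>)(\<xi> \<delta> w)\<close> converge
  (\<open>pf_matrix_tendsto\<close>). The Jacobians are bounded and converge pointwise, hence in \<open>L\<^sup>1\<close>, and with
  them the integrals above (\<open>transported_mass_tendsto\<close>).

  \<^bold>\<open>Convergence of eigenvectors.\<close> The spaces \<open>U\<^sub>j\<close> are the eigenspaces of the symmetric matrices
  \<open>P\<^sup>T P\<close>, since a positive power preserves the order of nonnegative eigenvalues
  (\<open>psd_powr_spectrum\<close>). As the number of distinct eigenvalues is constant, the second largest one
  converges to the second largest one of the limit (\<open>ranked_eigenvalue_tendsto\<close>). A limit of
  normalised eigenvectors is then a normalised vector in the line \<open>U\<^sub>2\<close> at \<open>\<delta> = 0\<close>, that is, \<open>u\<^sub>2\<close> or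
  \<open>- u\<^sub>2\<close> (\<open>simple_eigenvector_continuous_up_to_sign\<close>); the sign function is chosen so that it is
  \<open>u\<^sub>2\<close>.
\<close>

section \<open>Symmetric matrices: real powers and perturbation of eigenvectors\<close>

text \<open>
  Induction on the dimension. A maximiser of the quadratic form \<open>x \<mapsto> x \<bullet> A x\<close> on the unit sphere
  of the subspace is an eigenvector, because the form cannot grow to first order in any
  direction of the subspace; its orthogonal complement within the subspace is again invariant,
  by symmetry of \<open>A\<close>.
\<close>

lemma orthonormal_eigenbasis_of_invariant_subspace:
  fixes A :: "real^'n^'n" and S :: "(real^'n) set"
  assumes sym: "transpose A = A" and "subspace S" and "\<And>x. x \<in> S \<Longrightarrow> A *v x \<in> S"
  shows "\<exists>E. E \<subseteq> S \<and> pairwise orthogonal E \<and> (\<forall>e\<in>E. norm e = 1 \<and> (\<exists>r. A *v e = r *\<^sub>R e)) \<and> span E = S"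
  using assms(2,3)
proof (induction "dim S" arbitrary: S rule: less_induct)
  case less
  show ?case
  proof (cases "S = {0}")
    case True
    then show ?thesis by (intro exI[of _ "{}"]) auto
  next
    case False
    have swap: "x \<bullet> (A *v y) = (A *v x) \<bullet> y" for x y
      by (metis dot_lmul_matrix inner_commute sym transpose_matrix_vector)
    define K where "K = S \<inter> sphere 0 1"
    obtain x where x: "x \<in> S" "x \<noteq> 0" using False subspace_0[OF less.prems(1)] by auto
    then have "(1 / norm x) *\<^sub>R x \<in> K"
      using less.prems(1) by (auto simp: K_def subspace_scale)
    then have "K \<noteq> {}" by auto
    moreover have "compact K"
      unfolding K_def using closed_subspace[OF less.prems(1)] by (auto intro: closed_Int_compact)
    moreover have "continuous_on K (\<lambda>x. x \<bullet> (A *v x))"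
      by (intro continuous_intros)
    ultimately obtain v where v: "v \<in> K" "\<And>y. y \<in> K \<Longrightarrow> y \<bullet> (A *v y) \<le> v \<bullet> (A *v v)"
      using continuous_attains_sup by metis
    then have vS: "v \<in> S" and v1: "norm v = 1" by (auto simp: K_def)
    have vv: "v \<bullet> v = 1" using v1 by (simp add: norm_eq_1)
    define r where "r = v \<bullet> (A *v v)"
    have quad: "x \<bullet> (A *v x) \<le> r * (x \<bullet> x)" if "x \<in> S" for x
    proof (cases "x = 0")
      case False
      have "(1 / norm x) *\<^sub>R x \<in> K"
        using less.prems(1) that False by (auto simp: K_def subspace_scale)
      from v(2)[OF this] have "(x \<bullet> (A *v x)) / (norm x)^2 \<le> r"
        by (simp add: r_def matrix_vector_mult_scaleR power2_eq_square)
      then show ?thesis using False by (simp add: field_simps dot_square_norm)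
    qed simp
    define y where "y = A *v v - r *\<^sub>R v"
    have yS: "y \<in> S"
      unfolding y_def using less.prems vS by (auto intro!: subspace_diff subspace_scale)
    have "2 * t * (y \<bullet> y) \<le> t^2 * (r * (y \<bullet> y) - y \<bullet> (A *v y))" for t
    proof -
      have *: "v + t *\<^sub>R y \<in> S" using less.prems vS yS by (auto intro!: subspace_add subspace_scale)
      have e1: "y \<bullet> (A *v v) = y \<bullet> y + r * (v \<bullet> y)"
        unfolding y_def by (simp add: algebra_simps inner_commute)
      have e2: "v \<bullet> (A *v y) = y \<bullet> (A *v v)"
        using swap[of v y] by (simp add: inner_commute)
      show ?thesis
        using quad[OF *] e1 e2 vv
        by (simp add: matrix_vector_right_distrib matrix_vector_mult_scaleR inner_add_left inner_add_right
             r_def[symmetric] algebra_simps power2_eq_square inner_commute)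
    qed
    note q = this
    have "y \<bullet> y = 0"
    proof (rule ccontr)
      assume ne: "y \<bullet> y \<noteq> 0"
      then have pos: "y \<bullet> y > 0" by (simp add: inner_gt_zero_iff)
      define c where "c = r * (y \<bullet> y) - y \<bullet> (A *v y)"
      \<comment> \<open>So small that the quadratic term in \<open>t\<close> cannot compensate the linear one.\<close>
      define t where "t = (y \<bullet> y) / (\<bar>c\<bar> + 1)"
      have t: "t > 0" using pos by (simp add: t_def)
      have "2 * (y \<bullet> y) \<le> t * c"
        using q[of t] t by (simp add: c_def power2_eq_square)
      also have "\<dots> \<le> t * (\<bar>c\<bar> + 1)" using t by (intro mult_left_mono) auto
      also have "\<dots> = y \<bullet> y" by (simp add: t_def add_nonneg_eq_0_iff)
      finally show False using pos by simp
    qed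
    then have Av: "A *v v = r *\<^sub>R v" by (simp add: y_def)
    define S' where "S' = {x\<in>S. v \<bullet> x = 0}"
    have subS': "subspace S'"
      using less.prems(1) unfolding S'_def subspace_def by (auto simp: inner_add_right)
    have "v \<notin> S'" using vv by (simp add: S'_def)
    then have "S' \<subset> S" using vS unfolding S'_def by blast
    then have "dim S' < dim S"
      using dim_psubset subS' less.prems(1) by (metis span_eq_iff)
    moreover have "A *v x \<in> S'" if "x \<in> S'" for x
      using that less.prems(2) swap[of v x] Av by (auto simp: S'_def)
    ultimately obtain E where E: "E \<subseteq> S'" "pairwise orthogonal E"
        "\<forall>e\<in>E. norm e = 1 \<and> (\<exists>r. A *v e = r *\<^sub>R e)" "span E = S'"
      using less.hyps subS' by meson
    show ?thesis
    proof (intro exI conjI)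
      show "insert v E \<subseteq> S" using E(1) vS by (auto simp: S'_def)
      show "pairwise orthogonal (insert v E)"
        using E(1,2) by (auto simp: pairwise_insert orthogonal_def S'_def inner_commute)
      show "\<forall>e\<in>insert v E. norm e = 1 \<and> (\<exists>r. A *v e = r *\<^sub>R e)"
        using E(3) v1 Av by auto
      show "span (insert v E) = S"
      proof
        show "span (insert v E) \<subseteq> S"
          using E(1) vS less.prems(1) by (intro span_minimal) (auto simp: S'_def)
        show "S \<subseteq> span (insert v E)"
        proof
          fix x assume x: "x \<in> S"
          have "x - (v \<bullet> x) *\<^sub>R v \<in> S'"
            using x vS less.prems(1) vv by (auto simp: S'_def inner_diff_right intro!: subspace_diff subspace_scale)
          then have "x - (v \<bullet> x) *\<^sub>R v \<in> span E" using E(4) by simp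
          then show "x \<in> span (insert v E)" by (auto simp: span_insert)
        qed
      qed
    qed
  qed
qed

abbreviation spectral :: "real^'n^'n \<Rightarrow> ('n \<Rightarrow> real) \<Rightarrow> real^'n^'n" where
  "spectral Q l \<equiv> Q ** diagonal l ** transpose Q"

lemma diagonal_vector_nth: "(diagonal l *v w) $ i = l i * w $ i"
  by (simp add: diagonal_def matrix_vector_mult_def if_distrib[where f="\<lambda>x. x * _"] cong: if_cong)

lemma symmetric_matrix_diagonalisable:
  fixes A :: "real^'n^'n"
  assumes "transpose A = A"
  obtains Q l where "orthogonal_matrix Q" "A = spectral Q l"
proof -
  obtain E where E: "pairwise orthogonal E" "\<forall>e\<in>E. norm e = 1 \<and> (\<exists>r. A *v e = r *\<^sub>R e)"
      "span E = (UNIV :: (real^'n) set)"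
    using orthonormal_eigenbasis_of_invariant_subspace[OF assms subspace_UNIV] by auto
  have "0 \<notin> E" using E(2) by force
  then have ind: "independent E" by (rule pairwise_orthogonal_independent[OF E(1)])
  then have "card E = CARD('n)"
    using E(3) by (metis dim_UNIV dim_span_eq_card_independent DIM_cart DIM_real mult.right_neutral)
  then obtain f where f: "bij_betw f (UNIV :: 'n set) E"
    using independent_imp_finite[OF ind] finite_same_card_bij[of "UNIV :: 'n set" E] by auto
  obtain l where l: "\<And>i. A *v f i = l i *\<^sub>R f i"
  proof -
    have "\<forall>i. \<exists>r. A *v f i = r *\<^sub>R f i" using E(2) f by (auto simp: bij_betw_def)
    then show thesis using that by metis
  qed
  have on: "f i \<bullet> f j = (if i = j then 1 else 0)" for i j
    using E(1,2) f unfolding pairwise_def orthogonal_def bij_betw_def inj_on_def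
    by (metis UNIV_I norm_eq_1 rangeI)
  define Q :: "real^'n^'n" where "Q = (\<chi> i j. f j $ i)"
  have col: "Q *v axis j 1 = f j" for j
    by (simp add: Q_def vec_eq_iff matrix_vector_mult_basis column_def)
  have "transpose Q ** Q = mat 1"
    using on by (simp add: Q_def transpose_def matrix_matrix_mult_def mat_def vec_eq_iff inner_vec_def)
  then have Q: "orthogonal_matrix Q" by (simp add: orthogonal_matrix)
  then have QQ: "Q ** transpose Q = mat 1" by (simp add: orthogonal_matrix_def)
  have "A ** Q = Q ** diagonal l"
  proof -
    have "(A ** Q) *v axis j 1 = (Q ** diagonal l) *v axis j 1" for j
    proof -
      have d: "diagonal l *v axis j 1 = l j *\<^sub>R axis j 1"
        by (simp add: vec_eq_iff diagonal_vector_nth axis_def)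
      show ?thesis
        by (simp add: matrix_vector_mul_assoc[symmetric] col l d matrix_vector_mult_scaleR)
    qed
    then have "column j (A ** Q) = column j (Q ** diagonal l)" for j
      by (simp add: matrix_vector_mult_basis)
    then show ?thesis by (simp add: vec_eq_iff column_def)
  qed
  then have "A = spectral Q l"
    using QQ by (metis matrix_mul_assoc matrix_mul_rid)
  then show thesis using that Q by blast
qed

text \<open>
  In the coordinates \<open>Q\<^sup>T v\<close> the eigenvalue equation decouples. This description of eigenvectors
  mentions \<open>l\<close> only through the equations \<open>l i = r\<close>, so it shows at a glance what happens to
  eigenspaces when an injective function is applied to \<open>l\<close>.
\<close>

lemma conjugated_diagonal_eigen_iff:
  fixes Q :: "real^'n^'n"
  assumes Q: "orthogonal_matrix Q"
  shows "spectral Q l *v v = r *\<^sub>R v \<longleftrightarrow>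
         (\<forall>i. l i = r \<or> (transpose Q *v v) $ i = 0)"
proof -
  have Q1: "transpose Q ** Q = mat 1" and Q2: "Q ** transpose Q = mat 1"
    using Q by (auto simp: orthogonal_matrix_def)
  define w where "w = transpose Q *v v"
  have v: "v = Q *v w" by (simp add: w_def matrix_vector_mul_assoc Q2 del: transpose_matrix_vector)
  have inj: "Q *v a = Q *v b \<longleftrightarrow> a = b" for a b
    by (metis Q1 matrix_vector_mul_assoc matrix_vector_mul_lid)
  have "spectral Q l *v v = Q *v (diagonal l *v w)"
    by (simp add: w_def matrix_vector_mul_assoc matrix_mul_assoc del: transpose_matrix_vector)
  moreover have "r *\<^sub>R v = Q *v (r *\<^sub>R w)" by (simp add: v matrix_vector_mult_scaleR)
  ultimately have "spectral Q l *v v = r *\<^sub>R v \<longleftrightarrow> diagonal l *v w = r *\<^sub>R w"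
    by (simp add: inj)
  then show ?thesis
    unfolding w_def[symmetric] by (auto simp: vec_eq_iff diagonal_vector_nth)
qed

lemma eigenvalues_conjugated_diagonal:
  fixes Q :: "real^'n^'n"
  assumes Q: "orthogonal_matrix Q"
  shows "eigenvalues (spectral Q l) = range l"
proof -
  have Q1: "transpose Q ** Q = mat 1" and Q2: "Q ** transpose Q = mat 1"
    using Q by (auto simp: orthogonal_matrix_def)
  show ?thesis
  proof (intro equalityI subsetI)
    fix r assume "r \<in> eigenvalues (spectral Q l)"
    then obtain v where v: "v \<noteq> 0" "\<forall>i. l i = r \<or> (transpose Q *v v) $ i = 0"
      unfolding eigenvalues_def conjugated_diagonal_eigen_iff[OF Q] by auto
    have "transpose Q *v v \<noteq> 0"
      using v(1) Q2 by (metis matrix_vector_mul_assoc matrix_vector_mul_lid matrix_vector_mult_0_right)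
    then show "r \<in> range l" using v(2) by (auto simp: vec_eq_iff)
  next
    fix r assume "r \<in> range l"
    then obtain i where i: "r = l i" by auto
    have tv: "transpose Q *v (Q *v axis i 1) = axis i 1"
      by (simp add: matrix_vector_mul_assoc Q1 del: transpose_matrix_vector)
    then have nz: "Q *v axis i 1 \<noteq> 0"
      by (metis axis_eq_0_iff matrix_vector_mult_0_right zero_neq_one)
    have "spectral Q l *v (Q *v axis i 1) = r *\<^sub>R (Q *v axis i 1)"
      unfolding conjugated_diagonal_eigen_iff[OF Q] tv by (auto simp: axis_def i)
    with nz show "r \<in> eigenvalues (spectral Q l)"
      unfolding eigenvalues_def by blast
  qed
qed

lemma finite_eigenvalues_symmetric:
  fixes A :: "real^'n^'n"
  assumes "transpose A = A"
  shows "finite (eigenvalues A)"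
  by (metis symmetric_matrix_diagonalisable[OF assms] eigenvalues_conjugated_diagonal finite_imageI finite_code)

text \<open>
  The candidates for the power agree on the columns of any other diagonalising matrix \<open>Q'\<close>: such
  a column is an eigenvector of the original matrix for \<open>l' i\<close>, hence an eigenvector of both
  candidates for \<open>l' i powr s\<close>. So the definite description in the definition of the power picks
  a unique matrix.
\<close>

lemma psd_powr_conjugated_diagonal:
  fixes Q :: "real^'n^'n"
  assumes Q: "orthogonal_matrix Q"
  shows "psd_powr (spectral Q l) s = spectral Q (\<lambda>i. l i powr s)"
  unfolding psd_powr_def
proof (rule the_equality)
  show "\<exists>Q' l'. orthogonal_matrix Q' \<and> spectral Q l = spectral Q' l' \<and>
      spectral Q (\<lambda>i. l i powr s) = spectral Q' (\<lambda>i. l' i powr s)"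
    using Q by blast
next
  fix X
  assume "\<exists>Q' l'. orthogonal_matrix Q' \<and> spectral Q l = spectral Q' l' \<and>
      X = spectral Q' (\<lambda>i. l' i powr s)"
  then obtain Q' l' where Q': "orthogonal_matrix Q'"
    and eq: "spectral Q l = spectral Q' l'"
    and X: "X = spectral Q' (\<lambda>i. l' i powr s)" by blast
  define Y where "Y = spectral Q (\<lambda>i. l i powr s)"
  have Q1: "transpose Q' ** Q' = mat 1" "Q' ** transpose Q' = mat 1"
    using Q' by (auto simp: orthogonal_matrix_def)
  have "X *v (Q' *v axis i 1) = Y *v (Q' *v axis i 1)" for i
  proof -
    let ?v = "Q' *v axis i 1"
    have tv: "transpose Q' *v ?v = axis i 1"
      by (simp add: matrix_vector_mul_assoc Q1 del: transpose_matrix_vector)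
    have "spectral Q' l' *v ?v = l' i *\<^sub>R ?v"
      unfolding conjugated_diagonal_eigen_iff[OF Q'] tv by (auto simp: axis_def)
    then have "\<forall>k. l k = l' i \<or> (transpose Q *v ?v) $ k = 0"
      unfolding eq[symmetric] conjugated_diagonal_eigen_iff[OF Q] .
    then have "\<forall>k. l k powr s = l' i powr s \<or> (transpose Q *v ?v) $ k = 0"
      by metis
    then have 1: "Y *v ?v = (l' i powr s) *\<^sub>R ?v"
      unfolding Y_def conjugated_diagonal_eigen_iff[OF Q] .
    have "X *v ?v = (l' i powr s) *\<^sub>R ?v"
      unfolding X conjugated_diagonal_eigen_iff[OF Q'] tv by (auto simp: axis_def)
    with 1 show ?thesis by simp
  qed
  then have "(X ** Q') *v axis i 1 = (Y ** Q') *v axis i 1" for i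
    by (simp add: matrix_vector_mul_assoc)
  then have "column i (X ** Q') = column i (Y ** Q')" for i
    by (simp add: matrix_vector_mult_basis)
  then have "X ** Q' = Y ** Q'" by (simp add: vec_eq_iff column_def)
  then have "X = Y" using Q1 by (metis matrix_mul_assoc matrix_mul_rid)
  then show "X = spectral Q (\<lambda>i. l i powr s)" by (simp add: Y_def)
qed

text \<open>
  On the nonnegative reals a positive power is strictly increasing. It therefore changes neither
  the number of distinct eigenvalues, nor their order, nor the eigenspaces. This is what allows
  the eigenspaces of \<open>Psi\<close> to be replaced by those of \<open>P\<^sup>T P\<close>, whose dependence on the base
  point is easier to control.
\<close>

lemma psd_powr_spectrum:
  fixes A :: "real^'n^'n"
  assumes sym: "transpose A = A" and psd: "\<And>v. 0 \<le> v \<bullet> (A *v v)" and s: "s > 0"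
  shows card_eigenvalues_psd_powr: "card (eigenvalues (psd_powr A s)) = card (eigenvalues A)"
    and eigenspace_psd_powr: "eigenspace (psd_powr A s) j = eigenspace A j"
proof -
  obtain Q l where Q: "orthogonal_matrix Q" and A: "A = spectral Q l"
    using symmetric_matrix_diagonalisable[OF sym] .
  let ?X = "psd_powr A s"
  have X: "?X = spectral Q (\<lambda>i. l i powr s)"
    unfolding A by (rule psd_powr_conjugated_diagonal[OF Q])
  have ev: "eigenvalues A = range l" "eigenvalues ?X = (\<lambda>r. r powr s) ` range l"
    unfolding X eigenvalues_conjugated_diagonal[OF Q]
    by (simp_all add: A eigenvalues_conjugated_diagonal[OF Q] image_image)
  have nn: "r \<ge> 0" if "r \<in> range l" for r
  proof -
    from that obtain v where v: "v \<noteq> 0" "A *v v = r *\<^sub>R v"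
      unfolding ev(1)[symmetric] eigenvalues_def by auto
    then show ?thesis using psd[of v] inner_gt_zero_iff[of v]
      by (metis inner_scaleR_right mult_less_0_iff not_le)
  qed
  have mono: "a powr s \<le> b powr s \<longleftrightarrow> a \<le> b" if "a \<in> range l" "b \<in> range l" for a b
    using nn[OF that(1)] nn[OF that(2)] s by (smt (verit) powr_less_mono2 powr_mono2)
  have inj: "inj_on (\<lambda>r. r powr s) (range l)"
    by (intro inj_onI antisym) (metis mono order_refl)+
  show "card (eigenvalues ?X) = card (eigenvalues A)"
    unfolding ev by (rule card_image[OF inj])
  have cnt: "card {t \<in> eigenvalues ?X. r powr s \<le> t} = card {t \<in> eigenvalues A. r \<le> t}" if "r \<in> range l" for r
  proof -
    have "{t \<in> eigenvalues ?X. r powr s \<le> t} = (\<lambda>r. r powr s) ` {t \<in> eigenvalues A. r \<le> t}"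
      using mono that unfolding ev by auto
    then show ?thesis
      using inj unfolding ev by (simp add: card_image inj_on_subset[OF inj])
  qed
  have eig: "?X *v v = (r powr s) *\<^sub>R v \<longleftrightarrow> A *v v = r *\<^sub>R v" if "r \<in> range l" for r v
  proof -
    have "l i powr s = r powr s \<longleftrightarrow> l i = r" for i
      using inj that by (auto simp: inj_on_def)
    moreover have "?X *v v = (r powr s) *\<^sub>R v \<longleftrightarrow> (\<forall>i. l i powr s = r powr s \<or> (transpose Q *v v) $ i = 0)"
      unfolding X by (rule conjugated_diagonal_eigen_iff[OF Q])
    moreover have "A *v v = r *\<^sub>R v \<longleftrightarrow> (\<forall>i. l i = r \<or> (transpose Q *v v) $ i = 0)"
      by (subst A) (rule conjugated_diagonal_eigen_iff[OF Q])
    ultimately show ?thesis by simp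
  qed
  show "eigenspace ?X j = eigenspace A j"
  proof -
    have "v \<in> eigenspace ?X j \<longleftrightarrow> (\<exists>r\<in>range l. card {t \<in> eigenvalues ?X. r powr s \<le> t} = j \<and> ?X *v v = (r powr s) *\<^sub>R v)" for v
      unfolding eigenspace_def by (simp add: ev(2))
    also have "\<dots> v \<longleftrightarrow> (\<exists>r\<in>range l. card {t \<in> eigenvalues A. r \<le> t} = j \<and> A *v v = r *\<^sub>R v)" for v
      using cnt eig by (metis (no_types, lifting))
    finally show ?thesis unfolding eigenspace_def ev(1) by auto
  qed
qed


text \<open>
  If all eigenvalues had distance at least \<open>\<epsilon>\<close> from \<open>s\<close>, then \<open>A - s\<close> would stretch every vector
  by a factor of at least \<open>\<epsilon>\<close>, as is seen in an orthonormal eigenbasis.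
\<close>

lemma eigenvalue_near_approximate_eigenvector:
  fixes A :: "real^'n^'n"
  assumes sym: "transpose A = A" and v: "norm v = 1" and small: "norm (A *v v - s *\<^sub>R v) < \<epsilon>"
  shows "\<exists>r\<in>eigenvalues A. \<bar>r - s\<bar> < \<epsilon>"
proof (rule ccontr)
  assume "\<not> ?thesis"
  then have far: "\<epsilon> \<le> \<bar>r - s\<bar>" if "r \<in> eigenvalues A" for r using that by force
  have "\<epsilon> > 0" using small norm_ge_zero[of "A *v v - s *\<^sub>R v"] by linarith
  obtain Q l where Q: "orthogonal_matrix Q" and A: "A = spectral Q l"
    using symmetric_matrix_diagonalisable[OF sym] .
  have ev: "eigenvalues A = range l"
    by (simp add: A eigenvalues_conjugated_diagonal[OF Q])
  have Q2: "Q ** transpose Q = mat 1" using Q by (simp add: orthogonal_matrix_def)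
  have iso: "norm (transpose Q *v x) = norm x" "norm (Q *v x) = norm x" for x
    using Q by (auto intro!: orthogonal_transformation_norm simp: orthogonal_transformation_matrix simp del: transpose_matrix_vector)
  define w where "w = transpose Q *v v"
  have vw: "v = Q *v w" by (simp add: w_def matrix_vector_mul_assoc Q2 del: transpose_matrix_vector)
  have "A *v v - s *\<^sub>R v = Q *v (diagonal l *v w) - s *\<^sub>R (Q *v w)"
    by (simp add: A w_def matrix_vector_mul_assoc matrix_mul_assoc Q2 del: transpose_matrix_vector)
  also have "\<dots> = Q *v (diagonal l *v w - s *\<^sub>R w)"
    by (simp add: matrix_vector_mult_diff_distrib matrix_vector_mult_scaleR)
  finally have "norm (A *v v - s *\<^sub>R v) = norm (diagonal l *v w - s *\<^sub>R w)"
    by (simp add: iso)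
  moreover have "\<epsilon> * norm w \<le> norm (diagonal l *v w - s *\<^sub>R w)"
  proof -
    have "norm (\<epsilon> *\<^sub>R w) \<le> norm (diagonal l *v w - s *\<^sub>R w)"
    proof (rule norm_le_componentwise_cart)
      fix i
      have "\<epsilon> \<le> \<bar>l i - s\<bar>" using far ev by blast
      then have "\<epsilon> * \<bar>w $ i\<bar> \<le> \<bar>l i - s\<bar> * \<bar>w $ i\<bar>" by (rule mult_right_mono) simp
      then show "norm ((\<epsilon> *\<^sub>R w) $ i) \<le> norm ((diagonal l *v w - s *\<^sub>R w) $ i)"
        using \<open>\<epsilon> > 0\<close> by (simp add: diagonal_vector_nth abs_mult[symmetric] algebra_simps) (simp add: abs_mult)
    qed
    then show ?thesis using \<open>\<epsilon> > 0\<close> by simp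
  qed
  moreover have "norm w = 1" using v by (simp add: w_def iso del: transpose_matrix_vector)
  ultimately show False using small by simp
qed

lemma norm_matrix_vector_le_sum:
  fixes A :: "real^'n^'m"
  shows "norm (A *v x) \<le> (\<Sum>i\<in>UNIV. \<Sum>j\<in>UNIV. \<bar>A $ i $ j\<bar>) * norm x"
proof -
  have "norm (A *v x) \<le> onorm ((*v) A) * norm x"
    by (rule onorm[OF matrix_vector_mul_bounded_linear])
  also have "\<dots> \<le> (\<Sum>i\<in>UNIV. \<Sum>j\<in>UNIV. \<bar>A $ i $ j\<bar>) * norm x"
    by (intro mult_right_mono onorm_le_matrix_component_sum) auto
  finally show ?thesis .
qed

lemma eventually_matrix_vector_diff_le:
  fixes A :: "'b \<Rightarrow> real^'n^'m"
  assumes "(A \<longlongrightarrow> A0) F" and "\<epsilon> > 0"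
  shows "\<forall>\<^sub>F \<delta> in F. \<forall>v. norm (A \<delta> *v v - A0 *v v) \<le> \<epsilon> * norm v"
proof -
  have "((\<lambda>\<delta>. \<Sum>i\<in>UNIV. \<Sum>j\<in>UNIV. \<bar>(A \<delta> - A0) $ i $ j\<bar>) \<longlongrightarrow> (\<Sum>i\<in>UNIV. \<Sum>j\<in>UNIV. \<bar>(A0 - A0) $ i $ j\<bar>)) F"
    by (intro tendsto_intros assms(1))
  then have "((\<lambda>\<delta>. \<Sum>i\<in>UNIV. \<Sum>j\<in>UNIV. \<bar>(A \<delta> - A0) $ i $ j\<bar>) \<longlongrightarrow> 0) F" by simp
  from order_tendstoD(2)[OF this assms(2)] show ?thesis
  proof eventually_elim
    case (elim \<delta>)
    show ?case
    proof
      fix v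
      have "norm ((A \<delta> - A0) *v v) \<le> (\<Sum>i\<in>UNIV. \<Sum>j\<in>UNIV. \<bar>(A \<delta> - A0) $ i $ j\<bar>) * norm v"
        by (rule norm_matrix_vector_le_sum)
      also have "\<dots> \<le> \<epsilon> * norm v" using elim by (intro mult_right_mono) auto
      finally show "norm (A \<delta> *v v - A0 *v v) \<le> \<epsilon> * norm v" by (simp add: matrix_vector_mult_diff_rdistrib)
    qed
  qed
qed

text \<open>
  Unit eigenvectors of the limit are approximate eigenvectors of \<open>A \<delta>\<close>, so each distinct
  eigenvalue of the limit has an eigenvalue of \<open>A \<delta>\<close> nearby. As the numbers of distinct
  eigenvalues agree, this correspondence is an order preserving bijection: no eigenvalue of the
  limit splits, and the \<open>j\<close>-th largest one is matched with the \<open>j\<close>-th largest one. Without the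
  assumption on the cardinalities an eigenvalue could split and shift the ranks.
\<close>

lemma ranked_eigenvalue_tendsto:
  fixes A :: "'b \<Rightarrow> real^'n^'n"
  assumes lim: "(A \<longlongrightarrow> A0) F"
    and sym: "\<And>\<delta>. transpose (A \<delta>) = A \<delta>" and sym0: "transpose A0 = A0"
    and cardeq: "\<forall>\<^sub>F \<delta> in F. card (eigenvalues (A \<delta>)) = card (eigenvalues A0)"
    and s: "s \<in> eigenvalues A0" "card {t\<in>eigenvalues A0. s \<le> t} = j"
    and "\<epsilon> > 0"
  shows "\<forall>\<^sub>F \<delta> in F. \<forall>r\<in>eigenvalues (A \<delta>). card {t\<in>eigenvalues (A \<delta>). r \<le> t} = j \<longrightarrow> \<bar>r - s\<bar> < \<epsilon>"
proof -
  let ?E = "eigenvalues A0"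
  have finE: "finite ?E" by (rule finite_eigenvalues_symmetric[OF sym0])
  obtain \<eta> where \<eta>: "\<eta> > 0" "\<eta> \<le> \<epsilon>" and sep: "\<And>a b. a \<in> ?E \<Longrightarrow> b \<in> ?E \<Longrightarrow> a < b \<Longrightarrow> 2 * \<eta> \<le> b - a"
  proof -
    \<comment> \<open>The gaps between eigenvalues; the extra element keeps the set nonempty and makes
      \<open>\<eta> \<le> \<epsilon>\<close>.\<close>
    define G where "G = insert (2 * \<epsilon>) {b - a | a b. a \<in> ?E \<and> b \<in> ?E \<and> a < b}"
    have "G \<subseteq> insert (2 * \<epsilon>) ((\<lambda>(a,b). b - a) ` (?E \<times> ?E))" by (auto simp: G_def)
    then have "finite G" by (rule finite_subset) (use finE in auto)
    moreover have "\<forall>x\<in>G. x > 0" using \<open>\<epsilon> > 0\<close> by (auto simp: G_def)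
    moreover have "G \<noteq> {}" by (simp add: G_def)
    ultimately have "Min G > 0" and "\<And>x. x \<in> G \<Longrightarrow> Min G \<le> x" by auto
    moreover have "2 * \<epsilon> \<in> G" and "b - a \<in> G" if "a \<in> ?E" "b \<in> ?E" "a < b" for a b
      using that by (auto simp: G_def)
    ultimately show thesis
      by (intro that[of "Min G / 2"]) (force simp: G_def)+
  qed
  obtain v where v: "\<And>t. t \<in> ?E \<Longrightarrow> norm (v t) = 1 \<and> A0 *v v t = t *\<^sub>R v t"
  proof -
    have "\<exists>w. norm w = 1 \<and> A0 *v w = t *\<^sub>R w" if t: "t \<in> ?E" for t
    proof -
      obtain w where "w \<noteq> 0" "A0 *v w = t *\<^sub>R w" using t unfolding eigenvalues_def by auto
      then show ?thesis
        by (intro exI[of _ "(1 / norm w) *\<^sub>R w"]) (simp add: matrix_vector_mult_scaleR)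
    qed
    then show thesis using that by metis
  qed
  have "\<forall>\<^sub>F \<delta> in F. \<forall>w. norm (A \<delta> *v w - A0 *v w) \<le> (\<eta> / 2) * norm w"
    by (rule eventually_matrix_vector_diff_le[OF lim]) (use \<eta> in simp)
  with cardeq show ?thesis
  proof eventually_elim
    case (elim \<delta>)
    let ?D = "eigenvalues (A \<delta>)"
    have finD: "finite ?D" by (rule finite_eigenvalues_symmetric[OF sym])
    have "\<exists>r\<in>?D. \<bar>r - t\<bar> < \<eta>" if "t \<in> ?E" for t
    proof (rule eigenvalue_near_approximate_eigenvector[OF sym])
      show "norm (v t) = 1" using v[OF that] by simp
      have "norm (A \<delta> *v v t - A0 *v v t) \<le> \<eta> / 2" using elim(2) v[OF that] by (metis mult.right_neutral)
      then show "norm (A \<delta> *v v t - t *\<^sub>R v t) < \<eta>" using v[OF that] \<eta>(1) by simp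
    qed
    then obtain \<tau> where \<tau>: "\<And>t. t \<in> ?E \<Longrightarrow> \<tau> t \<in> ?D \<and> \<bar>\<tau> t - t\<bar> < \<eta>" by metis
    have less: "\<tau> a < \<tau> b" if "a \<in> ?E" "b \<in> ?E" "a < b" for a b
      using \<tau>[OF that(1)] \<tau>[OF that(2)] sep[OF that] by linarith
    have le: "\<tau> a \<le> \<tau> b \<longleftrightarrow> a \<le> b" if "a \<in> ?E" "b \<in> ?E" for a b
      using less[OF that] less[OF that(2,1)] by (cases a b rule: linorder_cases) auto
    have inj: "inj_on \<tau> ?E" by (intro inj_onI antisym) (metis le order_refl)+
    have "\<tau> ` ?E = ?D"
      using finD \<tau> elim(1) by (intro card_subset_eq) (auto simp: card_image[OF inj])
    show ?case
    proof (intro ballI impI)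
      fix r assume r: "r \<in> ?D" "card {t\<in>?D. r \<le> t} = j"
      then obtain a where a: "a \<in> ?E" "r = \<tau> a" using \<open>\<tau> ` ?E = ?D\<close> by auto
      have "{t\<in>?D. r \<le> t} = \<tau> ` {t\<in>?E. a \<le> t}"
      proof -
        have e: "{t\<in>?E. \<tau> a \<le> \<tau> t} = {t\<in>?E. a \<le> t}" using le[OF a(1)] by blast
        have "{t\<in>?D. r \<le> t} = {t\<in>\<tau> ` ?E. \<tau> a \<le> t}" using \<open>\<tau> ` ?E = ?D\<close> a(2) by simp
        also have "\<dots> = \<tau> ` {t\<in>?E. \<tau> a \<le> \<tau> t}" by blast
        finally show ?thesis unfolding e .
      qed
      then have ja: "card {t\<in>?E. a \<le> t} = j"
        using r(2) by (simp add: card_image inj_on_subset[OF inj])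
      have "a = s"
      proof (rule ccontr)
        assume "a \<noteq> s"
        have "card {t\<in>?E. y \<le> t} < card {t\<in>?E. x \<le> t}" if "x \<in> ?E" "x < y" for x y
          using finE that by (intro psubset_card_mono) force+
        then show False
          using a(1) s(1) ja s(2) \<open>a \<noteq> s\<close> by (cases a s rule: linorder_cases) fastforce+
      qed
      then show "\<bar>r - s\<bar> < \<epsilon>" using \<tau>[OF a(1)] a(2) \<eta>(2) by simp
    qed
  qed
qed

text \<open>
  The normalised vectors \<open>v\<close> at distance at least \<open>\<epsilon>\<close> from \<open>u0\<close> and \<open>- u0\<close> form a compact set,
  on which the defect \<open>\<parallel>A0 v - s v\<parallel>\<close> has a positive minimum, because the eigenspace is a line.
  The defect of \<open>u \<delta>\<close> tends to zero, so \<open>u \<delta>\<close> eventually leaves that set. The normalisation is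
  an abstract function \<open>p\<close>, since the vectors are scaled in a weighted \<open>L\<^sup>1\<close> norm. The sign
  cannot be avoided: both unit vectors of a line are normalised.
\<close>

lemma simple_eigenvector_continuous_up_to_sign:
  fixes A :: "'b \<Rightarrow> real^'n^'n" and p :: "real^'n \<Rightarrow> real"
  assumes lim: "(A \<longlongrightarrow> A0) F"
    and sym: "\<And>\<delta>. transpose (A \<delta>) = A \<delta>" and sym0: "transpose A0 = A0"
    and cardeq: "\<forall>\<^sub>F \<delta> in F. card (eigenvalues (A \<delta>)) = card (eigenvalues A0)"
    and dim1: "dim (eigenspace A0 j) = 1"
    and u0: "u0 \<in> eigenspace A0 j" "p u0 = 1"
    and u: "\<forall>\<^sub>F \<delta> in F. u \<delta> \<in> eigenspace (A \<delta>) j \<and> p (u \<delta>) = 1"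
    and contp: "continuous_on UNIV p" and homp: "\<And>c v. p (c *\<^sub>R v) = \<bar>c\<bar> * p v"
    and lowp: "c > 0" "\<And>v. c * norm v \<le> p v"
    and "\<epsilon> > 0"
  shows "\<forall>\<^sub>F \<delta> in F. norm (u \<delta> - u0) < \<epsilon> \<or> norm (u \<delta> + u0) < \<epsilon>"
proof -
  obtain s where s: "s \<in> eigenvalues A0" "card {t\<in>eigenvalues A0. s \<le> t} = j" "A0 *v u0 = s *\<^sub>R u0"
    using u0(1) unfolding eigenspace_def by auto
  have uniq: "\<exists>a. v = a *\<^sub>R u0" if "A0 *v v = s *\<^sub>R v" for v
  proof (rule ccontr)
    assume na: "\<not> ?thesis"
    have "u0 \<noteq> 0" using u0(2) homp[of 0 u0] by auto
    moreover from this na have "independent {v, u0}" 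
      by (auto simp: independent_insert span_singleton)
    moreover have "{v, u0} \<subseteq> eigenspace A0 j"
      using that s u0(1) unfolding eigenspace_def by auto
    ultimately have "card {v, u0} \<le> dim (eigenspace A0 j)"
      by (intro independent_card_le_dim)
    moreover have "v \<noteq> u0" using na by (metis scaleR_one)
    ultimately show False using dim1 by simp
  qed
  define K where "K = {v. p v = 1 \<and> \<epsilon> \<le> norm (v - u0) \<and> \<epsilon> \<le> norm (v + u0)}"
  have normle: "norm v \<le> 1 / c" if "p v = 1" for v
    using lowp(2)[of v] lowp(1) that by (simp add: field_simps)
  have "closed K"
    unfolding K_def using contp
    by (intro closed_Collect_conj closed_Collect_eq closed_Collect_le continuous_intros) auto
  moreover have "bounded K" using normle by (auto simp: K_def bounded_iff)
  ultimately have cK: "compact K" by (simp add: compact_eq_bounded_closed)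
  define q where "q v = norm (A0 *v v - s *\<^sub>R v)" for v
  have contq: "continuous_on K q" unfolding q_def by (intro continuous_intros)
  have qpos: "q v > 0" if "v \<in> K" for v
  proof (rule ccontr)
    assume "\<not> q v > 0"
    then have "A0 *v v = s *\<^sub>R v" by (simp add: q_def)
    from uniq[OF this] obtain a where a: "v = a *\<^sub>R u0" by auto
    have "\<bar>a\<bar> = 1" using that u0(2) homp[of a u0] a by (simp add: K_def)
    then have "v = u0 \<or> v = - u0" using a by (auto simp: abs_if split: if_splits)
    then show False using that \<open>\<epsilon> > 0\<close> by (auto simp: K_def)
  qed
  obtain \<mu> where \<mu>: "\<mu> > 0" "\<And>v. v \<in> K \<Longrightarrow> \<mu> \<le> q v"
  proof (cases "K = {}")
    case False
    then obtain x where "x \<in> K" "\<And>y. y \<in> K \<Longrightarrow> q x \<le> q y"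
      using continuous_attains_inf[OF cK _ contq] by metis
    then show thesis using qpos that by blast
  qed (use that[of 1] in auto)
  have ev1: "\<forall>\<^sub>F \<delta> in F. \<forall>v. norm (A \<delta> *v v - A0 *v v) \<le> (\<mu> * c / 4) * norm v"
    by (rule eventually_matrix_vector_diff_le[OF lim]) (use \<mu> lowp in simp)
  have ev2: "\<forall>\<^sub>F \<delta> in F. \<forall>r\<in>eigenvalues (A \<delta>). card {t\<in>eigenvalues (A \<delta>). r \<le> t} = j \<longrightarrow> \<bar>r - s\<bar> < \<mu> * c / 4"
    by (rule ranked_eigenvalue_tendsto[OF lim sym sym0 cardeq s(1,2)]) (use \<mu> lowp in simp)
  from u ev1 ev2 show ?thesis
  proof eventually_elim
    case (elim \<delta>)
    then obtain r where r: "\<bar>r - s\<bar> < \<mu> * c / 4" "A \<delta> *v u \<delta> = r *\<^sub>R u \<delta>"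
      unfolding eigenspace_def by auto
    have n: "norm (u \<delta>) \<le> 1 / c" using elim normle by blast
    have "q (u \<delta>) = norm ((r - s) *\<^sub>R u \<delta> - (A \<delta> *v u \<delta> - A0 *v u \<delta>))"
      unfolding q_def using r(2) by (simp add: algebra_simps)
    also have "\<dots> \<le> \<bar>r - s\<bar> * norm (u \<delta>) + norm (A \<delta> *v u \<delta> - A0 *v u \<delta>)"
      using norm_triangle_ineq4 by (metis norm_scaleR)
    also have "\<dots> \<le> (\<mu> * c / 4) * norm (u \<delta>) + (\<mu> * c / 4) * norm (u \<delta>)"
      using r(1) elim(2) by (intro add_mono mult_right_mono) auto
    also have "\<dots> = (\<mu> * c / 2) * norm (u \<delta>)" by simp
    also have "\<dots> \<le> (\<mu> * c / 2) * (1 / c)" using n \<mu> lowp by (intro mult_left_mono) auto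
    also have "\<dots> < \<mu>" using \<mu> lowp by simp
    finally have "u \<delta> \<notin> K" using \<mu>(2) by force
    then show ?case using elim(1) by (auto simp: K_def not_le)
  qed
qed

section \<open>Charts, tangent spaces and derivatives along the manifold\<close>

abbreviation Dat :: "('a::real_normed_vector \<Rightarrow> 'b::real_normed_vector) \<Rightarrow> 'a \<Rightarrow> 'a \<Rightarrow> 'b" where
  "Dat f u \<equiv> frechet_derivative f (at u)"

lemma local_param_facts:
  fixes \<psi> :: "real^'d \<Rightarrow> real^'D"
  assumes "local_param \<M> U \<psi>"
  shows local_param_open: "open U"
    and local_param_sub: "\<psi> ` U \<subseteq> \<M>"
    and local_param_inj: "inj_on \<psi> U"
    and local_param_deriv: "u \<in> U \<Longrightarrow> (\<psi> has_derivative Dat \<psi> u) (at u)"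
    and local_param_linear: "u \<in> U \<Longrightarrow> linear (Dat \<psi> u)"
    and local_param_deriv_inj: "u \<in> U \<Longrightarrow> inj (Dat \<psi> u)"
    and local_param_deriv_cont: "continuous_on U (\<lambda>u. Dat \<psi> u v)"
    and local_param_cont: "continuous_on U \<psi>"
proof -
  note a = assms[unfolded local_param_def]
  show "open U" "\<psi> ` U \<subseteq> \<M>" using a openin_imp_subset by blast+
  show "inj_on \<psi> U" using a by (auto simp: homeomorphism_def inj_on_def) metis
  have c: "C_on (Suc 0) \<psi> U" using a by blast
  then have d: "\<psi> differentiable_on U" and "\<forall>v. continuous_on U (\<lambda>u. Dat \<psi> u v)"
    by auto
  then show "continuous_on U (\<lambda>u. Dat \<psi> u v)" by blast
  show "continuous_on U \<psi>" using d by (rule differentiable_imp_continuous_on)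
  show 1: "(\<psi> has_derivative Dat \<psi> u) (at u)" if "u \<in> U"
    using d that \<open>open U\<close> by (simp add: differentiable_on_eq_differentiable_at frechet_derivative_works)
  show "linear (Dat \<psi> u)" if "u \<in> U"
    using 1[OF that] by (rule has_derivative_linear)
  show "inj (Dat \<psi> u)" if "u \<in> U" using a that by blast
qed

lemma at_within_chart_image:
  assumes "local_param \<M> U \<psi>" "u \<in> U"
  shows "at (\<psi> u) within \<M> = at (\<psi> u) within (\<psi> ` U)"
proof -
  have "openin (top_of_set \<M>) (\<psi> ` U)" using assms(1) by (simp add: local_param_def)
  then obtain T where "open T" "\<psi> ` U = \<M> \<inter> T" by (auto simp: openin_open)
  then show ?thesis
    using assms(2) by (intro at_within_nhd[of _ T]) auto
qed

text \<open>
  The inverse of a chart is defined on the manifold only, so its derivative is taken along it.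
  As \<open>R\<close> is a left inverse of the derivative, \<open>w - u - R (\<psi> w - \<psi> u)\<close> is the image under \<open>R\<close> of
  the remainder of the chart, hence \<open>o(\<parallel>w - u\<parallel>)\<close>; and \<open>\<parallel>w - u\<parallel>\<close> is at most a constant times
  \<open>\<parallel>\<psi> w - \<psi> u\<parallel>\<close> near \<open>u\<close>.
\<close>

lemma chart_inverse_has_derivative:
  fixes \<psi> :: "real^'d \<Rightarrow> real^'D"
  assumes lp: "local_param \<M> U \<psi>" and u: "u \<in> U"
    and k: "\<And>w. w \<in> U \<Longrightarrow> k (\<psi> w) = w"
    and R: "linear R" "\<And>v. R (Dat \<psi> u v) = v"
  shows "(k has_derivative R) (at (\<psi> u) within \<M>)"
  unfolding at_within_chart_image[OF lp u] has_derivative_within_alt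
proof (intro conjI allI impI)
  show "bounded_linear R" using R(1) by (simp add: linear_conv_bounded_linear)
  fix e :: real assume "e > 0"
  let ?D = "Dat \<psi> u"
  obtain B where B: "B > 0" "\<And>v. norm (R v) \<le> B * norm v"
    using linear_bounded_pos[OF R(1)] by blast
  \<comment> \<open>The first bound absorbs the remainder into \<open>\<parallel>w - u\<parallel>\<close>, the second makes the final error
    at most \<open>e\<close>.\<close>
  define e' where "e' = min (1 / (2 * B)) (e / (2 * B * B))"
  have e': "e' > 0" "B * e' \<le> 1/2" "B * e' * (2 * B) \<le> e"
  proof -
    show "e' > 0" using B(1) \<open>e > 0\<close> by (simp add: e'_def)
    have "B * e' \<le> B * (1 / (2 * B))" using B(1) by (intro mult_left_mono) (auto simp: e'_def)
    then show "B * e' \<le> 1/2" using B(1) by simp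
    have "B * e' * (2 * B) \<le> B * (e / (2 * B * B)) * (2 * B)"
      using B(1) by (intro mult_left_mono mult_right_mono) (auto simp: e'_def)
    then show "B * e' * (2 * B) \<le> e" using B(1) by simp
  qed
  obtain d1 where d1: "d1 > 0" "\<And>w. norm (w - u) < d1 \<Longrightarrow> norm (\<psi> w - \<psi> u - ?D (w - u)) \<le> e' * norm (w - u)"
    using local_param_deriv[OF lp u] e'(1) unfolding has_derivative_at_alt by blast
  obtain h where h: "homeomorphism U (\<psi> ` U) \<psi> h" using lp by (auto simp: local_param_def)
  have "continuous_on (\<psi> ` U) h" using h by (simp add: homeomorphism_def)
  then obtain d where d: "d > 0" "\<And>y. y \<in> \<psi> ` U \<Longrightarrow> norm (y - \<psi> u) < d \<Longrightarrow> norm (h y - h (\<psi> u)) < d1"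
    using u d1(1) unfolding continuous_on_iff dist_norm by blast
  have hk: "h (\<psi> w) = w" if "w \<in> U" for w using h that by (simp add: homeomorphism_def)
  show "\<exists>d>0. \<forall>y\<in>\<psi> ` U. norm (y - \<psi> u) < d \<longrightarrow> norm (k y - k (\<psi> u) - R (y - \<psi> u)) \<le> e * norm (y - \<psi> u)"
  proof (intro exI conjI ballI impI)
    show "d > 0" by (rule d(1))
    fix y assume y: "y \<in> \<psi> ` U" "norm (y - \<psi> u) < d"
    then obtain w where w: "w \<in> U" "y = \<psi> w" by auto
    have wu: "norm (w - u) < d1" using d(2)[OF y] w hk u by simp
    have eq: "w - u - R (y - \<psi> u) = - R (\<psi> w - \<psi> u - ?D (w - u))"
      using w R by (simp add: linear_diff)
    have "norm (R (\<psi> w - \<psi> u - ?D (w - u))) \<le> B * (e' * norm (w - u))"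
      using B d1(2)[OF wu] by (meson mult_le_cancel_left_pos order_trans)
    then have le: "norm (w - u - R (y - \<psi> u)) \<le> B * e' * norm (w - u)"
      unfolding eq by simp
    have "norm (w - u) \<le> norm (R (y - \<psi> u)) + norm (w - u - R (y - \<psi> u))"
      using norm_triangle_ineq[of "R (y - \<psi> u)" "w - u - R (y - \<psi> u)"] by simp
    also have "\<dots> \<le> B * norm (y - \<psi> u) + (1/2) * norm (w - u)"
    proof (intro add_mono)
      show "norm (w - u - R (y - \<psi> u)) \<le> (1/2) * norm (w - u)"
        using le e'(2) mult_right_mono[of "B * e'" "1/2" "norm (w - u)"] by simp
    qed (rule B)
    finally have "norm (w - u) \<le> 2 * B * norm (y - \<psi> u)" by simp
    then have "B * e' * norm (w - u) \<le> B * e' * (2 * B * norm (y - \<psi> u))"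
      using B(1) e'(1) by (intro mult_left_mono) auto
    also have "\<dots> \<le> e * norm (y - \<psi> u)"
      using mult_right_mono[OF e'(3), of "norm (y - \<psi> u)"] by (simp add: mult.assoc)
    finally show "norm (k y - k (\<psi> u) - R (y - \<psi> u)) \<le> e * norm (y - \<psi> u)"
      using le k w u by simp
  qed
qed

lemma chart_left_inverse_exists:
  fixes \<psi> :: "real^'d \<Rightarrow> real^'D"
  assumes "local_param \<M> U \<psi>" "u \<in> U"
  obtains R where "linear R" "\<And>v. R (Dat \<psi> u v) = v"
  using linear_injective_left_inverse[OF local_param_linear[OF assms] local_param_deriv_inj[OF assms]]
  by (metis comp_apply id_apply)

text \<open>
  The identity equals \<open>\<psi> \<circ> \<psi>\<inverse>\<close> on the manifold, so by the chain rule it has as a derivative the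
  map \<open>D\<psi> \<circ> R\<close>, whose range is that of \<open>D\<psi>\<close>. Composing this fact with other maps is how
  statements about tangent vectors are obtained below without transition functions.
\<close>

lemma id_has_derivative_chart_projection:
  fixes \<psi> :: "real^'d \<Rightarrow> real^'D"
  assumes lp: "local_param \<M> U \<psi>" and u: "u \<in> U"
    and R: "linear R" "\<And>v. R (Dat \<psi> u v) = v"
  shows "((\<lambda>y. y) has_derivative (\<lambda>v. Dat \<psi> u (R v))) (at (\<psi> u) within \<M>)"
proof -
  define k where "k = inv_into U \<psi>"
  have k: "k (\<psi> w) = w" if "w \<in> U" for w
    using local_param_inj[OF lp] that by (simp add: k_def)
  have "(k has_derivative R) (at (\<psi> u) within \<psi> ` U)"
    using chart_inverse_has_derivative[OF lp u k R] by (simp add: at_within_chart_image[OF lp u])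
  moreover have "(\<psi> has_derivative Dat \<psi> u) (at (k (\<psi> u)))"
    using local_param_deriv[OF lp u] k[OF u] by simp
  ultimately have "((\<lambda>y. \<psi> (k y)) has_derivative (\<lambda>v. Dat \<psi> u (R v))) (at (\<psi> u) within \<psi> ` U)"
    by (rule has_derivative_compose)
  then show ?thesis
    unfolding at_within_chart_image[OF lp u]
    by (rule has_derivative_transform[rotated 2]) (use k u in auto)
qed

lemma compose_chart_has_derivative:
  fixes \<psi> :: "real^'d \<Rightarrow> real^'D"
  assumes lp: "local_param \<M> U \<psi>" and u: "u \<in> U"
    and f: "(f has_derivative L) (at (\<psi> u) within \<M>)"
  shows "((\<lambda>w. f (\<psi> w)) has_derivative (\<lambda>v. L (Dat \<psi> u v))) (at u)"
proof -
  have "(\<psi> has_derivative Dat \<psi> u) (at u within U)"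
    using local_param_deriv[OF lp u] has_derivative_at_withinI by blast
  moreover have "(f has_derivative L) (at (\<psi> u) within \<psi> ` U)"
    using f by (simp add: at_within_chart_image[OF lp u])
  ultimately have "((\<lambda>w. f (\<psi> w)) has_derivative (\<lambda>v. L (Dat \<psi> u v))) (at u within U)"
    using diff_chain_within[of \<psi> _ u U f L] by (simp add: o_def)
  then show ?thesis using at_within_open[OF u local_param_open[OF lp]] by simp
qed

text \<open>
  The tangent space was defined through all charts around a point; a single one suffices,
  because composing any other chart with the identity and comparing derivatives shows that its
  derivative takes values in the range of \<open>D\<psi>\<close>.
\<close>

lemma tangent_space_chart:
  fixes \<psi> :: "real^'d \<Rightarrow> real^'D" and d :: "'d itself"
  assumes lp: "local_param \<M> U \<psi>" and u: "u \<in> U"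
  shows "tangent_space d \<M> (\<psi> u) = range (Dat \<psi> u)"
proof
  show "range (Dat \<psi> u) \<subseteq> tangent_space d \<M> (\<psi> u)"
    unfolding tangent_space_def using lp u by blast
  show "tangent_space d \<M> (\<psi> u) \<subseteq> range (Dat \<psi> u)"
  proof
    fix v assume "v \<in> tangent_space d \<M> (\<psi> u)"
    then obtain U2 and \<psi>2 :: "real^'d \<Rightarrow> real^'D" and u2 a where
      2: "local_param \<M> U2 \<psi>2" "u2 \<in> U2" "\<psi>2 u2 = \<psi> u" "v = Dat \<psi>2 u2 a"
      unfolding tangent_space_def by auto
    obtain R where R: "linear R" "\<And>v. R (Dat \<psi> u v) = v"
      using chart_left_inverse_exists[OF lp u] by blast
    have "(\<psi>2 has_derivative (\<lambda>v. Dat \<psi> u (R (Dat \<psi>2 u2 v)))) (at u2)"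
      using compose_chart_has_derivative[OF 2(1,2), of "\<lambda>y. y"]
        id_has_derivative_chart_projection[OF lp u R] 2(3) by simp
    from has_derivative_unique[OF this local_param_deriv[OF 2(1,2)]]
    show "v \<in> range (Dat \<psi> u)" using 2(4) by (metis rangeI)
  qed
qed

lemma derivative_within_unique_on_tangent_space:
  fixes d :: "'d::finite itself" and \<M> :: "(real^'D) set"
  assumes "(f has_derivative L1) (at x within \<M>)" "(f has_derivative L2) (at x within \<M>)"
    and "v \<in> tangent_space d \<M> x"
  shows "L1 v = L2 v"
proof -
  obtain U and \<psi> :: "real^'d \<Rightarrow> real^'D" and u a where
    c: "local_param \<M> U \<psi>" "u \<in> U" "\<psi> u = x" "v = Dat \<psi> u a"
    using assms(3) unfolding tangent_space_def by auto
  show ?thesis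
    using has_derivative_unique[OF compose_chart_has_derivative[OF c(1,2), of f L1]
        compose_chart_has_derivative[OF c(1,2), of f L2]] assms(1,2) c(3,4) by metis
qed

lemma compact_manifold_chart:
  fixes d :: "'d::finite itself" and \<M> :: "(real^'D) set"
  assumes "compact_manifold d \<M>" "x \<in> \<M>"
  obtains U and \<psi> :: "real^'d \<Rightarrow> real^'D" and u where "local_param \<M> U \<psi>" "u \<in> U" "x = \<psi> u"
  using assms unfolding compact_manifold_def by blast

lemma subspace_tangent_space:
  fixes d :: "'d::finite itself" and \<M> :: "(real^'D) set"
  assumes "compact_manifold d \<M>" "x \<in> \<M>"
  shows "subspace (tangent_space d \<M> x)"
proof -
  obtain U and \<psi> :: "real^'d \<Rightarrow> real^'D" and u where c: "local_param \<M> U \<psi>" "u \<in> U" "x = \<psi> u"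
    using compact_manifold_chart[OF assms] .
  show ?thesis
    unfolding c(3) tangent_space_chart[OF c(1,2)]
    by (intro linear_subspace_image local_param_linear[OF c(1,2)] subspace_UNIV)
qed

lemma derivative_maps_tangent_space:
  fixes d :: "'d::finite itself" and \<M> :: "(real^'D) set"
  assumes cm: "compact_manifold d \<M>" and "x \<in> \<M>" and f: "f ` \<M> \<subseteq> \<M>"
    and L: "(f has_derivative L) (at x within \<M>)" and v: "v \<in> tangent_space d \<M> x"
  shows "L v \<in> tangent_space d \<M> (f x)"
proof -
  have "f x \<in> \<M>" using assms by auto
  then obtain U and \<psi> :: "real^'d \<Rightarrow> real^'D" and u where c: "local_param \<M> U \<psi>" "u \<in> U" "f x = \<psi> u"
    using compact_manifold_chart[OF cm] by blast
  obtain R where R: "linear R" "\<And>v. R (Dat \<psi> u v) = v"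
    using chart_left_inverse_exists[OF c(1,2)] by blast
  have "((\<lambda>y. y) has_derivative (\<lambda>v. Dat \<psi> u (R v))) (at (f x) within f ` \<M>)"
    using id_has_derivative_chart_projection[OF c(1,2) R] f unfolding c(3)
    by (rule has_derivative_subset)
  from diff_chain_within[OF L this]
  have "(f has_derivative (\<lambda>v. Dat \<psi> u (R (L v)))) (at x within \<M>)" by (simp add: o_def)
  from derivative_within_unique_on_tangent_space[OF L this v]
  show ?thesis unfolding c(3) tangent_space_chart[OF c(1,2)] by auto
qed

text \<open>
  The definite description in the definition of the tangent map is meaningful. For existence
  take the left inverse \<open>R = (D\<psi>\<^sup>T D\<psi>)\<inverse> D\<psi>\<^sup>T\<close>, which kills the orthogonal complement of the
  tangent space, and compose any derivative of \<open>f\<close> with \<open>D\<psi> \<circ> R\<close>, a derivative of the identity.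
\<close>

lemma tangent_map_has_derivative:
  fixes d :: "'d::finite itself" and \<M> :: "(real^'D) set"
  assumes cm: "compact_manifold d \<M>" and x: "x \<in> \<M>" and f: "f differentiable (at x within \<M>)"
  shows "(f has_derivative tangent_map d \<M> f x) (at x within \<M>)"
proof -
  obtain U and \<psi> :: "real^'d \<Rightarrow> real^'D" and u where c: "local_param \<M> U \<psi>" "u \<in> U" "x = \<psi> u"
    using compact_manifold_chart[OF cm x] .
  let ?D = "Dat \<psi> u"
  note linD = local_param_linear[OF c(1,2)]
  have T: "tangent_space d \<M> x = range ?D" unfolding c(3) by (rule tangent_space_chart[OF c(1,2)])
  obtain L where L: "(f has_derivative L) (at x within \<M>)" using f by (auto simp: differentiable_def)
  define G where "G = adjoint ?D \<circ> ?D"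
  have adj: "w \<bullet> adjoint ?D v = ?D w \<bullet> v" for w v by (rule adjoint_works[OF linD])
  have linG: "linear G" unfolding G_def by (intro linear_compose linD adjoint_linear)
  have "inj G"
  proof (rule linear_injective_0[OF linG, THEN iffD2], intro allI impI)
    fix w assume "G w = 0"
    then have "?D w \<bullet> ?D w = 0" using adj[of w "?D w"] by (simp add: G_def)
    then have "?D w = ?D 0" using linD by (simp add: linear_0)
    then show "w = 0" using local_param_deriv_inj[OF c(1,2)] by (simp add: inj_eq)
  qed
  obtain G' where G': "linear G'" "\<And>w. G' (G w) = w"
    using linear_injective_left_inverse[OF linG \<open>inj G\<close>] by (metis comp_apply id_apply)
  define R where "R = G' \<circ> adjoint ?D"
  have R: "linear R" "\<And>v. R (?D v) = v"
    using G' by (auto simp: R_def G_def intro!: linear_compose adjoint_linear linD)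
  have R0: "R v = 0" if "\<forall>w\<in>tangent_space d \<M> x. v \<bullet> w = 0" for v
  proof -
    have "w \<bullet> adjoint ?D v = 0" for w using adj[of w v] that T by (simp add: inner_commute)
    then have "adjoint ?D v = 0" by (metis inner_eq_zero_iff)
    then show ?thesis using G'(1) by (simp add: R_def linear_0)
  qed
  define P where "P v = L (?D (R v))" for v
  have linL: "linear L" using L by (rule has_derivative_linear)
  have fP: "(f has_derivative P) (at x within \<M>)"
    using diff_chain_within[OF id_has_derivative_chart_projection[OF c(1,2) R], of f L] L
    by (simp add: P_def[abs_def] o_def c(3))
  have P0: "\<forall>v. (\<forall>w\<in>tangent_space d \<M> x. v \<bullet> w = 0) \<longrightarrow> P v = 0"
    using R0 linL linD by (simp add: P_def linear_0)
  have "tangent_map d \<M> f x = P"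
    unfolding tangent_map_def
  proof (rule the_equality)
    fix L' assume L': "(f has_derivative L') (at x within \<M>) \<and> (\<forall>v. (\<forall>w\<in>tangent_space d \<M> x. v \<bullet> w = 0) \<longrightarrow> L' v = 0)"
    show "L' = P"
    proof
      fix v
      obtain y z where yz: "y \<in> span (tangent_space d \<M> x)" "\<And>w. w \<in> span (tangent_space d \<M> x) \<Longrightarrow> orthogonal z w" "v = y + z"
        using orthogonal_subspace_decomp_exists by metis
      have y: "y \<in> tangent_space d \<M> x" using yz(1) subspace_tangent_space[OF cm x] by (simp add: span_eq_iff[THEN iffD2])
      have "L' z = 0" "P z = 0"
        using yz(2) L' P0 by (auto simp: orthogonal_def span_base)
      moreover have "L' y = P y"
        using derivative_within_unique_on_tangent_space[of f L' x \<M> P y d] L' fP y by blast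
      moreover have "linear L'" "linear P" using L' fP has_derivative_linear by blast+
      ultimately show "L' v = P v" by (simp add: yz(3) linear_add)
    qed
  qed (use fP P0 in blast)
  then show ?thesis using fP by simp
qed

section \<open>Gram determinants and the Jacobian of a map between manifolds\<close>

definition gram :: "('d \<Rightarrow> 'a::real_inner) \<Rightarrow> real^'d^'d" where
  "gram b = (\<chi> i j. b i \<bullet> b j)"

lemma det_gram_change_of_basis:
  fixes b c :: "'d::finite \<Rightarrow> 'a::real_inner" and T :: "real^'d^'d"
  assumes "\<And>j. c j = (\<Sum>k\<in>UNIV. T $ k $ j *\<^sub>R b k)"
  shows "det (gram c) = (det T)\<^sup>2 * det (gram b)"
proof -
  have "gram c = transpose T ** gram b ** T"
    by (simp add: vec_eq_iff gram_def transpose_def matrix_matrix_mult_def assms inner_sum_left inner_sum_right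
        sum_distrib_right sum_distrib_left mult_ac)
  then show ?thesis by (simp add: det_mul power2_eq_square)
qed

lemma volume_density_gram:
  "volume_density \<psi> u = sqrt (det (gram (\<lambda>i. Dat \<psi> u (axis i 1))))"
  by (simp add: volume_density_def gram_def)

lemma orthonormal_frame_expansion:
  fixes e :: "'d::finite \<Rightarrow> real^'D"
  assumes e: "orthonormal_frame e V" and v: "v \<in> V"
  shows "v = (\<Sum>k\<in>UNIV. (e k \<bullet> v) *\<^sub>R e k)"
proof -
  define w where "w = v - (\<Sum>k\<in>UNIV. (e k \<bullet> v) *\<^sub>R e k)"
  have on: "e i \<bullet> e j = (if i = j then 1 else 0)" and sp: "span (range e) = V" for i j
    using e by (auto simp: orthonormal_frame_def)
  have "w \<in> span (range e)"
    unfolding w_def using v sp by (intro span_diff span_sum span_scale) (auto intro: span_base)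
  moreover have "orthogonal w y" if y: "y \<in> range e" for y
  proof -
    obtain l where l: "y = e l" using y by auto
    have "(e k \<bullet> v) * (e l \<bullet> e k) = (if k = l then e l \<bullet> v else 0)" for k by (simp add: on)
    then have "e l \<bullet> w = 0" by (simp add: w_def inner_diff_right inner_sum_right)
    then show ?thesis using l by (simp add: orthogonal_def inner_commute)
  qed
  ultimately have "orthogonal w w" using orthogonal_to_span by blast
  then show ?thesis by (simp add: w_def orthogonal_def)
qed

lemma orthonormal_frame_mem: "orthonormal_frame e V \<Longrightarrow> e i \<in> V"
  unfolding orthonormal_frame_def by (metis rangeI span_base)

lemma orthonormal_frame_gram:
  fixes e :: "'d::finite \<Rightarrow> real^'D"
  shows "orthonormal_frame e V \<Longrightarrow> gram e = mat 1"
  by (simp add: orthonormal_frame_def gram_def mat_def vec_eq_iff)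

lemma tangent_space_orthonormal_frame_exists:
  fixes d :: "'d::finite itself" and \<M> :: "(real^'D) set"
  assumes "compact_manifold d \<M>" "x \<in> \<M>"
  obtains e :: "'d \<Rightarrow> real^'D" where "orthonormal_frame e (tangent_space d \<M> x)"
proof -
  obtain U and \<psi> :: "real^'d \<Rightarrow> real^'D" and u where c: "local_param \<M> U \<psi>" "u \<in> U" "x = \<psi> u"
    using compact_manifold_chart[OF assms] .
  let ?V = "tangent_space d \<M> x"
  have "dim ?V = dim (UNIV :: (real^'d) set)"
    unfolding c(3) tangent_space_chart[OF c(1,2)]
    by (rule dim_image_eq) (use local_param_linear[OF c(1,2)] local_param_deriv_inj[OF c(1,2)] in auto)
  then have dim: "dim ?V = CARD('d)" by simp
  obtain E where E: "E \<subseteq> ?V" "pairwise orthogonal E" "\<And>x. x \<in> E \<Longrightarrow> norm x = 1"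
    "independent E" "card E = dim ?V" "span E = ?V"
    using orthonormal_basis_subspace[OF subspace_tangent_space[OF assms]] by metis
  obtain e where e: "bij_betw e (UNIV :: 'd set) E"
    using E(4,5) dim independent_imp_finite finite_same_card_bij[of "UNIV :: 'd set" E] by auto
  have "orthonormal_frame e ?V"
    unfolding orthonormal_frame_def
  proof (intro conjI allI)
    show "span (range e) = ?V" using e E(6) by (simp add: bij_betw_def)
    fix i j show "e i \<bullet> e j = (if i = j then 1 else 0)"
      using E(2,3) e unfolding pairwise_def orthogonal_def bij_betw_def inj_on_def
      by (metis UNIV_I norm_eq_1 rangeI)
  qed
  then show thesis by (rule that)
qed

text \<open>
  The coordinate vectors of a chart are expressed in an orthonormal frame by the matrix \<open>T\<close>, so
  every Gram determinant in chart coordinates is \<open>(det T)\<^sup>2\<close> times the one in the frame.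
\<close>

lemma frame_chart_det:
  fixes \<psi> :: "real^'d \<Rightarrow> real^'D" and d :: "'d itself"
  assumes lp: "local_param \<M> U \<psi>" and u: "u \<in> U"
    and e: "orthonormal_frame e (tangent_space d \<M> (\<psi> u))"
    and L: "linear L"
  defines "T \<equiv> (\<chi> k j. e k \<bullet> Dat \<psi> u (axis j 1)) :: real^'d^'d"
  shows "det T \<noteq> 0" "volume_density \<psi> u = \<bar>det T\<bar>"
    "det (gram (\<lambda>i. L (Dat \<psi> u (axis i 1)))) = (det T)\<^sup>2 * det (gram (\<lambda>k. L (e k)))"
proof -
  let ?D = "Dat \<psi> u"
  note linD = local_param_linear[OF lp u]
  have TD: "?D v \<in> tangent_space d \<M> (\<psi> u)" for v using tangent_space_chart[OF lp u] by auto
  have exp: "?D v = (\<Sum>k\<in>UNIV. (e k \<bullet> ?D v) *\<^sub>R e k)" for v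
    by (rule orthonormal_frame_expansion[OF e TD])
  show g: "det (gram (\<lambda>i. L (?D (axis i 1)))) = (det T)\<^sup>2 * det (gram (\<lambda>k. L (e k)))"
  proof (rule det_gram_change_of_basis)
    fix j
    show "L (?D (axis j 1)) = (\<Sum>k\<in>UNIV. T $ k $ j *\<^sub>R L (e k))"
      by (subst exp) (simp add: T_def linear_sum[OF L] linear_scale[OF L])
  qed
  have "det (gram (\<lambda>i. ?D (axis i 1))) = (det T)\<^sup>2 * det (gram e)"
    by (rule det_gram_change_of_basis) (subst exp, simp add: T_def)
  then show "volume_density \<psi> u = \<bar>det T\<bar>"
    by (simp add: volume_density_gram orthonormal_frame_gram[OF e])
  have "inj ((*v) T)"
  proof (rule linear_injective_0[THEN iffD2], simp, intro allI impI)
    fix w assume w: "T *v w = 0"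
    have "?D w = (\<Sum>j\<in>UNIV. w $ j *\<^sub>R ?D (axis j 1))"
    proof -
      have "?D w = ?D (\<Sum>j\<in>UNIV. w $ j *\<^sub>R axis j 1)"
        using basis_expansion[of w] by (simp add: scalar_mult_eq_scaleR)
      then show ?thesis by (simp add: linear_sum[OF linD] linear_scale[OF linD])
    qed
    then have "e k \<bullet> ?D w = (T *v w) $ k" for k
      by (simp add: inner_sum_right T_def matrix_vector_mult_def mult.commute)
    then have "?D w = 0" using w exp[of w] by simp
    then show "w = 0" using local_param_deriv_inj[OF lp u] linear_0[OF linD] by (metis injD)
  qed
  then show "det T \<noteq> 0" by (simp add: invertible_det_nz[symmetric] invertible_left_inverse matrix_left_invertible_injective)
qed

lemma volume_density_pos:
  fixes \<psi> :: "real^'d \<Rightarrow> real^'D"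
  assumes "compact_manifold TYPE('d) \<M>" "local_param \<M> U \<psi>" "u \<in> U"
  shows "volume_density \<psi> u > 0"
proof -
  have "\<psi> u \<in> \<M>" using local_param_sub[OF assms(2)] assms(3) by auto
  then obtain e where e: "orthonormal_frame (e :: 'd \<Rightarrow> real^'D) (tangent_space TYPE('d) \<M> (\<psi> u))"
    using tangent_space_orthonormal_frame_exists[OF assms(1)] by blast
  show ?thesis using frame_chart_det[OF assms(2,3) e linear_id] by simp
qed

text \<open>
  Both the independence of the frame in the source and that in the target follow from the
  expression as a Gram determinant: it does not mention the frame in the target, and a change of
  the frame in the source is compared through a chart.
\<close>

lemma abs_det_deriv_frame:
  fixes d :: "'d::finite itself" and \<M> :: "(real^'D) set"
  assumes cm: "compact_manifold d \<M>" and x: "x \<in> \<M>" and g: "g ` \<M> \<subseteq> \<M>" "g differentiable (at x within \<M>)"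
    and e: "orthonormal_frame (e :: 'd \<Rightarrow> _) (tangent_space d \<M> x)" "orthonormal_frame e' (tangent_space d \<M> (g x))"
  shows abs_det_deriv_eq_gram: "abs_det_deriv d \<M> g x = sqrt (det (gram (\<lambda>i. tangent_map d \<M> g x (e i))))"
    and abs_det_deriv_eq_det: "abs_det_deriv d \<M> g x = \<bar>det ((\<chi> i j. e' i \<bullet> tangent_map d \<M> g x (e j)) :: real^'d^'d)\<bar>"
proof -
  let ?L = "tangent_map d \<M> g x"
  note L = tangent_map_has_derivative[OF cm x g(2)]
  have linL: "linear ?L" using L by (rule has_derivative_linear)
  have "g x \<in> \<M>" using g x by auto
  have sq: "sqrt (det (gram (\<lambda>i. ?L (f i)))) = \<bar>det ((\<chi> i j. f' i \<bullet> ?L (f j)) :: real^'d^'d)\<bar>"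
    if f: "orthonormal_frame f (tangent_space d \<M> x)" and f': "orthonormal_frame f' (tangent_space d \<M> (g x))" for f f' :: "'d \<Rightarrow> real^'D"
  proof -
    have "det (gram (\<lambda>i. ?L (f i))) = (det ((\<chi> i j. f' i \<bullet> ?L (f j)) :: real^'d^'d))\<^sup>2 * det (gram f')"
    proof (rule det_gram_change_of_basis)
      fix j
      have "f j \<in> tangent_space d \<M> x"
        by (rule orthonormal_frame_mem[OF f])
      then have "?L (f j) \<in> tangent_space d \<M> (g x)"
        by (rule derivative_maps_tangent_space[OF cm x g(1) L])
      then show "?L (f j) = (\<Sum>k\<in>UNIV. (\<chi> i j. f' i \<bullet> ?L (f j)) $ k $ j *\<^sub>R f' k)"
        by (simp add: orthonormal_frame_expansion[OF f', symmetric])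
    qed
    then show ?thesis by (simp add: orthonormal_frame_gram[OF f'])
  qed
  have indep: "sqrt (det (gram (\<lambda>i. ?L (f i)))) = sqrt (det (gram (\<lambda>i. ?L (e i))))"
    if f: "orthonormal_frame f (tangent_space d \<M> x)" for f :: "'d \<Rightarrow> real^'D"
  proof -
    obtain U and \<psi> :: "real^'d \<Rightarrow> real^'D" and u where c: "local_param \<M> U \<psi>" "u \<in> U" "x = \<psi> u"
      using compact_manifold_chart[OF cm x] .
    show ?thesis
      using frame_chart_det[OF c(1,2) f[unfolded c(3)] linL] frame_chart_det[OF c(1,2) e(1)[unfolded c(3)] linL]
      by (smt (verit, best) abs_eq_iff mult_cancel_left power2_eq_iff zero_eq_power2)
  qed
  have "abs_det_deriv d \<M> g x = sqrt (det (gram (\<lambda>i. ?L (e i))))"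
    unfolding abs_det_deriv_def
  proof (rule the_equality)
    show "\<exists>(f :: 'd \<Rightarrow> real^'D) f'. orthonormal_frame f (tangent_space d \<M> x) \<and> orthonormal_frame f' (tangent_space d \<M> (g x)) \<and>
       sqrt (det (gram (\<lambda>i. ?L (e i)))) = \<bar>det ((\<chi> i j. f' i \<bullet> ?L (f j)) :: real^'d^'d)\<bar>"
      using e sq[OF e] by blast
  qed (use sq indep in fastforce)
  then show "abs_det_deriv d \<M> g x = sqrt (det (gram (\<lambda>i. ?L (e i))))"
    "abs_det_deriv d \<M> g x = \<bar>det ((\<chi> i j. e' i \<bullet> ?L (e j)) :: real^'d^'d)\<bar>"
    using sq[OF e] by auto
qed

text \<open>
  This formula replaces the orthonormal frames, which cannot in general be chosen continuously
  on the whole manifold, by the coordinate vectors of a chart, which depend continuously on the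
  point and do not depend on the map \<open>g\<close>.
\<close>

lemma abs_det_deriv_chart:
  fixes \<psi> :: "real^'d \<Rightarrow> real^'D" and d :: "'d itself"
  assumes cm: "compact_manifold d \<M>" and lp: "local_param \<M> U \<psi>" and u: "u \<in> U"
    and g: "g ` \<M> \<subseteq> \<M>" "g differentiable (at (\<psi> u) within \<M>)"
  shows "abs_det_deriv d \<M> g (\<psi> u) =
    sqrt (det (gram (\<lambda>i. tangent_map d \<M> g (\<psi> u) (Dat \<psi> u (axis i 1))))) / volume_density \<psi> u"
proof -
  have x: "\<psi> u \<in> \<M>" "g (\<psi> u) \<in> \<M>" using local_param_sub[OF lp] u g(1) by auto
  obtain e :: "'d \<Rightarrow> real^'D" where e: "orthonormal_frame e (tangent_space d \<M> (\<psi> u))"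
    using tangent_space_orthonormal_frame_exists[OF cm x(1)] .
  obtain e' :: "'d \<Rightarrow> real^'D" where e': "orthonormal_frame e' (tangent_space d \<M> (g (\<psi> u)))"
    using tangent_space_orthonormal_frame_exists[OF cm x(2)] .
  have "linear (tangent_map d \<M> g (\<psi> u))"
    using tangent_map_has_derivative[OF cm x(1) g(2)] by (rule has_derivative_linear)
  note T = frame_chart_det[OF lp u e this]
  show ?thesis
    using T(1) unfolding T(2,3) abs_det_deriv_eq_gram[OF cm x(1) g e e']
    by (simp add: real_sqrt_mult)
qed

lemma abs_det_le_fact:
  fixes A :: "real^'d^'d"
  assumes "\<And>i j. \<bar>A $ i $ j\<bar> \<le> K"
  shows "\<bar>det A\<bar> \<le> fact CARD('d) * K ^ CARD('d)"
proof -
  have "\<bar>det A\<bar> \<le> (\<Sum>p | p permutes (UNIV :: 'd set). \<bar>of_int (sign p) * (\<Prod>i\<in>UNIV. A $ i $ p i)\<bar>)"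
    unfolding det_def by (rule sum_abs)
  also have "\<dots> \<le> (\<Sum>p | p permutes (UNIV :: 'd set). K ^ CARD('d))"
  proof (rule sum_mono)
    fix p
    have "\<bar>of_int (sign p) * (\<Prod>i\<in>UNIV. A $ i $ p i)\<bar> = (\<Prod>i\<in>UNIV. \<bar>A $ i $ p i\<bar>)"
      by (simp add: abs_mult abs_prod sign_def)
    also have "\<dots> \<le> (\<Prod>i\<in>(UNIV::'d set). K)" by (rule prod_mono) (use assms in auto)
    finally show "\<bar>of_int (sign p) * (\<Prod>i\<in>UNIV. A $ i $ p i)\<bar> \<le> K ^ CARD('d)" by simp
  qed
  also have "\<dots> = fact CARD('d) * K ^ CARD('d)" by (simp add: card_permutations)
  finally show ?thesis .
qed

lemma abs_det_deriv_bounds: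
  fixes d :: "'d::finite itself" and \<M> :: "(real^'D) set"
  assumes cm: "compact_manifold d \<M>" and x: "x \<in> \<M>" and g: "g ` \<M> \<subseteq> \<M>" "g differentiable (at x within \<M>)"
    and K: "\<And>v. v \<in> tangent_space d \<M> x \<Longrightarrow> norm (tangent_map d \<M> g x v) \<le> K * norm v"
  shows "0 \<le> abs_det_deriv d \<M> g x" "abs_det_deriv d \<M> g x \<le> fact CARD('d) * K ^ CARD('d)"
proof -
  have gx: "g x \<in> \<M>" using x g(1) by auto
  obtain e :: "'d \<Rightarrow> real^'D" where e: "orthonormal_frame e (tangent_space d \<M> x)"
    using tangent_space_orthonormal_frame_exists[OF cm x] .
  obtain e' :: "'d \<Rightarrow> real^'D" where e': "orthonormal_frame e' (tangent_space d \<M> (g x))"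
    using tangent_space_orthonormal_frame_exists[OF cm gx] .
  have n1: "norm (e i) = 1" "norm (e' i) = 1" "e i \<in> tangent_space d \<M> x" for i
    using e e' orthonormal_frame_mem[OF e] by (auto simp: orthonormal_frame_def norm_eq_1)
  note eq = abs_det_deriv_eq_det[OF cm x g e e']
  show "0 \<le> abs_det_deriv d \<M> g x" unfolding eq by simp
  show "abs_det_deriv d \<M> g x \<le> fact CARD('d) * K ^ CARD('d)"
    unfolding eq
  proof (rule abs_det_le_fact)
    fix i j
    have "\<bar>e' i \<bullet> tangent_map d \<M> g x (e j)\<bar> \<le> norm (e' i) * norm (tangent_map d \<M> g x (e j))"
      by (rule Cauchy_Schwarz_ineq2)
    also have "\<dots> \<le> K" using K[OF n1(3), of j] n1 by simp
    finally show "\<bar>(\<chi> i j. e' i \<bullet> tangent_map d \<M> g x (e j)) $ i $ j\<bar> \<le> K" by simp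
  qed
qed

section \<open>Finite atlases with uniform bounds\<close>

text \<open>
  Cover \<open>S\<close> by balls inside a slightly larger open set. By Vitali's lemma disjoint balls can be
  selected whose fivefold enlargements cover \<open>S\<close>; the images are contained in balls with radii
  multiplied by \<open>5 H\<close>. The constant is far from optimal, but only its dependence on \<open>H\<close> alone
  matters.
\<close>

lemma emeasure_Lipschitz_image_le:
  fixes h :: "'a::euclidean_space \<Rightarrow> 'a"
  assumes S: "S \<in> sets lebesgue" and H: "H > 0"
    and lip: "\<And>x y. x \<in> S \<Longrightarrow> y \<in> S \<Longrightarrow> norm (h x - h y) \<le> H * norm (x - y)"
  shows "h ` S \<in> sets lebesgue"
    and "emeasure lebesgue (h ` S) \<le> ennreal ((5 * H) ^ DIM('a)) * emeasure lebesgue S"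
proof -
  show meas: "h ` S \<in> sets lebesgue"
  proof (rule sets_lebesgue_continuous_image[OF S])
    show "continuous_on S h"
      using lip by (intro lipschitz_on_continuous_on[of H] lipschitz_onI) (use H in \<open>auto simp: dist_norm\<close>)
    show "negligible (h ` T)" if "negligible T" "T \<subseteq> S" for T
      by (rule negligible_locally_Lipschitz_image[OF _ that(1)])
        (use lip that(2) in \<open>auto intro!: exI[of _ UNIV] exI[of _ H]\<close>)
  qed auto
  show "emeasure lebesgue (h ` S) \<le> ennreal ((5 * H) ^ DIM('a)) * emeasure lebesgue S"
  proof (rule ennreal_le_epsilon)
    fix e :: real assume "e > 0"
    let ?C = "(5 * H) ^ DIM('a)"
    have C: "?C > 0" using H by simp
    obtain G where G: "open G" "S \<subseteq> G" "emeasure lebesgue (G - S) < ennreal (e / ?C)"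
      using sets_lebesgue_outer_open[OF S, of "e / ?C"] \<open>e > 0\<close> C by (metis divide_pos_pos)
    have emG: "emeasure lebesgue G \<le> emeasure lebesgue S + ennreal (e / ?C)"
    proof -
      have "emeasure lebesgue G \<le> emeasure lebesgue S + emeasure lebesgue (G - S)"
        using emeasure_subadditive[of S lebesgue "G - S"] S G(1,2) by (simp add: Un_absorb1 borel_open sets.Diff)
      also have "\<dots> \<le> emeasure lebesgue S + ennreal (e / ?C)"
        using G(3) by (intro add_left_mono) simp
      finally show ?thesis .
    qed
    have "\<exists>r. 0 < r \<and> r \<le> 1 \<and> cball x r \<subseteq> G" if xS: "x \<in> S" for x
    proof -
      obtain r where "r > 0" "cball x r \<subseteq> G"
        using G(1,2) xS open_contains_cball by blast
      then show ?thesis by (intro exI[of _ "min r 1"]) auto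
    qed
    then obtain r where r: "\<And>x. x \<in> S \<Longrightarrow> 0 < r x \<and> r x \<le> 1 \<and> cball x (r x) \<subseteq> G" by metis
    have "x \<in> cball x (r x)" if "x \<in> S" for x using r[OF that] by simp
    then have cov: "S \<subseteq> (\<Union>i\<in>S. cball i (r i))" by blast
    have r01: "0 < r i \<and> r i \<le> 1" if "i \<in> S" for i using r[OF that] by simp
    obtain C where C: "countable C" "C \<subseteq> S" "pairwise (\<lambda>i j. disjnt (cball i (r i)) (cball j (r j))) C"
        "S \<subseteq> (\<Union>i\<in>C. cball i (5 * r i))"
      by (rule Vitali_covering_lemma_cballs[OF cov r01]) (blast intro: that)+
    \<comment> \<open>The countable family of balls is indexed by the natural numbers, with empty sets as
      fillers, because countable additivity is formulated for sequences.\<close>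
    define J where "J = to_nat_on C ` C"
    define i where "i = from_nat_into C"
    have iC: "i n \<in> C" if "n \<in> J" for n
      using that C(1) by (auto simp: J_def i_def)
    have i_onto: "\<exists>n\<in>J. i n = x" if "x \<in> C" for x
      using that C(1) by (auto simp: J_def i_def)
    have i_inj: "i n \<noteq> i n'" if "n \<in> J" "n' \<in> J" "n \<noteq> n'" for n n'
      using that C(1) by (auto simp: J_def i_def)
    define A where "A n = (if n \<in> J then cball (i n) (r (i n)) else {})" for n
    define A' where "A' n = (if n \<in> J then cball (h (i n)) (5 * H * r (i n)) else {})" for n
    have em: "emeasure lebesgue (A' n) = ennreal ?C * emeasure lebesgue (A n)" for n
    proof (cases "n \<in> J")
      case True
      then have "r (i n) > 0" using iC C(2) r by blast
      then show ?thesis using True H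
        by (simp add: A_def A'_def emeasure_cball ennreal_mult[symmetric] power_mult_distrib mult_ac)
    qed (simp add: A_def A'_def)
    have disj: "disjoint_family A"
      unfolding disjoint_family_on_def
    proof (intro ballI impI)
      fix n n' :: nat assume "n \<noteq> n'"
      show "A n \<inter> A n' = {}"
      proof (cases "n \<in> J \<and> n' \<in> J")
        case True
        then have "disjnt (cball (i n) (r (i n))) (cball (i n') (r (i n')))"
          using pairwiseD[OF C(3) iC iC i_inj] \<open>n \<noteq> n'\<close> by blast
        then show ?thesis using True by (simp add: A_def disjnt_def)
      qed (auto simp: A_def)
    qed
    have "h ` S \<subseteq> (\<Union>n. A' n)"
    proof
      fix y assume "y \<in> h ` S"
      then obtain x where x: "x \<in> S" "y = h x" by auto
      then obtain j where j: "j \<in> C" "x \<in> cball j (5 * r j)" using C(4) by auto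
      then obtain n where n: "n \<in> J" "i n = j" using i_onto by blast
      have "norm (h j - h x) \<le> H * norm (j - x)" using lip j(1) x(1) C(2) by blast
      also have "\<dots> \<le> H * (5 * r j)" using j(2) H by (intro mult_left_mono) (auto simp: dist_norm)
      finally have "y \<in> A' n" using n x(2) by (simp add: A'_def dist_norm mult_ac)
      then show "y \<in> (\<Union>n. A' n)" by blast
    qed
    then have "emeasure lebesgue (h ` S) \<le> emeasure lebesgue (\<Union>n. A' n)"
      by (intro emeasure_mono) (auto simp: A'_def)
    also have "\<dots> \<le> (\<Sum>n. emeasure lebesgue (A' n))"
      by (rule emeasure_subadditive_countably) (auto simp: A'_def)
    also have "\<dots> = ennreal ?C * (\<Sum>n. emeasure lebesgue (A n))"
      by (simp only: em ennreal_suminf_cmult)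
    also have "(\<Sum>n. emeasure lebesgue (A n)) = emeasure lebesgue (\<Union>n. A n)"
      by (rule suminf_emeasure[OF _ disj]) (auto simp: A_def)
    also have "\<dots> \<le> emeasure lebesgue G"
      using r iC C(2) G(1) by (intro emeasure_mono) (force simp: A_def split: if_splits, simp add: borel_open)
    also have "\<dots> \<le> emeasure lebesgue S + ennreal (e / ?C)" by (rule emG)
    finally show "emeasure lebesgue (h ` S) \<le> ennreal ?C * emeasure lebesgue S + ennreal e"
      using C \<open>e > 0\<close> H by (simp add: distrib_left mult_left_mono ennreal_mult[symmetric])
  qed
qed

lemma C_on_subset:
  "C_on k f U \<Longrightarrow> open U \<Longrightarrow> S \<subseteq> U \<Longrightarrow> C_on k f S"
proof (induction k arbitrary: f)
  case 0
  then show ?case by (auto intro: continuous_on_subset)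
next
  case (Suc k)
  then show ?case by (auto intro: differentiable_on_subset)
qed

lemma local_param_subset:
  assumes lp: "local_param \<M> U \<psi>" and S: "open S" "S \<subseteq> U"
  shows "local_param \<M> S \<psi>"
proof -
  note a = lp[unfolded local_param_def]
  obtain h where h: "homeomorphism U (\<psi> ` U) \<psi> h" using a by blast
  have "openin (top_of_set U) S" using S a by (simp add: openin_open_eq)
  then have "openin (top_of_set (\<psi> ` U)) (\<psi> ` S)"
    using homeomorphism_imp_open_map[OF h] by blast
  then have "openin (top_of_set \<M>) (\<psi> ` S)" using a openin_trans by blast
  moreover have "homeomorphism S (\<psi> ` S) \<psi> h"
    using homeomorphism_of_subsets[OF h] S by blast
  ultimately show ?thesis using a S C_on_subset unfolding local_param_def by blast
qed

lemma continuous_on_det: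
  fixes A :: "'a::topological_space \<Rightarrow> real^'n^'n"
  assumes "\<And>i j. continuous_on S (\<lambda>x. A x $ i $ j)"
  shows "continuous_on S (\<lambda>x. det (A x))"
  unfolding det_def by (intro continuous_intros assms)

lemma tendsto_det:
  fixes A :: "'a \<Rightarrow> real^'n^'n"
  assumes "\<And>i j. ((\<lambda>x. A x $ i $ j) \<longlongrightarrow> A0 $ i $ j) F"
  shows "((\<lambda>x. det (A x)) \<longlongrightarrow> det A0) F"
  unfolding det_def by (intro tendsto_intros assms)

lemma continuous_on_volume_density:
  assumes "local_param \<M> U \<psi>"
  shows "continuous_on U (volume_density \<psi>)"
proof -
  have "continuous_on U (\<lambda>u. volume_density \<psi> u)"
    unfolding volume_density_def
    by (intro continuous_on_real_sqrt continuous_on_det) (auto intro!: continuous_intros local_param_deriv_cont[OF assms])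
  then show ?thesis by simp
qed

text \<open>
  The constants are arguments, so that the charts of a finite atlas can share them. Convexity of
  the parameter domain turns bounds for derivatives into Lipschitz bounds.
\<close>

definition regular_chart ::
  "(real^'D) set \<Rightarrow> real \<Rightarrow> real \<Rightarrow> real \<Rightarrow> real \<Rightarrow> (real^'d) set \<Rightarrow> (real^'d \<Rightarrow> real^'D) \<Rightarrow> bool" where
  "regular_chart \<M> a b \<alpha> \<beta> S \<psi> \<longleftrightarrow>
     local_param \<M> S \<psi> \<and> convex S \<and> bounded S \<and>
     (\<forall>w\<in>S. \<forall>w'\<in>S. a * norm (w - w') \<le> norm (\<psi> w - \<psi> w')) \<and>
     (\<forall>w\<in>S. \<forall>v. norm (Dat \<psi> w v) \<le> b * norm v) \<and>
     (\<forall>w\<in>S. \<alpha> \<le> volume_density \<psi> w \<and> volume_density \<psi> w \<le> \<beta>)"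

lemma regular_chart_mono:
  assumes "regular_chart \<M> a b \<alpha> \<beta> S \<psi>" "a' \<le> a" "b \<le> b'" "\<alpha>' \<le> \<alpha>" "\<beta> \<le> \<beta>'"
  shows "regular_chart \<M> a' b' \<alpha>' \<beta>' S \<psi>"
  unfolding regular_chart_def
proof (intro conjI ballI allI)
  note reg = assms(1)[unfolded regular_chart_def]
  show "local_param \<M> S \<psi>" "convex S" "bounded S" using reg by auto
  fix w assume w: "w \<in> S"
  show "\<alpha>' \<le> volume_density \<psi> w" "volume_density \<psi> w \<le> \<beta>'" using reg w assms(4,5) by force+
  show "norm (Dat \<psi> w v) \<le> b' * norm v" for v
  proof -
    have "norm (Dat \<psi> w v) \<le> b * norm v" using reg w by blast
    also have "\<dots> \<le> b' * norm v" using assms(3) by (rule mult_right_mono) simp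
    finally show ?thesis .
  qed
  fix w' assume w': "w' \<in> S"
  have "a' * norm (w - w') \<le> a * norm (w - w')" using assms(2) by (rule mult_right_mono) simp
  also have "\<dots> \<le> norm (\<psi> w - \<psi> w')" using reg w w' by blast
  finally show "a' * norm (w - w') \<le> norm (\<psi> w - \<psi> w')" .
qed

text \<open>
  A small ball around the parameter of the point does: there the derivative of the chart is
  close to the injective derivative at the centre, so the chart is close to an injective linear
  map in the Lipschitz sense, and the density is continuous and positive.
\<close>

lemma regular_chart_exists:
  fixes \<M> :: "(real^'D) set"
  assumes cm: "compact_manifold TYPE('d::finite) \<M>" and x: "x \<in> \<M>"
  shows "\<exists>a b \<alpha> \<beta> S (\<psi> :: real^'d \<Rightarrow> real^'D). 0 < a \<and> 0 < b \<and> 0 < \<alpha> \<and> 0 < \<beta> \<and>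
           regular_chart \<M> a b \<alpha> \<beta> S \<psi> \<and> x \<in> \<psi> ` S"
proof -
  obtain U and \<psi> :: "real^'d \<Rightarrow> real^'D" and u where lp: "local_param \<M> U \<psi>" and u: "u \<in> U" and xu: "x = \<psi> u"
    using compact_manifold_chart[OF cm x] .
  let ?D = "\<lambda>w. Dat \<psi> w"
  obtain R where R: "linear R" "\<And>v. R (?D u v) = v" using chart_left_inverse_exists[OF lp u] by blast
  obtain B where B: "B > 0" "\<And>v. norm (R v) \<le> B * norm v" using linear_bounded_pos[OF R(1)] by blast
  obtain B0 where B0: "B0 > 0" "\<And>v. norm (?D u v) \<le> B0 * norm v"
    using linear_bounded_pos[OF local_param_linear[OF lp u]] by blast
  have low: "norm v / B \<le> norm (?D u v)" for v
    using B(2)[of "?D u v"] B(1) R(2) by (simp add: field_simps)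
  note opU = local_param_open[OF lp]
  have evU: "\<forall>\<^sub>F w in nhds u. w \<in> U" using opU u by (rule eventually_nhds_in_open)
  have isC: "((\<lambda>w. ?D w v) \<longlongrightarrow> ?D u v) (nhds u)" for v
    using local_param_deriv_cont[OF lp, of v] opU u tendsto_at_iff_tendsto_nhds[of "\<lambda>w. ?D w v" u]
    by (simp add: continuous_on_eq_continuous_at isCont_def)
  have "((\<lambda>w. \<Sum>i\<in>UNIV. norm (?D w (axis i 1) - ?D u (axis i 1))) \<longlongrightarrow>
        (\<Sum>i\<in>UNIV. norm (?D u (axis i 1) - ?D u (axis i 1)))) (nhds u)"
    by (intro tendsto_intros isC)
  then have "((\<lambda>w. \<Sum>i\<in>UNIV. norm (?D w (axis i 1) - ?D u (axis i 1))) \<longlongrightarrow> 0) (nhds u)" by simp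
  from order_tendstoD(2)[OF this, of "1 / (2 * B)"] B(1)
  have ev1: "\<forall>\<^sub>F w in nhds u. (\<Sum>i\<in>UNIV. norm (?D w (axis i 1) - ?D u (axis i 1))) < 1 / (2 * B)" by simp
  have pos: "volume_density \<psi> u > 0" by (rule volume_density_pos[OF cm lp u])
  have "isCont (volume_density \<psi>) u"
    using continuous_on_volume_density[OF lp] opU u by (simp add: continuous_on_eq_continuous_at)
  then have "(volume_density \<psi> \<longlongrightarrow> volume_density \<psi> u) (nhds u)"
    by (simp add: isCont_def tendsto_at_iff_tendsto_nhds)
  from order_tendstoD(1)[OF this, of "volume_density \<psi> u / 2"] order_tendstoD(2)[OF this, of "2 * volume_density \<psi> u"] pos
  have ev2: "\<forall>\<^sub>F w in nhds u. volume_density \<psi> u / 2 < volume_density \<psi> w"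
    "\<forall>\<^sub>F w in nhds u. volume_density \<psi> w < 2 * volume_density \<psi> u" by auto
  obtain \<rho> where \<rho>: "\<rho> > 0" "\<And>w. dist w u < \<rho> \<Longrightarrow> w \<in> U \<and> (\<Sum>i\<in>UNIV. norm (?D w (axis i 1) - ?D u (axis i 1))) < 1 / (2 * B)
      \<and> volume_density \<psi> u / 2 < volume_density \<psi> w \<and> volume_density \<psi> w < 2 * volume_density \<psi> u"
    using eventually_conj[OF evU eventually_conj[OF ev1 eventually_conj[OF ev2]]]
    unfolding eventually_nhds_metric by blast
  define S where "S = ball u \<rho>"
  have SU: "S \<subseteq> U" using \<rho>(2) by (auto simp: S_def dist_commute)
  \<comment> \<open>Half of the lower bound \<open>1 / B\<close> for \<open>?D u\<close>, so that half of it survives for the chart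
    itself.\<close>
  have near: "norm (?D w v - ?D u v) \<le> 1 / (2 * B) * norm v" if w: "w \<in> S" for w v
  proof -
    have lin: "linear (\<lambda>v. ?D w v - ?D u v)"
      using local_param_linear[OF lp] SU w u by (intro linear_compose_sub) auto
    have "?D w v - ?D u v = (\<Sum>i\<in>UNIV. v $ i *\<^sub>R (?D w (axis i 1) - ?D u (axis i 1)))"
      using linear_sum[OF lin, of "\<lambda>i. v $ i *\<^sub>R axis i 1" UNIV] basis_expansion[of v] linear_scale[OF lin]
      by (simp add: scalar_mult_eq_scaleR)
    also have "norm \<dots> \<le> (\<Sum>i\<in>UNIV. norm v * norm (?D w (axis i 1) - ?D u (axis i 1)))"
      by (rule order_trans[OF norm_sum sum_mono]) (auto intro!: mult_right_mono component_le_norm_cart)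
    also have "\<dots> = norm v * (\<Sum>i\<in>UNIV. norm (?D w (axis i 1) - ?D u (axis i 1)))" by (simp add: sum_distrib_left)
    also have "\<dots> \<le> norm v * (1 / (2 * B))"
      using \<rho>(2)[of w] w by (intro mult_left_mono) (auto simp: S_def dist_commute)
    finally show ?thesis by (simp add: mult.commute)
  qed
  have "local_param \<M> S \<psi>" by (rule local_param_subset[OF lp _ SU]) (simp add: S_def)
  moreover have "convex S" "bounded S" by (auto simp: S_def)
  moreover have "1 / (2 * B) * norm (w - w') \<le> norm (\<psi> w - \<psi> w')" if w: "w \<in> S" "w' \<in> S" for w w'
  proof -
    have linDu: "linear (?D u)" by (rule local_param_linear[OF lp u])
    have der: "((\<lambda>y. \<psi> y - ?D u y) has_derivative (\<lambda>v. ?D y v - ?D u v)) (at y within S)" if "y \<in> S" for y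
    proof (rule has_derivative_diff)
      show "(\<psi> has_derivative ?D y) (at y within S)"
        using local_param_deriv[OF lp] SU that has_derivative_at_withinI by blast
      show "(?D u has_derivative ?D u) (at y within S)"
        using linDu by (simp add: linear_imp_has_derivative)
    qed
    have "norm ((\<psi> w - ?D u w) - (\<psi> w' - ?D u w')) \<le> 1 / (2 * B) * norm (w - w')"
    proof (rule differentiable_bound[OF \<open>convex S\<close> der _ w])
      show "onorm (\<lambda>v. ?D y v - ?D u v) \<le> 1 / (2 * B)" if "y \<in> S" for y
        by (rule onorm_bound) (use B(1) near[OF that] in auto)
    qed
    moreover have "(\<psi> w - ?D u w) - (\<psi> w' - ?D u w') = (\<psi> w - \<psi> w') - ?D u (w - w')"
      using linDu by (simp add: linear_diff)
    ultimately have "norm (?D u (w - w')) - norm (\<psi> w - \<psi> w') \<le> 1 / (2 * B) * norm (w - w')"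
      using norm_triangle_ineq2[of "?D u (w - w')" "\<psi> w - \<psi> w'"] by (simp add: norm_minus_commute)
    then show ?thesis using low[of "w - w'"] by (simp add: field_simps)
  qed
  moreover have "norm (?D w v) \<le> (B0 + 1 / (2 * B)) * norm v" if "w \<in> S" for w v
    using near[OF that, of v] B0(2)[of v] norm_triangle_ineq2[of "?D w v" "?D u v"] by (simp add: algebra_simps)
  moreover have "volume_density \<psi> u / 2 \<le> volume_density \<psi> w \<and> volume_density \<psi> w \<le> 2 * volume_density \<psi> u" if "w \<in> S" for w
    using \<rho>(2)[of w] that by (force simp: S_def dist_commute)
  ultimately have "regular_chart \<M> (1 / (2 * B)) (B0 + 1 / (2 * B)) (volume_density \<psi> u / 2) (2 * volume_density \<psi> u) S \<psi>"
    unfolding regular_chart_def by blast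
  moreover have "x \<in> \<psi> ` S" using xu \<rho>(1) by (auto simp: S_def)
  ultimately show ?thesis using B B0 pos
    by (intro exI[of _ "1 / (2 * B)"] exI[of _ "B0 + 1 / (2 * B)"] exI[of _ "volume_density \<psi> u / 2"]
        exI[of _ "2 * volume_density \<psi> u"] exI[of _ S] exI[of _ \<psi>]) (auto intro: add_pos_pos)
qed

lemma regular_atlas_exists:
  fixes \<M> :: "(real^'D) set"
  assumes cm: "compact_manifold TYPE('d::finite) \<M>"
  obtains a b \<alpha> \<beta> and \<C> :: "((real^'d) set \<times> (real^'d \<Rightarrow> real^'D)) set" where
    "0 < a" "0 < b" "0 < \<alpha>" "0 < \<beta>" "finite \<C>"
    "\<And>S \<psi>. (S, \<psi>) \<in> \<C> \<Longrightarrow> regular_chart \<M> a b \<alpha> \<beta> S \<psi>"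
    "\<M> = (\<Union>(S, \<psi>)\<in>\<C>. \<psi> ` S)"
proof -
  have "\<forall>x\<in>\<M>. \<exists>q. (case q of (a, b, \<alpha>, \<beta>, S, \<psi> :: real^'d \<Rightarrow> real^'D) \<Rightarrow> 0 < a \<and> 0 < b \<and> 0 < \<alpha> \<and> 0 < \<beta> \<and>
           regular_chart \<M> a b \<alpha> \<beta> S \<psi> \<and> x \<in> \<psi> ` S)"
    using regular_chart_exists[OF cm] by auto
  from bchoice[OF this] obtain q where
    "\<forall>x\<in>\<M>. case q x of (a, b, \<alpha>, \<beta>, S, \<psi> :: real^'d \<Rightarrow> real^'D) \<Rightarrow>
      0 < a \<and> 0 < b \<and> 0 < \<alpha> \<and> 0 < \<beta> \<and> regular_chart \<M> a b \<alpha> \<beta> S \<psi> \<and> x \<in> \<psi> ` S" ..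
  note q = bspec[OF this]
  define qa where "qa x = fst (q x)" for x
  define qb where "qb x = fst (snd (q x))" for x
  define q\<alpha> where "q\<alpha> x = fst (snd (snd (q x)))" for x
  define q\<beta> where "q\<beta> x = fst (snd (snd (snd (q x))))" for x
  define c where "c x = snd (snd (snd (snd (q x))))" for x
  have Q: "0 < qa x" "0 < qb x" "0 < q\<alpha> x" "0 < q\<beta> x"
     "regular_chart \<M> (qa x) (qb x) (q\<alpha> x) (q\<beta> x) (fst (c x)) (snd (c x))" "x \<in> snd (c x) ` fst (c x)" if "x \<in> \<M>" for x
    using q[OF that] by (auto simp: qa_def qb_def q\<alpha>_def q\<beta>_def c_def split: prod.splits)
  have "compact \<M>" using cm by (simp add: compact_manifold_def)
  have open_charts: "openin (top_of_set \<M>) (snd (c x) ` fst (c x))" if "x \<in> \<M>" for x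
    using Q(5)[OF that] by (simp add: regular_chart_def local_param_def)
  obtain X where X: "X \<subseteq> \<M>" "finite X" "\<M> \<subseteq> (\<Union>x\<in>X. snd (c x) ` fst (c x))"
  proof -
    let ?V = "\<lambda>x. snd (c x) ` fst (c x)"
    have "\<forall>V\<in>?V ` \<M>. openin (top_of_set \<M>) V" using open_charts by blast
    moreover have "\<M> \<subseteq> \<Union>(?V ` \<M>)" using Q(6) by blast
    ultimately obtain \<D> where D: "\<D> \<subseteq> ?V ` \<M>" "finite \<D>" "\<M> \<subseteq> \<Union>\<D>"
      using \<open>compact \<M>\<close>[unfolded compact_eq_openin_cover, rule_format, of "?V ` \<M>"] by blast
    from finite_subset_image[OF D(2,1)] obtain X where "X \<subseteq> \<M>" "finite X" "\<D> = ?V ` X"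
      by blast
    then show thesis using that D(3) by blast
  qed
  define a where "a = Min (insert 1 (qa ` X))"
  define b where "b = Max (insert 1 (qb ` X))"
  define \<alpha> where "\<alpha> = Min (insert 1 (q\<alpha> ` X))"
  define \<beta> where "\<beta> = Max (insert 1 (q\<beta> ` X))"
  have pos: "0 < a" "0 < \<alpha>" "1 \<le> b" "1 \<le> \<beta>"
    using X(1,2) Q(1,3) by (auto simp: a_def b_def \<alpha>_def \<beta>_def)
  show thesis
  proof (rule that[of a b \<alpha> \<beta> "c ` X"])
    fix S \<psi> assume "(S, \<psi>) \<in> c ` X"
    then obtain x where x: "x \<in> X" "c x = (S, \<psi>)" by auto
    have "regular_chart \<M> (qa x) (qb x) (q\<alpha> x) (q\<beta> x) S \<psi>" using Q(5)[of x] x X(1) by auto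
    then show "regular_chart \<M> a b \<alpha> \<beta> S \<psi>"
      by (rule regular_chart_mono) (use x X(2) in \<open>auto simp: a_def b_def \<alpha>_def \<beta>_def\<close>)
  next
    show "\<M> = (\<Union>(S, \<psi>)\<in>c ` X. \<psi> ` S)"
    proof
      show "\<M> \<subseteq> (\<Union>(S, \<psi>)\<in>c ` X. \<psi> ` S)"
        using X(3) by (simp add: case_prod_beta)
      have "snd (c x) ` fst (c x) \<subseteq> \<M>" if "x \<in> X" for x
        using Q(5)[of x] that X(1) local_param_sub unfolding regular_chart_def by blast
      then show "(\<Union>(S, \<psi>)\<in>c ` X. \<psi> ` S) \<subseteq> \<M>" by (simp add: case_prod_beta UN_subset_iff)
    qed
  qed (use pos X(2) in auto)
qed

section \<open>Images of sets under differentiable maps, and inner regularity\<close>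

lemma regular_chart_local_param: "regular_chart \<M> a b \<alpha> \<beta> S \<psi> \<Longrightarrow> local_param \<M> S \<psi>"
  by (simp add: regular_chart_def)

abbreviation tangent_bound ::
  "'d::finite itself \<Rightarrow> (real^'D) set \<Rightarrow> real \<Rightarrow> (real^'D \<Rightarrow> real^'m) \<Rightarrow> bool" where
  "tangent_bound d \<M> K f \<equiv> \<forall>x\<in>\<M>. \<exists>L. (f has_derivative L) (at x within \<M>) \<and>
     (\<forall>v\<in>tangent_space d \<M> x. norm (L v) \<le> K * norm v)"

text \<open>
  The mean value inequality, applied to \<open>f \<circ> \<psi>\<close> on the convex parameter domain.
\<close>

lemma Lipschitz_on_regular_chart:
  fixes \<psi> :: "real^'d \<Rightarrow> real^'D" and f :: "real^'D \<Rightarrow> real^'m" and d :: "'d itself"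
  assumes reg: "regular_chart \<M> a b \<alpha> \<beta> S \<psi>" and K: "K \<ge> 0"
    and f: "tangent_bound d \<M> K f"
    and w: "w \<in> S" "w' \<in> S"
  shows "norm (f (\<psi> w) - f (\<psi> w')) \<le> K * b * norm (w - w')"
proof -
  note lp = regular_chart_local_param[OF reg]
  have in_M: "\<psi> w \<in> \<M>" if "w \<in> S" for w using local_param_sub[OF lp] that by auto
  obtain L where L: "\<And>x. x \<in> \<M> \<Longrightarrow> (f has_derivative L x) (at x within \<M>) \<and> (\<forall>v\<in>tangent_space d \<M> x. norm (L x v) \<le> K * norm v)"
    using f by metis
  have b: "norm (Dat \<psi> y v) \<le> b * norm v" if "y \<in> S" for y v
    using reg that unfolding regular_chart_def by blast
  have b0: "b \<ge> 0"
  proof -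
    have "0 \<le> norm (Dat \<psi> w (axis undefined 1))" by simp
    also have "\<dots> \<le> b * norm (axis undefined 1 :: real^'d)" by (rule b[OF w(1)])
    finally show ?thesis by simp
  qed
  have conv: "convex S" using reg by (simp add: regular_chart_def)
  show ?thesis
  proof (rule differentiable_bound[OF conv _ _ w, where f = "\<lambda>w. f (\<psi> w)" and f' = "\<lambda>y v. L (\<psi> y) (Dat \<psi> y v)"])
    fix y assume y: "y \<in> S"
    show "((\<lambda>w. f (\<psi> w)) has_derivative (\<lambda>v. L (\<psi> y) (Dat \<psi> y v))) (at y within S)"
      using compose_chart_has_derivative[OF lp y] L[OF in_M[OF y]] has_derivative_at_withinI by blast
    show "onorm (\<lambda>v. L (\<psi> y) (Dat \<psi> y v)) \<le> K * b"
    proof (rule onorm_bound)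
      fix v
      have "norm (L (\<psi> y) (Dat \<psi> y v)) \<le> K * norm (Dat \<psi> y v)"
        using L[OF in_M[OF y]] tangent_space_chart[OF lp y, of d] by auto
      also have "\<dots> \<le> K * (b * norm v)" using K b[OF y] by (intro mult_left_mono)
      finally show "norm (L (\<psi> y) (Dat \<psi> y v)) \<le> K * b * norm v" by (simp add: mult.assoc)
    qed (use K b0 in simp)
  qed
qed

lemma open_chart_preimage:
  fixes \<psi> :: "real^'d \<Rightarrow> real^'D"
  assumes lp: "local_param \<M> U \<psi>" and f: "continuous_on \<M> f" "f ` \<M> \<subseteq> \<M>"
    and V: "openin (top_of_set \<M>) V"
  shows "open {w\<in>U. f (\<psi> w) \<in> V}"
proof -
  have "continuous_on U (\<lambda>w. f (\<psi> w))"
    using local_param_cont[OF lp] local_param_sub[OF lp] continuous_on_compose2[OF f(1)] by blast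
  moreover obtain T where T: "open T" "V = \<M> \<inter> T" using V by (auto simp: openin_open)
  ultimately have "open (U \<inter> (\<lambda>w. f (\<psi> w)) -` T)"
    using local_param_open[OF lp] by (simp add: continuous_on_open_vimage Int_commute)
  moreover have "{w\<in>U. f (\<psi> w) \<in> V} = U \<inter> (\<lambda>w. f (\<psi> w)) -` T"
    using T f(2) local_param_sub[OF lp] by auto
  ultimately show ?thesis by simp
qed

lemma normalised_lebesgue_facts:
  fixes \<M> :: "(real^'D) set"
  assumes nl: "normalised_lebesgue TYPE('d::finite) \<M> m"
  shows normalised_lebesgue_space: "space m = \<M>"
    and normalised_lebesgue_prob: "prob_space m"
    and normalised_lebesgue_sets_iff: "A \<in> sets m \<longleftrightarrow>
      A \<subseteq> \<M> \<and> (\<forall>U (\<psi> :: real^'d \<Rightarrow> real^'D). local_param \<M> U \<psi> \<longrightarrow> U \<inter> \<psi> -` A \<in> sets lebesgue)"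
  using nl unfolding normalised_lebesgue_def by (auto intro: prob_spaceI)

text \<open>
  Seen in any other chart, the set is the image of a Lebesgue set under the differentiable map
  \<open>\<psi>2\<inverse> \<circ> f \<circ> \<psi>\<close> between spaces of equal dimension. With the identity for \<open>f\<close> this shows that
  chart images of Lebesgue sets are measurable.
\<close>

lemma chart_image_in_sets:
  fixes \<M> :: "(real^'D) set" and \<psi> :: "real^'d::finite \<Rightarrow> real^'D"
  assumes nl: "normalised_lebesgue TYPE('d) \<M> m"
    and lp: "local_param \<M> U \<psi>" and A: "A \<in> sets lebesgue" "A \<subseteq> U"
    and f: "f differentiable_on \<M>" "f ` \<M> \<subseteq> \<M>"
  shows "f ` \<psi> ` A \<in> sets m"
  unfolding normalised_lebesgue_sets_iff[OF nl]
proof (intro conjI allI impI)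
  show "f ` \<psi> ` A \<subseteq> \<M>" using local_param_sub[OF lp] A(2) f(2) by blast
  fix U2 and \<psi>2 :: "real^'d \<Rightarrow> real^'D" assume lp2: "local_param \<M> U2 \<psi>2"
  define k where "k = inv_into U2 \<psi>2"
  have k: "k (\<psi>2 w) = w" if "w \<in> U2" for w
    using local_param_inj[OF lp2] that by (simp add: k_def)
  define A' where "A' = A \<inter> {w\<in>U. f (\<psi> w) \<in> \<psi>2 ` U2}"
  have contf: "continuous_on \<M> f" using f(1) by (rule differentiable_imp_continuous_on)
  have "open {w\<in>U. f (\<psi> w) \<in> \<psi>2 ` U2}"
    using open_chart_preimage[OF lp contf f(2)] lp2 by (simp add: local_param_def)
  then have A': "A' \<in> sets lebesgue" using A(1) by (auto simp: A'_def)
  have "(\<lambda>w. k (f (\<psi> w))) differentiable_on A'"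
    unfolding differentiable_on_def
  proof
    fix w assume w: "w \<in> A'"
    then obtain w2 where w2: "w2 \<in> U2" "f (\<psi> w) = \<psi>2 w2" and wU: "w \<in> U" by (auto simp: A'_def)
    obtain R where R: "linear R" "\<And>v. R (Dat \<psi>2 w2 v) = v"
      using chart_left_inverse_exists[OF lp2 w2(1)] by blast
    have kd: "(k has_derivative R) (at (\<psi>2 w2) within \<M>)"
      by (rule chart_inverse_has_derivative[OF lp2 w2(1) k R])
    have "\<psi> w \<in> \<M>" using wU local_param_sub[OF lp] by auto
    then obtain L where L: "(f has_derivative L) (at (\<psi> w) within \<M>)"
      using f(1) by (auto simp: differentiable_on_def differentiable_def)
    have "(k has_derivative R) (at (f (\<psi> w)) within f ` \<M>)"
      using kd f(2) unfolding w2(2) by (rule has_derivative_subset)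
    from diff_chain_within[OF L this] have "((\<lambda>x. k (f x)) has_derivative (\<lambda>v. R (L v))) (at (\<psi> w) within \<M>)"
      by (simp add: o_def)
    from compose_chart_has_derivative[OF lp wU this] show "(\<lambda>w. k (f (\<psi> w))) differentiable (at w within A')"
      unfolding differentiable_def using has_derivative_at_withinI by blast
  qed
  then have "(\<lambda>w. k (f (\<psi> w))) ` A' \<in> sets lebesgue"
    by (intro differentiable_image_in_sets_lebesgue[OF A']) auto
  moreover have "(\<lambda>w. k (f (\<psi> w))) ` A' = U2 \<inter> \<psi>2 -` (f ` \<psi> ` A)"
  proof (intro equalityI subsetI)
    fix y assume "y \<in> (\<lambda>w. k (f (\<psi> w))) ` A'"
    then obtain w w2 where w: "y = k (f (\<psi> w))" "w \<in> A" "w2 \<in> U2" "f (\<psi> w) = \<psi>2 w2"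
      by (auto simp: A'_def)
    then have "y = w2" using k by simp
    then show "y \<in> U2 \<inter> \<psi>2 -` (f ` \<psi> ` A)" using w(2-4) by (metis IntI imageI vimageI)
  next
    fix y assume "y \<in> U2 \<inter> \<psi>2 -` (f ` \<psi> ` A)"
    then obtain w where w: "y \<in> U2" "w \<in> A" "\<psi>2 y = f (\<psi> w)" by auto
    then have "f (\<psi> w) \<in> \<psi>2 ` U2" by (metis imageI)
    then have "w \<in> A'" using w(2) A(2) unfolding A'_def by blast
    moreover have "k (f (\<psi> w)) = y" using k[OF w(1)] w(3) by simp
    ultimately show "y \<in> (\<lambda>w. k (f (\<psi> w))) ` A'" by (intro image_eqI[of _ _ w]) simp_all
  qed
  ultimately show "U2 \<inter> \<psi>2 -` (f ` \<psi> ` A) \<in> sets lebesgue" by simp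
qed

lemma regular_chart_emeasure_bounds:
  fixes \<M> :: "(real^'D) set"
  assumes nl: "normalised_lebesgue TYPE('d::finite) \<M> m"
  obtains c where "c > 0"
    "\<And>a b \<alpha> \<beta> S (\<psi> :: real^'d \<Rightarrow> real^'D) A. regular_chart \<M> a b \<alpha> \<beta> S \<psi> \<Longrightarrow> 0 < \<alpha> \<Longrightarrow> 0 < \<beta> \<Longrightarrow> A \<in> sets lebesgue \<Longrightarrow> A \<subseteq> S \<Longrightarrow>
       ennreal (c * \<alpha>) * emeasure lebesgue A \<le> emeasure m (\<psi> ` A) \<and> emeasure m (\<psi> ` A) \<le> ennreal (c * \<beta>) * emeasure lebesgue A"
proof -
  obtain c where c: "c > 0" "\<And>U (\<psi> :: real^'d \<Rightarrow> real^'D) A. local_param \<M> U \<psi> \<Longrightarrow> A \<in> sets lebesgue \<Longrightarrow> A \<subseteq> U \<Longrightarrow>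
        emeasure m (\<psi> ` A) = ennreal c * (\<integral>\<^sup>+u\<in>A. ennreal (volume_density \<psi> u) \<partial>lebesgue)"
    using nl unfolding normalised_lebesgue_def by blast
  show thesis
  proof (rule that[OF c(1)])
    fix a b \<alpha> \<beta> :: real and S A and \<psi> :: "real^'d \<Rightarrow> real^'D"
    assume reg: "regular_chart \<M> a b \<alpha> \<beta> S \<psi>" and pos: "0 < \<alpha>" "0 < \<beta>" and A: "A \<in> sets lebesgue" "A \<subseteq> S"
    have dens: "\<alpha> \<le> volume_density \<psi> w" "volume_density \<psi> w \<le> \<beta>" if "w \<in> A" for w
      using reg that A(2) unfolding regular_chart_def by blast+
    have const: "(\<integral>\<^sup>+u\<in>A. ennreal t \<partial>lebesgue) = ennreal t * emeasure lebesgue A" for t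
      by (rule nn_integral_cmult_indicator[OF A(1)])
    have "(\<integral>\<^sup>+u\<in>A. ennreal \<alpha> \<partial>lebesgue) \<le> (\<integral>\<^sup>+u\<in>A. ennreal (volume_density \<psi> u) \<partial>lebesgue)"
      using dens by (intro nn_integral_mono) (auto simp: indicator_def intro: ennreal_leI)
    moreover have "(\<integral>\<^sup>+u\<in>A. ennreal (volume_density \<psi> u) \<partial>lebesgue) \<le> (\<integral>\<^sup>+u\<in>A. ennreal \<beta> \<partial>lebesgue)"
      using dens by (intro nn_integral_mono) (auto simp: indicator_def intro: ennreal_leI)
    ultimately show "ennreal (c * \<alpha>) * emeasure lebesgue A \<le> emeasure m (\<psi> ` A) \<and> emeasure m (\<psi> ` A) \<le> ennreal (c * \<beta>) * emeasure lebesgue A"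
      unfolding c(2)[OF regular_chart_local_param[OF reg] A] const using c(1) pos
      by (auto simp: ennreal_mult mult.assoc intro!: mult_left_mono)
  qed
qed

lemma differentiable_image_in_sets:
  fixes \<M> :: "(real^'D) set"
  assumes cm: "compact_manifold TYPE('d::finite) \<M>" and nl: "normalised_lebesgue TYPE('d) \<M> m"
    and f: "f differentiable_on \<M>" "f ` \<M> \<subseteq> \<M>" and A: "A \<in> sets m"
  shows "f ` A \<in> sets m"
proof -
  obtain a b \<alpha> \<beta> and \<C> :: "((real^'d) set \<times> (real^'d \<Rightarrow> real^'D)) set" where
    C: "finite \<C>" "\<And>S \<psi>. (S, \<psi>) \<in> \<C> \<Longrightarrow> regular_chart \<M> a b \<alpha> \<beta> S \<psi>" "\<M> = (\<Union>(S, \<psi>)\<in>\<C>. \<psi> ` S)"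
    using regular_atlas_exists[OF cm] by metis
  have "A \<subseteq> \<M>" using A normalised_lebesgue_sets_iff[OF nl] by blast
  have "f ` \<psi> ` (S \<inter> \<psi> -` A) \<in> sets m" if "(S, \<psi>) \<in> \<C>" for S \<psi>
    using chart_image_in_sets[OF nl regular_chart_local_param[OF C(2)[OF that]] _ _ f, of "S \<inter> \<psi> -` A"]
      A[unfolded normalised_lebesgue_sets_iff[OF nl]] regular_chart_local_param[OF C(2)[OF that]] by blast
  then have "(\<Union>(S, \<psi>)\<in>\<C>. f ` \<psi> ` (S \<inter> \<psi> -` A)) \<in> sets m"
    using C(1) by (intro sets.finite_UN) auto
  moreover have "(\<Union>(S, \<psi>)\<in>\<C>. f ` \<psi> ` (S \<inter> \<psi> -` A)) = f ` A"
  proof (intro equalityI subsetI)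
    fix y assume "y \<in> f ` A"
    then obtain x where x: "x \<in> A" "y = f x" by auto
    then obtain S \<psi> w where "(S, \<psi>) \<in> \<C>" "w \<in> S" "x = \<psi> w" using C(3) \<open>A \<subseteq> \<M>\<close> by blast
    then show "y \<in> (\<Union>(S, \<psi>)\<in>\<C>. f ` \<psi> ` (S \<inter> \<psi> -` A))" using x by blast
  qed auto
  ultimately show ?thesis by simp
qed

lemma borel_measurable_chartwise_continuous:
  fixes \<M> :: "(real^'D) set" and h :: "real^'D \<Rightarrow> real"
  assumes nl: "normalised_lebesgue TYPE('d::finite) \<M> m"
    and h: "\<And>U (\<psi> :: real^'d \<Rightarrow> real^'D). local_param \<M> U \<psi> \<Longrightarrow> continuous_on U (\<lambda>w. h (\<psi> w))"
  shows "h \<in> borel_measurable m"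
  unfolding borel_measurable_iff_less normalised_lebesgue_space[OF nl]
proof
  fix t
  show "{x\<in>\<M>. h x < t} \<in> sets m"
    unfolding normalised_lebesgue_sets_iff[OF nl]
  proof (intro conjI allI impI)
    fix U and \<psi> :: "real^'d \<Rightarrow> real^'D" assume lp: "local_param \<M> U \<psi>"
    have "open (U \<inter> (\<lambda>w. h (\<psi> w)) -` {..<t})"
      using h[OF lp] local_param_open[OF lp] by (simp add: continuous_on_open_vimage Int_commute)
    moreover have "U \<inter> \<psi> -` {x\<in>\<M>. h x < t} = U \<inter> (\<lambda>w. h (\<psi> w)) -` {..<t}"
      using local_param_sub[OF lp] by auto
    ultimately show "U \<inter> \<psi> -` {x\<in>\<M>. h x < t} \<in> sets lebesgue" by (simp add: borel_open)
  qed auto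
qed

text \<open>
  On a piece of \<open>A\<close> that lies in one regular chart and is mapped into another, the map is
  Lipschitz in coordinates with constant \<open>K b / a\<close>, and the densities are bounded above and
  below. Since every pair of charts gives only one piece, the sum over the pieces is controlled
  by \<open>A\<close> itself, and the constant depends on \<open>K\<close> but not on \<open>f\<close>. This uniformity over all maps
  with the same bound is essential: it is applied to all members of a family of flow maps at
  once.
\<close>

lemma emeasure_image_le_of_tangent_bound:
  fixes \<M> :: "(real^'D) set"
  assumes cm: "compact_manifold TYPE('d::finite) \<M>" and nl: "normalised_lebesgue TYPE('d) \<M> m" and K: "K > 0"
  obtains C where "C > 0"
    "\<And>f A. f ` \<M> \<subseteq> \<M> \<Longrightarrow>
      tangent_bound TYPE('d) \<M> K f \<Longrightarrow>
      A \<in> sets m \<Longrightarrow> emeasure m (f ` A) \<le> ennreal C * emeasure m A"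
proof -
  obtain a b \<alpha> \<beta> and \<C> :: "((real^'d) set \<times> (real^'d \<Rightarrow> real^'D)) set" where
    pos: "0 < a" "0 < b" "0 < \<alpha>" "0 < \<beta>" and
    C: "finite \<C>" "\<And>S \<psi>. (S, \<psi>) \<in> \<C> \<Longrightarrow> regular_chart \<M> a b \<alpha> \<beta> S \<psi>" "\<M> = (\<Union>(S, \<psi>)\<in>\<C>. \<psi> ` S)"
    using regular_atlas_exists[OF cm] by metis
  obtain c where c: "c > 0"
    "\<And>a b \<alpha> \<beta> S (\<psi> :: real^'d \<Rightarrow> real^'D) A. regular_chart \<M> a b \<alpha> \<beta> S \<psi> \<Longrightarrow> 0 < \<alpha> \<Longrightarrow> 0 < \<beta> \<Longrightarrow> A \<in> sets lebesgue \<Longrightarrow> A \<subseteq> S \<Longrightarrow>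
       ennreal (c * \<alpha>) * emeasure lebesgue A \<le> emeasure m (\<psi> ` A) \<and> emeasure m (\<psi> ` A) \<le> ennreal (c * \<beta>) * emeasure lebesgue A"
    using regular_chart_emeasure_bounds[OF nl] by blast
  define H where "H = K * b / a"
  have H: "H > 0" using K pos by (simp add: H_def)
  define E where "E = (\<beta> / \<alpha>) * (5 * H) ^ CARD('d)"
  have E: "E > 0" using pos H by (simp add: E_def)
  show thesis
  proof (rule that[of "real (card (\<C> \<times> \<C>)) * E + 1"])
    show "0 < real (card (\<C> \<times> \<C>)) * E + 1" using E by (simp add: add_nonneg_pos)
    fix f A
    assume fM: "f ` \<M> \<subseteq> \<M>"
      and df: "tangent_bound TYPE('d) \<M> K f" and A: "A \<in> sets m"
    have diff: "f differentiable_on \<M>" using df by (auto simp: differentiable_on_def differentiable_def)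
    then have contf: "continuous_on \<M> f" by (rule differentiable_imp_continuous_on)
    have AM: "A \<subseteq> \<M>" using A normalised_lebesgue_sets_iff[OF nl] by blast
    define P where "P q = A \<inter> (snd (fst q) ` fst (fst q)) \<inter> f -` (snd (snd q) ` fst (snd q))"
      for q :: "((real^'d) set \<times> (real^'d \<Rightarrow> real^'D)) \<times> ((real^'d) set \<times> (real^'d \<Rightarrow> real^'D))"
    have piece: "P q \<in> sets m \<and> emeasure m (f ` P q) \<le> ennreal E * emeasure m (P q)" if q: "q \<in> \<C> \<times> \<C>" for q
    proof -
      obtain S \<psi> S' \<psi>' where qq: "q = ((S, \<psi>), (S', \<psi>'))" by (metis surj_pair)
      have reg: "regular_chart \<M> a b \<alpha> \<beta> S \<psi>" and reg': "regular_chart \<M> a b \<alpha> \<beta> S' \<psi>'"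
        using q C(2) by (auto simp: qq)
      note lp = regular_chart_local_param[OF reg] and lp' = regular_chart_local_param[OF reg']
      define A' where "A' = (S \<inter> \<psi> -` A) \<inter> {w\<in>S. f (\<psi> w) \<in> \<psi>' ` S'}"
      have "open {w\<in>S. f (\<psi> w) \<in> \<psi>' ` S'}"
        using open_chart_preimage[OF lp contf fM] lp' by (simp add: local_param_def)
      moreover have "S \<inter> \<psi> -` A \<in> sets lebesgue"
        using A[unfolded normalised_lebesgue_sets_iff[OF nl]] lp by blast
      ultimately have A': "A' \<in> sets lebesgue" by (auto simp: A'_def)
      have A'S: "A' \<subseteq> S" by (auto simp: A'_def)
      have Pq: "P q = \<psi> ` A'" by (auto simp: P_def qq A'_def)
      have "P q \<in> sets m"
        using chart_image_in_sets[OF nl lp A' A'S, of "\<lambda>x. x"] by (simp add: Pq)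
      define k where "k = inv_into S' \<psi>'"
      have k: "k (\<psi>' w) = w" if "w \<in> S'" for w
        using local_param_inj[OF lp'] that by (simp add: k_def)
      define h where "h w = k (f (\<psi> w))" for w
      have h: "h w \<in> S'" "\<psi>' (h w) = f (\<psi> w)" if "w \<in> A'" for w
        using that k by (auto simp: h_def A'_def)
      have lip: "norm (h w - h w') \<le> H * norm (w - w')" if w: "w \<in> A'" "w' \<in> A'" for w w'
      proof -
        have "a * norm (h w - h w') \<le> norm (\<psi>' (h w) - \<psi>' (h w'))"
          using reg' h(1)[OF w(1)] h(1)[OF w(2)] unfolding regular_chart_def by blast
        also have "\<dots> = norm (f (\<psi> w) - f (\<psi> w'))" using h(2) w by simp
        also have "\<dots> \<le> K * b * norm (w - w')"
          by (rule Lipschitz_on_regular_chart[OF reg _ df]) (use K w A'S in auto)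
        finally show ?thesis using pos(1) by (simp add: H_def field_simps)
      qed
      note Lip = emeasure_Lipschitz_image_le[OF A' H lip]
      have fP: "f ` P q = \<psi>' ` (h ` A')" using h(2) by (auto simp: Pq image_image)
      have hS: "h ` A' \<subseteq> S'" using h(1) by auto
      have "emeasure m (f ` P q) \<le> ennreal (c * \<beta>) * emeasure lebesgue (h ` A')"
        unfolding fP using c(2)[OF reg' pos(3,4) Lip(1) hS] by blast
      also have "\<dots> \<le> ennreal (c * \<beta>) * (ennreal ((5 * H) ^ CARD('d)) * emeasure lebesgue A')"
        using Lip(2) by (intro mult_left_mono) auto
      also have "\<dots> = ennreal E * (ennreal (c * \<alpha>) * emeasure lebesgue A')"
      proof -
        have "c * \<beta> * (5 * H) ^ CARD('d) = E * (c * \<alpha>)" using pos by (simp add: E_def)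
        then have "ennreal (c * \<beta>) * ennreal ((5 * H) ^ CARD('d)) = ennreal E * ennreal (c * \<alpha>)"
          using pos c(1) H E by (simp add: ennreal_mult[symmetric])
        then show ?thesis by (simp only: mult.assoc[symmetric])
      qed
      also have "\<dots> \<le> ennreal E * emeasure m (P q)"
        unfolding Pq using c(2)[OF reg pos(3,4) A' A'S] by (intro mult_left_mono) auto
      finally show ?thesis using \<open>P q \<in> sets m\<close> by simp
    qed
    have fP: "f ` P q \<in> sets m" if "q \<in> \<C> \<times> \<C>" for q
      using differentiable_image_in_sets[OF cm nl diff fM] piece[OF that] by blast
    have "f ` A = (\<Union>q\<in>\<C>\<times>\<C>. f ` P q)"
    proof (intro equalityI subsetI)
      fix y assume "y \<in> f ` A"
      then obtain x where x: "x \<in> A" "y = f x" by auto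
      then obtain S \<psi> where 1: "(S, \<psi>) \<in> \<C>" "x \<in> \<psi> ` S" using C(3) AM by blast
      have "f x \<in> \<M>" using x AM fM by auto
      then obtain S' \<psi>' where 2: "(S', \<psi>') \<in> \<C>" "f x \<in> \<psi>' ` S'" using C(3) by blast
      show "y \<in> (\<Union>q\<in>\<C>\<times>\<C>. f ` P q)"
        using x 1 2 by (intro UN_I[of "((S, \<psi>), (S', \<psi>'))"]) (auto simp: P_def)
    qed (auto simp: P_def)
    then have "emeasure m (f ` A) \<le> (\<Sum>q\<in>\<C>\<times>\<C>. emeasure m (f ` P q))"
      using fP C(1) by (simp add: emeasure_subadditive_finite image_subset_iff)
    also have "\<dots> \<le> (\<Sum>q\<in>\<C>\<times>\<C>. ennreal E * emeasure m A)"
    proof (rule sum_mono)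
      fix q assume q: "q \<in> \<C> \<times> \<C>"
      have "emeasure m (P q) \<le> emeasure m A" by (rule emeasure_mono[OF _ A]) (auto simp: P_def)
      then show "emeasure m (f ` P q) \<le> ennreal E * emeasure m A"
        using piece[OF q] by (meson mult_left_mono order_trans zero_le)
    qed
    also have "\<dots> = ennreal (real (card (\<C> \<times> \<C>)) * E) * emeasure m A"
      using E by (simp add: ennreal_mult ennreal_of_nat_eq_real_of_nat mult.assoc)
    also have "\<dots> \<le> ennreal (real (card (\<C> \<times> \<C>)) * E + 1) * emeasure m A"
      by (intro mult_right_mono ennreal_leI) auto
    finally show "emeasure m (f ` A) \<le> ennreal (real (card (\<C> \<times> \<C>)) * E + 1) * emeasure m A" .
  qed
qed

text \<open>
  Lebesgue measure is inner regular in the parameter domains, and these are bounded, so that the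
  closed sets found there are compact and have compact images.
\<close>

lemma compact_inner_approximation:
  fixes \<M> :: "(real^'D) set"
  assumes cm: "compact_manifold TYPE('d::finite) \<M>" and nl: "normalised_lebesgue TYPE('d) \<M> m"
    and A: "A \<in> sets m" and "\<epsilon> > 0"
  obtains Q where "compact Q" "Q \<subseteq> A" "Q \<in> sets m" "emeasure m (A - Q) < ennreal \<epsilon>"
proof -
  obtain a b \<alpha> \<beta> and \<C> :: "((real^'d) set \<times> (real^'d \<Rightarrow> real^'D)) set" where
    pos: "0 < a" "0 < b" "0 < \<alpha>" "0 < \<beta>" and
    C: "finite \<C>" "\<And>S \<psi>. (S, \<psi>) \<in> \<C> \<Longrightarrow> regular_chart \<M> a b \<alpha> \<beta> S \<psi>" "\<M> = (\<Union>(S, \<psi>)\<in>\<C>. \<psi> ` S)"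
    using regular_atlas_exists[OF cm] by metis
  obtain c where c: "c > 0"
    "\<And>a b \<alpha> \<beta> S (\<psi> :: real^'d \<Rightarrow> real^'D) A. regular_chart \<M> a b \<alpha> \<beta> S \<psi> \<Longrightarrow> 0 < \<alpha> \<Longrightarrow> 0 < \<beta> \<Longrightarrow> A \<in> sets lebesgue \<Longrightarrow> A \<subseteq> S \<Longrightarrow>
       ennreal (c * \<alpha>) * emeasure lebesgue A \<le> emeasure m (\<psi> ` A) \<and> emeasure m (\<psi> ` A) \<le> ennreal (c * \<beta>) * emeasure lebesgue A"
    using regular_chart_emeasure_bounds[OF nl] by blast
  have AM: "A \<subseteq> \<M>" using A normalised_lebesgue_sets_iff[OF nl] by blast
  \<comment> \<open>One share of \<open>\<epsilon>\<close> for each chart, after multiplication by the density bound.\<close>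
  define e where "e = \<epsilon> / (2 * c * \<beta> * (real (card \<C>) + 1))"
  have e: "e > 0" using pos c(1) \<open>\<epsilon> > 0\<close> by (simp add: e_def add_nonneg_pos)
  have "\<exists>T. closed T \<and> T \<subseteq> fst q \<inter> snd q -` A \<and> T \<in> sets lebesgue \<and> fst q \<inter> snd q -` A \<in> sets lebesgue \<and>
      emeasure lebesgue ((fst q \<inter> snd q -` A) - T) < ennreal e" if "q \<in> \<C>" for q
  proof -
    have "local_param \<M> (fst q) (snd q)" using C(2) that regular_chart_local_param by (metis prod.collapse)
    then have "fst q \<inter> snd q -` A \<in> sets lebesgue"
      using A[unfolded normalised_lebesgue_sets_iff[OF nl]] by blast
    moreover from sets_lebesgue_inner_closed[OF this e] obtain T where
      "closed T" "T \<subseteq> fst q \<inter> snd q -` A" "emeasure lebesgue ((fst q \<inter> snd q -` A) - T) < ennreal e" by metis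
    ultimately show ?thesis by (intro exI[of _ T]) (auto simp: borel_closed)
  qed
  then obtain T where T: "\<And>q. q \<in> \<C> \<Longrightarrow> closed (T q) \<and> T q \<subseteq> fst q \<inter> snd q -` A \<and> T q \<in> sets lebesgue \<and> fst q \<inter> snd q -` A \<in> sets lebesgue \<and>
      emeasure lebesgue ((fst q \<inter> snd q -` A) - T q) < ennreal e" by metis
  define Q where "Q = (\<Union>q\<in>\<C>. snd q ` T q)"
  have lp: "local_param \<M> (fst q) (snd q)" if "q \<in> \<C>" for q
    using C(2) that regular_chart_local_param by (metis prod.collapse)
  have im: "snd q ` X \<in> sets m" if "q \<in> \<C>" "X \<in> sets lebesgue" "X \<subseteq> fst q" for q X
    using chart_image_in_sets[OF nl lp[OF that(1)] that(2,3), of "\<lambda>x. x"] by simp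
  show thesis
  proof (rule that[of Q])
    show "compact Q"
      unfolding Q_def
    proof (intro compact_UN C(1))
      fix q assume q: "q \<in> \<C>"
      have "bounded (fst q)" using C(2)[of "fst q" "snd q"] q by (simp add: regular_chart_def)
      then have "compact (T q)" using T[OF q] by (meson bounded_subset compact_eq_bounded_closed le_inf_iff)
      then show "compact (snd q ` T q)"
        using T[OF q] local_param_cont[OF lp[OF q]] by (meson compact_continuous_image continuous_on_subset le_inf_iff)
    qed
    show "Q \<subseteq> A"
    proof
      fix x assume "x \<in> Q"
      then obtain q w where "q \<in> \<C>" "w \<in> T q" "x = snd q w" unfolding Q_def by blast
      then show "x \<in> A" using T[of q] by blast
    qed
    show Qm: "Q \<in> sets m" unfolding Q_def by (intro sets.finite_UN C(1) im) (use T in auto)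
    let ?R = "\<lambda>q. snd q ` ((fst q \<inter> snd q -` A) - T q)"
    have Rm: "?R q \<in> sets m" if "q \<in> \<C>" for q by (rule im[OF that]) (use T[OF that] in auto)
    have "A - Q \<subseteq> (\<Union>q\<in>\<C>. ?R q)"
    proof
      fix x assume x: "x \<in> A - Q"
      then obtain S \<psi> w where 1: "(S, \<psi>) \<in> \<C>" "w \<in> S" "x = \<psi> w" using C(3) AM by blast
      have "w \<notin> T (S, \<psi>)"
      proof
        assume "w \<in> T (S, \<psi>)"
        then have "x \<in> snd (S, \<psi>) ` T (S, \<psi>)" using 1(3) by simp
        then show False using x 1(1) unfolding Q_def by blast
      qed
      then show "x \<in> (\<Union>q\<in>\<C>. ?R q)" using x 1 by (intro UN_I[of "(S, \<psi>)"]) auto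
    qed
    then have "emeasure m (A - Q) \<le> emeasure m (\<Union>q\<in>\<C>. ?R q)"
      by (rule emeasure_mono) (intro sets.finite_UN C(1) Rm)
    also have "\<dots> \<le> (\<Sum>q\<in>\<C>. emeasure m (?R q))"
      using Rm C(1) by (intro emeasure_subadditive_finite) auto
    also have "\<dots> \<le> (\<Sum>q\<in>\<C>. ennreal (c * \<beta>) * ennreal e)"
    proof (rule sum_mono)
      fix q assume q: "q \<in> \<C>"
      have "regular_chart \<M> a b \<alpha> \<beta> (fst q) (snd q)" using C(2)[of "fst q" "snd q"] q by simp
      from c(2)[OF this pos(3,4)] have "emeasure m (?R q) \<le> ennreal (c * \<beta>) * emeasure lebesgue ((fst q \<inter> snd q -` A) - T q)"
        using T[OF q] by (meson Diff_subset Int_lower1 order_trans sets.Diff)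
      also have "\<dots> \<le> ennreal (c * \<beta>) * ennreal e" using T[OF q] by (intro mult_left_mono) auto
      finally show "emeasure m (?R q) \<le> ennreal (c * \<beta>) * ennreal e" .
    qed
    also have "\<dots> = ennreal (real (card \<C>) * (c * \<beta> * e))"
      using pos c(1) e by (simp add: ennreal_mult ennreal_of_nat_eq_real_of_nat mult.assoc)
    also have "\<dots> < ennreal \<epsilon>"
    proof (rule ennreal_lessI[OF \<open>\<epsilon> > 0\<close>])
      have "c * \<beta> * e = \<epsilon> / (2 * (real (card \<C>) + 1))"
        using c(1) pos by (simp add: e_def)
      then have "real (card \<C>) * (c * \<beta> * e) = \<epsilon> * (real (card \<C>) / (2 * (real (card \<C>) + 1)))"
        by simp
      also have "\<dots> < \<epsilon> * 1" using \<open>\<epsilon> > 0\<close> by (intro mult_strict_left_mono) (auto simp: field_simps)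
      finally show "real (card \<C>) * (c * \<beta> * e) < \<epsilon>" by simp
    qed
    finally show "emeasure m (A - Q) < ennreal \<epsilon>" .
  qed
qed

section \<open>The flow as the base point moves along its orbit\<close>

locale smooth_cocycle =
  fixes d :: "'d::finite itself" and \<M> :: "(real^'D) set" and \<Xi> :: "'z::real_normed_vector set"
    and g :: "'z \<Rightarrow> 'z" and \<xi> :: "real \<Rightarrow> 'z \<Rightarrow> 'z"
    and F :: "'z \<Rightarrow> real^'D \<Rightarrow> real^'D" and \<phi> :: "real \<Rightarrow> 'z \<Rightarrow> real^'D \<Rightarrow> real^'D"
  assumes manifold: "compact_manifold d \<M>"
    and driving: "ode_flow_on \<Xi> g \<xi>"
    and flow: "nonautonomous_flow d \<M> \<Xi> \<xi> F \<phi>"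
begin

lemma driving_in: "w \<in> \<Xi> \<Longrightarrow> \<xi> t w \<in> \<Xi>"
  and driving_zero: "w \<in> \<Xi> \<Longrightarrow> \<xi> 0 w = w"
  and driving_add: "w \<in> \<Xi> \<Longrightarrow> \<xi> s (\<xi> t w) = \<xi> (s + t) w"
  using driving by (auto simp: ode_flow_on_def)

lemma flow_in: "w \<in> \<Xi> \<Longrightarrow> x \<in> \<M> \<Longrightarrow> \<phi> t w x \<in> \<M>"
  and flow_zero: "w \<in> \<Xi> \<Longrightarrow> x \<in> \<M> \<Longrightarrow> \<phi> 0 w x = x"
  and flow_add: "w \<in> \<Xi> \<Longrightarrow> x \<in> \<M> \<Longrightarrow> \<phi> s (\<xi> t w) (\<phi> t w x) = \<phi> (s + t) w x"
  and flow_differentiable: "w \<in> \<Xi> \<Longrightarrow> \<phi> t w differentiable_on \<M>"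
  using flow by (auto simp: nonautonomous_flow_def)

lemma flow_image: "w \<in> \<Xi> \<Longrightarrow> \<phi> t w ` \<M> \<subseteq> \<M>"
  using flow_in by auto

lemma flow_inverse:
  assumes "w \<in> \<Xi>" "x \<in> \<M>"
  shows "\<phi> (-t) (\<xi> t w) (\<phi> t w x) = x" "\<phi> t w (\<phi> (-t) (\<xi> t w) x) = x"
proof -
  show "\<phi> (-t) (\<xi> t w) (\<phi> t w x) = x"
    using assms by (simp add: flow_add flow_zero)
  have "\<phi> t (\<xi> (-t) (\<xi> t w)) (\<phi> (-t) (\<xi> t w) x) = x"
    using flow_add[OF driving_in[OF assms(1)] assms(2), of t "-t" t] flow_zero[OF driving_in[OF assms(1)] assms(2)] by simp
  then show "\<phi> t w (\<phi> (-t) (\<xi> t w) x) = x"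
    using assms by (simp add: driving_add driving_zero)
qed

text \<open>
  The continuity assumption on the flow concerns one base point \<open>w\<close> at a time. Flowing from the
  shifted base point \<open>\<xi> \<delta> w\<close> is the same as flowing back to \<open>w\<close> and then forward along the orbit
  of \<open>w\<close>; in this way all maps \<open>\<phi> s (\<xi> \<delta> w)\<close> are expressed by the flow from \<open>w\<close> and the inverse
  of its time-\<open>\<delta>\<close> map.
\<close>

lemma flow_shifted_base:
  assumes "w \<in> \<Xi>" "x \<in> \<M>"
  shows "\<phi> s (\<xi> \<delta> w) x = \<phi> (s + \<delta>) w (\<phi> (-\<delta>) (\<xi> \<delta> w) x)"
  using flow_add[OF assms(1) flow_in[OF driving_in[OF assms(1)] assms(2)], of s \<delta> "-\<delta>" \<delta>] flow_inverse(2)[OF assms] by simp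

abbreviation D\<phi> :: "real \<Rightarrow> 'z \<Rightarrow> real^'D \<Rightarrow> real^'D \<Rightarrow> real^'D" where
  "D\<phi> t w x \<equiv> tangent_map d \<M> (\<phi> t w) x"

abbreviation T :: "real^'D \<Rightarrow> (real^'D) set" where
  "T x \<equiv> tangent_space d \<M> x"

lemma D_flow: "w \<in> \<Xi> \<Longrightarrow> x \<in> \<M> \<Longrightarrow> (\<phi> t w has_derivative D\<phi> t w x) (at x within \<M>)"
  using tangent_map_has_derivative[OF manifold] flow_differentiable by (auto simp: differentiable_on_def)

lemma linear_D_flow: "w \<in> \<Xi> \<Longrightarrow> x \<in> \<M> \<Longrightarrow> linear (D\<phi> t w x)"
  using D_flow has_derivative_linear by blast

lemma D_flow_matrix: "w \<in> \<Xi> \<Longrightarrow> x \<in> \<M> \<Longrightarrow> matrix (D\<phi> t w x) *v v = D\<phi> t w x v"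
  by (rule matrix_vector_mul(2)[OF linear_D_flow, THEN fun_cong])

lemma continuous_on_D_flow_matrix:
  "w \<in> \<Xi> \<Longrightarrow> continuous_on (UNIV \<times> \<M>) (\<lambda>(t, x). matrix (D\<phi> t w x))"
  using flow by (auto simp: nonautonomous_flow_def)

lemma compact_manifold_set: "compact \<M>"
  using manifold by (simp add: compact_manifold_def)

lemma D_flow_zero: "w \<in> \<Xi> \<Longrightarrow> x \<in> \<M> \<Longrightarrow> v \<in> T x \<Longrightarrow> D\<phi> 0 w x v = v"
proof -
  assume a: "w \<in> \<Xi>" "x \<in> \<M>" "v \<in> T x"
  have "(\<phi> 0 w has_derivative (\<lambda>v. v)) (at x within \<M>)"
    by (rule has_derivative_transform[OF a(2) flow_zero[OF a(1)] has_derivative_ident])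
  from derivative_within_unique_on_tangent_space[OF D_flow[OF a(1,2)] this a(3)] show ?thesis .
qed

lemma D_flow_bounded:
  assumes w: "w \<in> \<Xi>"
  obtains K where "K > 0" "\<And>t x v. \<bar>t\<bar> \<le> r \<Longrightarrow> x \<in> \<M> \<Longrightarrow> norm (D\<phi> t w x v) \<le> K * norm v"
proof -
  define G where "G = (\<lambda>(t, x). \<Sum>i\<in>UNIV. \<Sum>j\<in>UNIV. \<bar>matrix (D\<phi> t w x) $ i $ j\<bar>)"
  have c: "continuous_on ({-r..r} \<times> \<M>) (\<lambda>p. matrix (D\<phi> (fst p) w (snd p)))"
    using continuous_on_subset[OF continuous_on_D_flow_matrix[OF w], of "{-r..r} \<times> \<M>"] by (auto simp: case_prod_beta)
  have "continuous_on ({-r..r} \<times> \<M>) G"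
    unfolding G_def case_prod_beta by (intro continuous_intros c)
  then have "compact (G ` ({-r..r} \<times> \<M>))"
    by (intro compact_continuous_image compact_Times compact_manifold_set) auto
  then obtain K where K: "\<And>p. p \<in> {-r..r} \<times> \<M> \<Longrightarrow> norm (G p) \<le> K"
    using compact_imp_bounded[of "G ` ({-r..r} \<times> \<M>)"] unfolding bounded_iff by blast
  show thesis
  proof (rule that[of "\<bar>K\<bar> + 1"])
    fix t x v assume t: "\<bar>t\<bar> \<le> r" and x: "x \<in> \<M>"
    have "norm (D\<phi> t w x v) \<le> G (t, x) * norm v"
      using norm_matrix_vector_le_sum[of "matrix (D\<phi> t w x)" v] by (simp add: D_flow_matrix[OF w x] G_def)
    also have "G (t, x) \<le> \<bar>K\<bar> + 1" using K[of "(t, x)"] t x by (auto simp: abs_le_iff)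
    finally show "norm (D\<phi> t w x v) \<le> (\<bar>K\<bar> + 1) * norm v" by (simp add: mult_right_mono)
  qed simp
qed

text \<open>
  The entries of \<open>D\<phi> t w x - D\<phi> 0 w x\<close> are uniformly continuous on a compact set of pairs
  \<open>(t, x)\<close> and vanish for \<open>t = 0\<close>.
\<close>

lemma D_flow_near_zero:
  assumes w: "w \<in> \<Xi>" and "\<epsilon> > 0"
  shows "\<forall>\<^sub>F t in at_right 0. \<forall>x\<in>\<M>. \<forall>v. norm (D\<phi> t w x v - D\<phi> 0 w x v) \<le> \<epsilon> * norm v"
proof -
  define G where "G = (\<lambda>(t, x). \<Sum>i\<in>UNIV. \<Sum>j\<in>UNIV. \<bar>(matrix (D\<phi> t w x) - matrix (D\<phi> 0 w x)) $ i $ j\<bar>)"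
  have c1: "continuous_on ({-1..1} \<times> \<M>) (\<lambda>p. matrix (D\<phi> (fst p) w (snd p)))"
    using continuous_on_subset[OF continuous_on_D_flow_matrix[OF w], of "{-1..1} \<times> \<M>"] by (auto simp: case_prod_beta)
  have "continuous_on ({-1..1} \<times> \<M>) (\<lambda>p. (0::real, snd p))" by (intro continuous_intros)
  then have c2: "continuous_on ({-1..1} \<times> \<M>) (\<lambda>p. matrix (D\<phi> 0 w (snd p)))"
    using continuous_on_compose2[OF continuous_on_D_flow_matrix[OF w], of "{-1..1} \<times> \<M>" "\<lambda>p. (0, snd p)"]
    by (simp add: image_subset_iff)
  have "continuous_on ({-1..1} \<times> \<M>) G"
    unfolding G_def case_prod_beta by (intro continuous_intros c1 c2)
  then have unif: "uniformly_continuous_on ({-1..1} \<times> \<M>) G"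
    by (intro compact_uniformly_continuous compact_Times compact_manifold_set) auto
  then obtain \<eta> where \<eta>: "\<eta> > 0" "\<And>p q. p \<in> {-1..1} \<times> \<M> \<Longrightarrow> q \<in> {-1..1} \<times> \<M> \<Longrightarrow> dist q p < \<eta> \<Longrightarrow> dist (G q) (G p) < \<epsilon>"
    using unif[unfolded uniformly_continuous_on_def, rule_format, OF \<open>\<epsilon> > 0\<close>] by blast
  have "\<forall>\<^sub>F t in at_right 0. t \<in> {0<..<min \<eta> 1}"
    using \<eta>(1) by (intro eventually_at_right_real) simp
  then show ?thesis
  proof eventually_elim
    case (elim t)
    show ?case
    proof (intro ballI allI)
      fix x v assume x: "x \<in> \<M>"
      have "dist (G (t, x)) (G (0, x)) < \<epsilon>"
        by (rule \<eta>(2)) (use elim x in \<open>auto simp: dist_Pair_Pair\<close>)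
      then have "G (t, x) < \<epsilon>" by (simp add: G_def dist_real_def)
      have "norm (D\<phi> t w x v - D\<phi> 0 w x v) = norm ((matrix (D\<phi> t w x) - matrix (D\<phi> 0 w x)) *v v)"
        by (simp add: matrix_vector_mult_diff_rdistrib D_flow_matrix[OF w x])
      also have "\<dots> \<le> G (t, x) * norm v"
        unfolding G_def using norm_matrix_vector_le_sum[of "matrix (D\<phi> t w x) - matrix (D\<phi> 0 w x)" v] by simp
      also have "\<dots> \<le> \<epsilon> * norm v" using \<open>G (t, x) < \<epsilon>\<close> by (intro mult_right_mono) auto
      finally show "norm (D\<phi> t w x v - D\<phi> 0 w x v) \<le> \<epsilon> * norm v" .
    qed
  qed
qed

text \<open>
  Each orbit is continuous in time, and the derivative bound makes the flow maps Lipschitz in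
  the point near \<open>x0\<close>, uniformly in time.
\<close>

lemma continuous_on_flow:
  assumes w: "w \<in> \<Xi>"
  shows "continuous_on ({-r..r} \<times> \<M>) (\<lambda>(t, x). \<phi> t w x)"
  unfolding continuous_on_iff
proof (intro ballI allI impI)
  fix p :: "real \<times> (real^'D)" and \<epsilon> :: real assume p: "p \<in> {-r..r} \<times> \<M>" and "\<epsilon> > 0"
  obtain t0 x0 where pp: "p = (t0, x0)" and t0: "\<bar>t0\<bar> \<le> r" and x0: "x0 \<in> \<M>" using p by auto
  obtain K where K: "K > 0" "\<And>t x v. \<bar>t\<bar> \<le> r \<Longrightarrow> x \<in> \<M> \<Longrightarrow> norm (D\<phi> t w x v) \<le> K * norm v"
    using D_flow_bounded[OF w] by blast
  have "compact_manifold TYPE('d) \<M>" using manifold by (simp add: compact_manifold_def)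
  from regular_chart_exists[OF this x0] obtain a b \<alpha> \<beta> S and \<psi> :: "real^'d \<Rightarrow> real^'D" where
    pos: "0 < a" "0 < b" and reg: "regular_chart \<M> a b \<alpha> \<beta> S \<psi>" and x0S: "x0 \<in> \<psi> ` S"
    by blast
  have op: "openin (top_of_set \<M>) (\<psi> ` S)" using reg by (simp add: regular_chart_def local_param_def)
  obtain \<eta>1 where \<eta>1: "\<eta>1 > 0" "\<And>y. y \<in> \<M> \<Longrightarrow> dist y x0 < \<eta>1 \<Longrightarrow> y \<in> \<psi> ` S"
    using bspec[OF conjunct2[OF op[unfolded openin_euclidean_subtopology_iff]] x0S] by blast
  have "((\<lambda>t. \<phi> t w x0) has_vector_derivative F (\<xi> t0 w) (\<phi> t0 w x0)) (at t0)"
    using flow w x0 by (simp add: nonautonomous_flow_def)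
  then have "isCont (\<lambda>t. \<phi> t w x0) t0" by (rule has_vector_derivative_continuous)
  then obtain \<eta>2 where \<eta>2: "\<eta>2 > 0" "\<And>t. dist t t0 < \<eta>2 \<Longrightarrow> dist (\<phi> t w x0) (\<phi> t0 w x0) < \<epsilon> / 2"
    using \<open>\<epsilon> > 0\<close> unfolding continuous_at_eps_delta by (meson half_gt_zero)
  define H where "H = K * b / a"
  have H: "H > 0" using K pos by (simp add: H_def)
  define \<eta> where "\<eta> = min (min \<eta>1 \<eta>2) (\<epsilon> / (2 * H))"
  show "\<exists>\<eta>>0. \<forall>q\<in>{-r..r} \<times> \<M>. dist q p < \<eta> \<longrightarrow> dist ((\<lambda>(t, x). \<phi> t w x) q) ((\<lambda>(t, x). \<phi> t w x) p) < \<epsilon>"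
  proof (intro exI conjI ballI impI)
    show "\<eta> > 0" using \<eta>1 \<eta>2 H \<open>\<epsilon> > 0\<close> by (simp add: \<eta>_def)
    fix q assume q: "q \<in> {-r..r} \<times> \<M>" and dq: "dist q p < \<eta>"
    obtain t x where qq: "q = (t, x)" and t: "\<bar>t\<bar> \<le> r" and x: "x \<in> \<M>" using q by auto
    have "dist t t0 \<le> dist q p" "dist x x0 \<le> dist q p"
      using dist_fst_le[of q p] dist_snd_le[of q p] by (auto simp: qq pp)
    then have dt: "dist t t0 < \<eta>2" and dx: "dist x x0 < \<eta>1" "dist x x0 < \<epsilon> / (2 * H)"
      using dq by (auto simp: \<eta>_def)
    obtain u u0 where u: "u \<in> S" "x = \<psi> u" "u0 \<in> S" "x0 = \<psi> u0" using \<eta>1(2)[OF x dx(1)] x0S by auto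
    have "tangent_bound d \<M> K (\<phi> t w)"
      using D_flow[OF w] K(2)[OF t] by blast
    then have "norm (\<phi> t w (\<psi> u) - \<phi> t w (\<psi> u0)) \<le> K * b * norm (u - u0)"
      by (rule Lipschitz_on_regular_chart[OF reg less_imp_le[OF K(1)] _ u(1,3)])
    also have "\<dots> \<le> K * b * (norm (x - x0) / a)"
    proof -
      have "a * norm (u - u0) \<le> norm (x - x0)" using reg u unfolding regular_chart_def by blast
      then show ?thesis using pos K by (intro mult_left_mono) (auto simp: field_simps)
    qed
    also have "\<dots> = H * dist x x0" by (simp add: H_def dist_norm)
    also have "\<dots> < \<epsilon> / 2" using dx(2) H by (simp add: field_simps)
    finally have "dist (\<phi> t w x) (\<phi> t w x0) < \<epsilon> / 2" by (simp add: dist_norm u)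
    then have "dist (\<phi> t w x) (\<phi> t0 w x0) < \<epsilon>"
      using \<eta>2(2)[OF dt] dist_triangle_half_r[of "\<phi> t w x0" "\<phi> t w x" \<epsilon> "\<phi> t0 w x0"] by (simp add: dist_commute)
    then show "dist ((\<lambda>(t, x). \<phi> t w x) q) ((\<lambda>(t, x). \<phi> t w x) p) < \<epsilon>" by (simp add: pp qq)
  qed
qed

lemma flow_uniform:
  assumes w: "w \<in> \<Xi>" and "\<epsilon> > 0"
  obtains \<eta> where "\<eta> > 0"
    "\<And>t t' x x'. \<bar>t\<bar> \<le> r \<Longrightarrow> \<bar>t'\<bar> \<le> r \<Longrightarrow> x \<in> \<M> \<Longrightarrow> x' \<in> \<M> \<Longrightarrow> \<bar>t - t'\<bar> < \<eta> \<Longrightarrow> norm (x - x') < \<eta> \<Longrightarrow> norm (\<phi> t w x - \<phi> t' w x') < \<epsilon>"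
proof -
  have unif: "uniformly_continuous_on ({-r..r} \<times> \<M>) (\<lambda>(t, x). \<phi> t w x)"
    by (intro compact_uniformly_continuous continuous_on_flow[OF w] compact_Times compact_manifold_set) auto
  then obtain \<eta> where \<eta>: "\<eta> > 0" "\<And>p q. p \<in> {-r..r} \<times> \<M> \<Longrightarrow> q \<in> {-r..r} \<times> \<M> \<Longrightarrow> dist q p < \<eta> \<Longrightarrow>
      dist ((\<lambda>(t, x). \<phi> t w x) q) ((\<lambda>(t, x). \<phi> t w x) p) < \<epsilon>"
    using unif[unfolded uniformly_continuous_on_def, rule_format, OF \<open>\<epsilon> > 0\<close>] by blast
  show thesis
  proof (rule that[of "\<eta> / 2"])
    fix t t' :: real and x x' assume a: "\<bar>t\<bar> \<le> r" "\<bar>t'\<bar> \<le> r" "x \<in> \<M>" "x' \<in> \<M>" "\<bar>t - t'\<bar> < \<eta> / 2" "norm (x - x') < \<eta> / 2"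
    have "dist (t, x) (t', x') \<le> dist t t' + dist x x'"
      unfolding dist_Pair_Pair by (rule sqrt_sum_squares_le_sum) auto
    then have "dist (t, x) (t', x') < \<eta>" using a by (simp add: dist_real_def dist_norm)
    from \<eta>(2)[OF _ _ this] a show "norm (\<phi> t w x - \<phi> t' w x') < \<epsilon>" by (auto simp: dist_norm abs_le_iff)
  qed (use \<eta>(1) in simp)
qed

lemma small_time_inverse_uniformly_near_id:
  assumes w: "w \<in> \<Xi>" and "\<epsilon> > 0"
  shows "\<forall>\<^sub>F \<delta> in at_right 0. \<forall>x\<in>\<M>. norm (\<phi> (-\<delta>) (\<xi> \<delta> w) x - x) < \<epsilon>"
proof -
  obtain \<eta> where \<eta>: "\<eta> > 0"
    "\<And>t t' x x'. \<bar>t\<bar> \<le> 1 \<Longrightarrow> \<bar>t'\<bar> \<le> 1 \<Longrightarrow> x \<in> \<M> \<Longrightarrow> x' \<in> \<M> \<Longrightarrow> \<bar>t - t'\<bar> < \<eta> \<Longrightarrow> norm (x - x') < \<eta> \<Longrightarrow> norm (\<phi> t w x - \<phi> t' w x') < \<epsilon>"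
    by (rule flow_uniform[OF w \<open>\<epsilon> > 0\<close>, where r = 1]) (rule that)
  have "\<forall>\<^sub>F t in at_right 0. t \<in> {0<..<min \<eta> 1}"
    using \<eta>(1) by (intro eventually_at_right_real) simp
  then show ?thesis
  proof eventually_elim
    case (elim \<delta>)
    show ?case
    proof
      fix x assume x: "x \<in> \<M>"
      let ?y = "\<phi> (-\<delta>) (\<xi> \<delta> w) x"
      have y: "?y \<in> \<M>" by (rule flow_in[OF driving_in[OF w] x])
      have "norm (\<phi> 0 w ?y - \<phi> \<delta> w ?y) < \<epsilon>"
        by (rule \<eta>(2)) (use elim y \<eta>(1) in auto)
      then show "norm (?y - x) < \<epsilon>"
        by (simp add: flow_zero[OF w y] flow_inverse(2)[OF w x])
    qed
  qed
qed

lemma shifted_flow_uniformly_near: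
  assumes w: "w \<in> \<Xi>" and "\<epsilon> > 0"
  shows "\<forall>\<^sub>F \<delta> in at_right 0. \<forall>x\<in>\<M>. norm (\<phi> s (\<xi> \<delta> w) x - \<phi> s w x) < \<epsilon>"
proof -
  obtain \<eta> where \<eta>: "\<eta> > 0"
    "\<And>t t' x x'. \<bar>t\<bar> \<le> \<bar>s\<bar> + 1 \<Longrightarrow> \<bar>t'\<bar> \<le> \<bar>s\<bar> + 1 \<Longrightarrow> x \<in> \<M> \<Longrightarrow> x' \<in> \<M> \<Longrightarrow> \<bar>t - t'\<bar> < \<eta> \<Longrightarrow> norm (x - x') < \<eta> \<Longrightarrow> norm (\<phi> t w x - \<phi> t' w x') < \<epsilon>"
    by (rule flow_uniform[OF w \<open>\<epsilon> > 0\<close>, where r = "\<bar>s\<bar> + 1"]) (rule that)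
  have "\<forall>\<^sub>F t in at_right 0. t \<in> {0<..<min \<eta> 1}"
    using \<eta>(1) by (intro eventually_at_right_real) simp
  with small_time_inverse_uniformly_near_id[OF w \<eta>(1)] show ?thesis
  proof eventually_elim
    case (elim \<delta>)
    show ?case
    proof
      fix x assume x: "x \<in> \<M>"
      have y: "\<phi> (-\<delta>) (\<xi> \<delta> w) x \<in> \<M>" by (rule flow_in[OF driving_in[OF w] x])
      show "norm (\<phi> s (\<xi> \<delta> w) x - \<phi> s w x) < \<epsilon>"
        unfolding flow_shifted_base[OF w x, of s \<delta>] by (rule \<eta>(2)) (use elim x y in auto)
    qed
  qed
qed

text \<open>
  The derivative of the inverse of the time-\<open>\<delta>\<close> map is controlled through an equation that it
  satisfies: if \<open>v'\<close> is the image of \<open>v\<close> under it, then \<open>D\<phi> \<delta> w\<close> maps \<open>v'\<close> back to \<open>v\<close>, and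
  \<open>D\<phi> \<delta> w\<close> is close to the identity on tangent vectors, so \<open>v'\<close> is close to \<open>v\<close>. The rest is the
  chain rule.
\<close>

lemma D_shifted_flow:
  assumes w: "w \<in> \<Xi>" and "\<epsilon> > 0"
  shows "\<forall>\<^sub>F \<delta> in at_right 0. \<forall>x\<in>\<M>. \<forall>v\<in>T x. \<exists>v'. norm (v' - v) \<le> \<epsilon> * norm v' \<and>
     (\<forall>s. D\<phi> s (\<xi> \<delta> w) x v = D\<phi> (s + \<delta>) w (\<phi> (-\<delta>) (\<xi> \<delta> w) x) v')"
  using D_flow_near_zero[OF assms]
proof eventually_elim
  case (elim \<delta>)
  show ?case
  proof (intro ballI)
    fix x v assume x: "x \<in> \<M>" and v: "v \<in> T x"
    note w\<delta> = driving_in[OF w, of \<delta>]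
    let ?I = "\<phi> (-\<delta>) (\<xi> \<delta> w)"
    have y: "?I x \<in> \<M>" by (rule flow_in[OF w\<delta> x])
    define v' where "v' = D\<phi> (-\<delta>) (\<xi> \<delta> w) x v"
    have v'T: "v' \<in> T (?I x)"
      unfolding v'_def by (rule derivative_maps_tangent_space[OF manifold x flow_image[OF w\<delta>] D_flow[OF w\<delta> x] v])
    \<comment> \<open>Used for \<open>t = \<delta>\<close>, where the composition is the identity, and for \<open>t = s + \<delta>\<close>, where
      it is the flow map from the shifted base point.\<close>
    have comp: "((\<lambda>y. \<phi> t w (?I y)) has_derivative (\<lambda>u. D\<phi> t w (?I x) (D\<phi> (-\<delta>) (\<xi> \<delta> w) x u))) (at x within \<M>)" for t
    proof -
      have "(\<phi> t w has_derivative D\<phi> t w (?I x)) (at (?I x) within ?I ` \<M>)"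
        using D_flow[OF w y] flow_image[OF w\<delta>] by (rule has_derivative_subset)
      from diff_chain_within[OF D_flow[OF w\<delta> x] this] show ?thesis by (simp add: o_def)
    qed
    have "((\<lambda>y. y) has_derivative (\<lambda>u. D\<phi> \<delta> w (?I x) (D\<phi> (-\<delta>) (\<xi> \<delta> w) x u))) (at x within \<M>)"
      by (rule has_derivative_transform[OF x _ comp[of \<delta>]]) (simp add: flow_inverse(2)[OF w])
    from derivative_within_unique_on_tangent_space[OF this has_derivative_ident v]
    have "D\<phi> \<delta> w (?I x) v' = v" by (simp add: v'_def)
    then have "norm (v' - v) = norm (D\<phi> \<delta> w (?I x) v' - D\<phi> 0 w (?I x) v')"
      using D_flow_zero[OF w y v'T] by (simp add: norm_minus_commute)
    then have "norm (v' - v) \<le> \<epsilon> * norm v'" using elim y by simp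
    moreover have "D\<phi> s (\<xi> \<delta> w) x v = D\<phi> (s + \<delta>) w (?I x) v'" for s
    proof -
      have "(\<phi> s (\<xi> \<delta> w) has_derivative (\<lambda>u. D\<phi> (s + \<delta>) w (?I x) (D\<phi> (-\<delta>) (\<xi> \<delta> w) x u))) (at x within \<M>)"
        by (rule has_derivative_transform[OF x _ comp[of "s + \<delta>"]]) (rule flow_shifted_base[OF w])
      from derivative_within_unique_on_tangent_space[OF D_flow[OF w\<delta> x] this v] show ?thesis by (simp add: v'_def)
    qed
    ultimately show "\<exists>v'. norm (v' - v) \<le> \<epsilon> * norm v' \<and> (\<forall>s. D\<phi> s (\<xi> \<delta> w) x v = D\<phi> (s + \<delta>) w (?I x) v')" by blast
  qed
qed

lemma D_shifted_flow_bounded: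
  assumes w: "w \<in> \<Xi>"
  obtains K where "K > 0"
    "\<forall>\<^sub>F \<delta> in at_right 0. \<forall>x\<in>\<M>. \<forall>v\<in>T x. norm (D\<phi> s (\<xi> \<delta> w) x v) \<le> K * norm v"
    "\<And>x v. x \<in> \<M> \<Longrightarrow> norm (D\<phi> s w x v) \<le> K * norm v"
proof -
  obtain K where K: "K > 0" "\<And>t x v. \<bar>t\<bar> \<le> \<bar>s\<bar> + 1 \<Longrightarrow> x \<in> \<M> \<Longrightarrow> norm (D\<phi> t w x v) \<le> K * norm v"
    using D_flow_bounded[OF w] by blast
  show thesis
  proof (rule that[of "2 * K"])
    have half: "(1/2 :: real) > 0" by simp
    have "\<forall>\<^sub>F t :: real in at_right 0. t \<in> {0<..<1}" by (intro eventually_at_right_real) simp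
    then show "\<forall>\<^sub>F \<delta> in at_right 0. \<forall>x\<in>\<M>. \<forall>v\<in>T x. norm (D\<phi> s (\<xi> \<delta> w) x v) \<le> 2 * K * norm v"
      using D_shifted_flow[OF w half]
    proof eventually_elim
      case (elim \<delta>)
      show ?case
      proof (intro ballI)
        fix x v assume x: "x \<in> \<M>" and v: "v \<in> T x"
        then obtain v' where v': "norm (v' - v) \<le> 1/2 * norm v'" "D\<phi> s (\<xi> \<delta> w) x v = D\<phi> (s + \<delta>) w (\<phi> (-\<delta>) (\<xi> \<delta> w) x) v'"
          using elim(2) by blast
        have le: "norm v' \<le> 2 * norm v" using v'(1) norm_triangle_ineq2[of v' v] by simp
        have "norm (D\<phi> s (\<xi> \<delta> w) x v) \<le> K * norm v'"
          unfolding v'(2) by (rule K(2)) (use elim(1) flow_in[OF driving_in[OF w] x] in auto)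
        also have "\<dots> \<le> K * (2 * norm v)" using le K(1) by (intro mult_left_mono) auto
        finally show "norm (D\<phi> s (\<xi> \<delta> w) x v) \<le> 2 * K * norm v" by simp
      qed
    qed
    fix x v assume "x \<in> \<M>"
    then have "norm (D\<phi> s w x v) \<le> K * norm v" by (intro K(2)) auto
    also have "\<dots> \<le> 2 * K * norm v" using K(1) by (intro mult_right_mono) auto
    finally show "norm (D\<phi> s w x v) \<le> 2 * K * norm v" .
  qed (use K(1) in simp)
qed

lemma D_shifted_flow_tendsto:
  assumes w: "w \<in> \<Xi>" and x: "x \<in> \<M>" and v: "v \<in> T x"
  shows "((\<lambda>\<delta>. D\<phi> s (\<xi> \<delta> w) x v) \<longlongrightarrow> D\<phi> s w x v) (at_right 0)"
proof -
  obtain K where K: "K > 0" "\<And>t x v. \<bar>t\<bar> \<le> \<bar>s\<bar> + 1 \<Longrightarrow> x \<in> \<M> \<Longrightarrow> norm (D\<phi> t w x v) \<le> K * norm v"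
    using D_flow_bounded[OF w] by blast
  let ?I = "\<lambda>\<delta>. \<phi> (-\<delta>) (\<xi> \<delta> w) x"
  have IM: "?I \<delta> \<in> \<M>" for \<delta> by (rule flow_in[OF driving_in[OF w] x])
  have "((\<lambda>\<delta>. ?I \<delta>) \<longlongrightarrow> x) (at_right 0)"
  proof (rule tendstoI)
    fix e :: real assume "e > 0"
    from small_time_inverse_uniformly_near_id[OF w this]
    show "\<forall>\<^sub>F \<delta> in at_right 0. dist (?I \<delta>) x < e"
      by eventually_elim (use x in \<open>simp add: dist_norm\<close>)
  qed
  then have "((\<lambda>\<delta>. (s + \<delta>, ?I \<delta>)) \<longlongrightarrow> (s + 0, x)) (at_right 0)"
    by (intro tendsto_intros)
  then have "((\<lambda>\<delta>. (\<lambda>(t, x). matrix (D\<phi> t w x)) (s + \<delta>, ?I \<delta>)) \<longlongrightarrow> (\<lambda>(t, x). matrix (D\<phi> t w x)) (s, x)) (at_right 0)"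
    by (intro continuous_on_tendsto_compose[OF continuous_on_D_flow_matrix[OF w]]) (use IM x in auto)
  then have "((\<lambda>\<delta>. matrix (D\<phi> (s + \<delta>) w (?I \<delta>)) *v v) \<longlongrightarrow> matrix (D\<phi> s w x) *v v) (at_right 0)"
    unfolding matrix_vector_mult_def by (intro tendsto_intros) simp
  then have main: "((\<lambda>\<delta>. D\<phi> (s + \<delta>) w (?I \<delta>) v) \<longlongrightarrow> D\<phi> s w x v) (at_right 0)"
    by (simp add: D_flow_matrix[OF w] IM x)
  have "((\<lambda>\<delta>. D\<phi> s (\<xi> \<delta> w) x v - D\<phi> (s + \<delta>) w (?I \<delta>) v) \<longlongrightarrow> 0) (at_right 0)"
  proof (rule tendstoI)
    fix \<epsilon> :: real assume "\<epsilon> > 0"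
    \<comment> \<open>The bound \<open>1/2\<close> ensures \<open>\<parallel>v'\<parallel> \<le> 2 \<parallel>v\<parallel>\<close> for the vectors \<open>v'\<close> below.\<close>
    define \<epsilon>' where "\<epsilon>' = min (1/2) (\<epsilon> / (4 * K * (norm v + 1)))"
    have n: "norm v + 1 > 0" using norm_ge_zero[of v] by linarith
    then have \<epsilon>': "\<epsilon>' > 0" using K(1) \<open>\<epsilon> > 0\<close> by (simp add: \<epsilon>'_def)
    have "\<forall>\<^sub>F t :: real in at_right 0. t \<in> {0<..<1}" by (intro eventually_at_right_real) simp
    then show "\<forall>\<^sub>F \<delta> in at_right 0. dist (D\<phi> s (\<xi> \<delta> w) x v - D\<phi> (s + \<delta>) w (?I \<delta>) v) 0 < \<epsilon>"
      using D_shifted_flow[OF w \<epsilon>']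
    proof eventually_elim
      case (elim \<delta>)
      obtain v' where v': "norm (v' - v) \<le> \<epsilon>' * norm v'" "D\<phi> s (\<xi> \<delta> w) x v = D\<phi> (s + \<delta>) w (?I \<delta>) v'"
        using elim(2) x v by blast
      have "\<epsilon>' * norm v' \<le> (1/2) * norm v'" by (intro mult_right_mono) (auto simp: \<epsilon>'_def)
      then have "norm v' \<le> 2 * (norm v + 1)" using v'(1) norm_triangle_ineq2[of v' v] by simp
      then have "norm (v' - v) \<le> \<epsilon> / (4 * K * (norm v + 1)) * (2 * (norm v + 1))"
        using v'(1) \<epsilon>' by (intro order_trans[OF v'(1)] mult_mono) (auto simp: \<epsilon>'_def)
      also have "\<dots> = \<epsilon> / (2 * K)" using n K(1) by (simp add: divide_simps)
      finally have small: "norm (v' - v) \<le> \<epsilon> / (2 * K)" .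
      have "D\<phi> s (\<xi> \<delta> w) x v - D\<phi> (s + \<delta>) w (?I \<delta>) v = D\<phi> (s + \<delta>) w (?I \<delta>) (v' - v)"
        unfolding v'(2) by (simp add: linear_diff[OF linear_D_flow[OF w IM]])
      also have "norm \<dots> \<le> K * norm (v' - v)"
        by (rule K(2)[OF _ IM]) (use elim(1) in auto)
      also have "\<dots> \<le> K * (\<epsilon> / (2 * K))" using small K(1) by (intro mult_left_mono) auto
      also have "\<dots> < \<epsilon>" using K(1) \<open>\<epsilon> > 0\<close> by simp
      finally show ?case by simp
    qed
  qed
  from tendsto_add[OF this main] show ?thesis by simp
qed

end

section \<open>Continuity of transition matrices and transported masses\<close>

text \<open>
  Dominated convergence along the filter \<open>at_right 0\<close>, where the bound need hold only
  eventually.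
\<close>

lemma integral_tendsto_zero_at_right:
  fixes f :: "real \<Rightarrow> 'a \<Rightarrow> real"
  assumes fin: "finite_measure m"
    and meas: "\<And>\<delta>. f \<delta> \<in> borel_measurable m"
    and bound: "\<forall>\<^sub>F \<delta> in at_right 0. \<forall>x\<in>space m. \<bar>f \<delta> x\<bar> \<le> C"
    and lim: "\<And>x. x \<in> space m \<Longrightarrow> ((\<lambda>\<delta>. f \<delta> x) \<longlongrightarrow> 0) (at_right 0)"
  shows "((\<lambda>\<delta>. LINT x|m. f \<delta> x) \<longlongrightarrow> 0) (at_right 0)"
  unfolding tendsto_at_iff_sequentially comp_def
proof (intro allI impI)
  fix X :: "nat \<Rightarrow> real" assume X: "\<forall>i. X i \<in> {0<..} - {0}" "X \<longlonglongrightarrow> 0"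
  have X0: "filterlim X (at_right 0) sequentially"
  proof -
    have "X i > 0" for i using X(1) by auto
    then have "X i \<in> {0<..} \<and> X i \<noteq> 0" for i by (metis greaterThan_iff less_irrefl)
    then show ?thesis using X(2) by (simp add: filterlim_at)
  qed
  from eventually_compose_filterlim[OF bound X0]
  obtain N where N: "\<And>i x. i \<ge> N \<Longrightarrow> x \<in> space m \<Longrightarrow> \<bar>f (X i) x\<bar> \<le> C"
    unfolding eventually_sequentially by blast
  interpret finite_measure m by (rule fin)
  have "(\<lambda>i. LINT x|m. f (X (i + N)) x) \<longlonglongrightarrow> (LINT x|m. 0)"
  proof (rule integral_dominated_convergence[where w = "\<lambda>_. C"])
    show "AE x in m. (\<lambda>i. f (X (i + N)) x) \<longlonglongrightarrow> 0"
      by (rule AE_I2) (rule LIMSEQ_ignore_initial_segment[OF filterlim_compose[OF lim X0]])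
    show "AE x in m. norm (f (X (i + N)) x) \<le> C" for i
      using N[of "i + N"] by (intro AE_I2) simp
  qed (use meas in simp_all)
  then have "(\<lambda>i. LINT x|m. f (X (i + N)) x) \<longlonglongrightarrow> 0" by simp
  then show "(\<lambda>i. LINT x|m. f (X i) x) \<longlonglongrightarrow> 0" by (rule LIMSEQ_offset)
qed

locale measured_cocycle = smooth_cocycle d \<M> \<Xi> g \<xi> F \<phi>
  for d :: "'d::finite itself" and \<M> :: "(real^'D) set" and \<Xi> :: "'z::real_normed_vector set"
    and g \<xi> F \<phi> +
  fixes m :: "(real^'D) measure"
  assumes volume: "normalised_lebesgue d \<M> m"
begin

lemma manifold_type: "compact_manifold TYPE('d) \<M>"
  using manifold by (simp add: compact_manifold_def)

lemma volume_type: "normalised_lebesgue TYPE('d) \<M> m"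
  using volume by (simp add: normalised_lebesgue_def)

sublocale prob_space m
  by (rule normalised_lebesgue_prob[OF volume_type])

lemma space_volume: "space m = \<M>"
  by (rule normalised_lebesgue_space[OF volume_type])

lemma manifold_in_sets: "\<M> \<in> sets m"
  using sets.top[of m] by (simp add: space_volume)

lemma sets_volume_subset: "A \<in> sets m \<Longrightarrow> A \<subseteq> \<M>"
  using sets.sets_into_space[of A m] by (simp add: space_volume)

lemma flow_preimage_eq_image:
  assumes w: "w \<in> \<Xi>" and A: "A \<subseteq> \<M>"
  shows "{x\<in>\<M>. \<phi> s w x \<in> A} = \<phi> (-s) (\<xi> s w) ` A"
proof (intro equalityI subsetI)
  fix x assume "x \<in> {x\<in>\<M>. \<phi> s w x \<in> A}"
  then show "x \<in> \<phi> (-s) (\<xi> s w) ` A"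
    using flow_inverse(1)[OF w] by (intro image_eqI[of _ _ "\<phi> s w x"]) auto
next
  fix x assume "x \<in> \<phi> (-s) (\<xi> s w) ` A"
  then show "x \<in> {x\<in>\<M>. \<phi> s w x \<in> A}"
    using flow_inverse(2)[OF w] flow_in[OF driving_in[OF w]] A by auto
qed

lemma flow_preimage_in_sets:
  assumes w: "w \<in> \<Xi>" and A: "A \<in> sets m"
  shows "{x\<in>\<M>. \<phi> s w x \<in> A} \<in> sets m"
  unfolding flow_preimage_eq_image[OF w sets_volume_subset[OF A]]
  by (rule differentiable_image_in_sets[OF manifold_type volume_type
        flow_differentiable[OF driving_in[OF w]] flow_image[OF driving_in[OF w]] A])

lemma D_flow_bound_type:
  assumes w: "w \<in> \<Xi>" and K: "\<forall>x\<in>\<M>. \<forall>v\<in>T x. norm (D\<phi> s w x v) \<le> K * norm v"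
  shows "tangent_bound TYPE('d) \<M> K (\<phi> s w)"
proof
  fix x assume x: "x \<in> \<M>"
  have eq: "tangent_space TYPE('d) \<M> x = T x" by (simp add: tangent_space_def)
  show "\<exists>L. (\<phi> s w has_derivative L) (at x within \<M>) \<and> (\<forall>v\<in>tangent_space TYPE('d) \<M> x. norm (L v) \<le> K * norm v)"
    unfolding eq using D_flow[OF w x] bspec[OF K x] by blast
qed

text \<open>
  Preimages under a flow map are images under the inverse flow map, and the inverse flow maps
  \<open>\<phi> (-s) (\<xi> \<delta> (\<xi> s w))\<close> form a family of the same kind, based at \<open>\<xi> s w\<close>. Their derivatives are
  bounded uniformly in \<open>\<delta>\<close>.
\<close>

lemma measure_flow_preimage_le:
  assumes w: "w \<in> \<Xi>"
  obtains C where "C > 0"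
    "\<forall>\<^sub>F \<delta> in at_right 0. \<forall>E\<in>sets m. measure m {x\<in>\<M>. \<phi> s (\<xi> \<delta> w) x \<in> E} \<le> C * measure m E"
    "\<forall>E\<in>sets m. measure m {x\<in>\<M>. \<phi> s w x \<in> E} \<le> C * measure m E"
proof -
  have sw: "\<xi> s w \<in> \<Xi>" by (rule driving_in[OF w])
  obtain K where K: "K > 0"
    "\<forall>\<^sub>F \<delta> in at_right 0. \<forall>x\<in>\<M>. \<forall>v\<in>T x. norm (D\<phi> (-s) (\<xi> \<delta> (\<xi> s w)) x v) \<le> K * norm v"
    "\<And>x v. x \<in> \<M> \<Longrightarrow> norm (D\<phi> (-s) (\<xi> s w) x v) \<le> K * norm v"
    by (rule D_shifted_flow_bounded[OF sw, where s = "-s"]) (rule that)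
  obtain C where C: "C > 0"
    "\<And>f A. f ` \<M> \<subseteq> \<M> \<Longrightarrow>
      tangent_bound TYPE('d) \<M> K f \<Longrightarrow>
      A \<in> sets m \<Longrightarrow> emeasure m (f ` A) \<le> ennreal C * emeasure m A"
    by (rule emeasure_image_le_of_tangent_bound[OF manifold_type volume_type K(1)]) (rule that)
  have le: "measure m {x\<in>\<M>. \<phi> s w' x \<in> E} \<le> C * measure m E"
    if w': "w' \<in> \<Xi>" and b: "\<forall>x\<in>\<M>. \<forall>v\<in>T x. norm (D\<phi> (-s) (\<xi> s w') x v) \<le> K * norm v" and E: "E \<in> sets m" for w' E
  proof -
    have sw': "\<xi> s w' \<in> \<Xi>" by (rule driving_in[OF w'])
    have "emeasure m {x\<in>\<M>. \<phi> s w' x \<in> E} \<le> ennreal C * emeasure m E"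
      unfolding flow_preimage_eq_image[OF w' sets_volume_subset[OF E]]
      by (rule C(2)[OF flow_image[OF sw'] D_flow_bound_type[OF sw' b] E])
    then show ?thesis
      using C(1) by (simp add: emeasure_eq_measure ennreal_mult[symmetric])
  qed
  show thesis
  proof (rule that[OF C(1)])
    show "\<forall>E\<in>sets m. measure m {x\<in>\<M>. \<phi> s w x \<in> E} \<le> C * measure m E"
      using le[OF w] K(3) by blast
    show "\<forall>\<^sub>F \<delta> in at_right 0. \<forall>E\<in>sets m. measure m {x\<in>\<M>. \<phi> s (\<xi> \<delta> w) x \<in> E} \<le> C * measure m E"
      using K(2)
    proof eventually_elim
      case (elim \<delta>)
      have "\<xi> s (\<xi> \<delta> w) = \<xi> \<delta> (\<xi> s w)" by (simp add: driving_add[OF w] add.commute)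
      then show ?case using le[OF driving_in[OF w], of \<delta>] elim by simp
    qed
  qed
qed

abbreviation mismatch :: "real \<Rightarrow> 'z \<Rightarrow> 'z \<Rightarrow> (real^'D) set \<Rightarrow> (real^'D) set" where
  "mismatch s w w' A \<equiv> {x\<in>\<M>. (\<phi> s w x \<in> A) \<noteq> (\<phi> s w' x \<in> A)}"

lemma flow_symmetric_difference_in_sets:
  assumes "w \<in> \<Xi>" "w' \<in> \<Xi>" "A \<in> sets m"
  shows "(mismatch s w w' A) \<in> sets m"
proof -
  let ?X = "{x\<in>\<M>. \<phi> s w x \<in> A}" and ?Y = "{x\<in>\<M>. \<phi> s w' x \<in> A}"
  have "(mismatch s w w' A) = (?X - ?Y) \<union> (?Y - ?X)" by auto
  then show ?thesis using flow_preimage_in_sets assms by (simp add: sets.Un sets.Diff)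
qed

text \<open>
  The members of the partition may have large boundaries, so uniform convergence of the flow
  maps is not enough. Approximate \<open>A\<close> and its complement from inside by compact sets, which have
  a positive distance. If exactly one of the two images of \<open>x\<close> lies in \<open>A\<close> and they are closer
  than this distance, then one of them lies in the small exceptional set \<open>E\<close>; and the preimages
  of \<open>E\<close> are small uniformly in \<open>\<delta>\<close>.
\<close>

lemma measure_symmetric_difference_tendsto:
  assumes w: "w \<in> \<Xi>" and A: "A \<in> sets m"
  shows "((\<lambda>\<delta>. measure m (mismatch s (\<xi> \<delta> w) w A)) \<longlongrightarrow> 0) (at_right 0)"
proof (rule tendstoI)
  fix \<epsilon> :: real assume "\<epsilon> > 0"
  obtain C where C: "C > 0"
    "\<forall>\<^sub>F \<delta> in at_right 0. \<forall>E\<in>sets m. measure m {x\<in>\<M>. \<phi> s (\<xi> \<delta> w) x \<in> E} \<le> C * measure m E"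
    "\<forall>E\<in>sets m. measure m {x\<in>\<M>. \<phi> s w x \<in> E} \<le> C * measure m E"
    by (rule measure_flow_preimage_le[OF w, where s = s]) (rule that)
  define \<eta> where "\<eta> = \<epsilon> / (4 * C)"
  have \<eta>: "\<eta> > 0" using \<open>\<epsilon> > 0\<close> C(1) by (simp add: \<eta>_def)
  have A': "\<M> - A \<in> sets m" using A manifold_in_sets by auto
  obtain Q where Q: "compact Q" "Q \<subseteq> A" "Q \<in> sets m" "emeasure m (A - Q) < ennreal \<eta>"
    by (rule compact_inner_approximation[OF manifold_type volume_type A \<eta>]) (rule that)
  obtain Q' where Q': "compact Q'" "Q' \<subseteq> \<M> - A" "Q' \<in> sets m" "emeasure m ((\<M> - A) - Q') < ennreal \<eta>"
    by (rule compact_inner_approximation[OF manifold_type volume_type A' \<eta>]) (rule that)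
  define E where "E = (A - Q) \<union> ((\<M> - A) - Q')"
  have E: "E \<in> sets m" unfolding E_def using A A' Q(3) Q'(3) by auto
  have "measure m E \<le> measure m (A - Q) + measure m ((\<M> - A) - Q')"
    unfolding E_def using A A' Q(3) Q'(3) by (intro measure_Un_le) auto
  also have "\<dots> < \<eta> + \<eta>"
    using Q(4) Q'(4) \<eta> by (intro add_strict_mono) (auto simp: emeasure_eq_measure ennreal_less_iff)
  finally have mE: "measure m E < 2 * \<eta>" by simp
  obtain \<rho> where \<rho>: "\<rho> > 0" "\<And>x y. x \<in> Q \<Longrightarrow> y \<in> Q' \<Longrightarrow> \<rho> \<le> dist x y"
    using separate_compact_closed[of Q Q'] Q(1,2) Q'(1,2) compact_imp_closed by blast
  show "\<forall>\<^sub>F \<delta> in at_right 0. dist (measure m (mismatch s (\<xi> \<delta> w) w A)) 0 < \<epsilon>"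
    using C(2) shifted_flow_uniformly_near[OF w \<rho>(1), where s = s]
  proof eventually_elim
    case (elim \<delta>)
    note w\<delta> = driving_in[OF w, of \<delta>]
    let ?X = "{x\<in>\<M>. \<phi> s (\<xi> \<delta> w) x \<in> E}" and ?Y = "{x\<in>\<M>. \<phi> s w x \<in> E}"
    have "(mismatch s (\<xi> \<delta> w) w A) \<subseteq> ?X \<union> ?Y"
    proof
      fix x assume "x \<in> (mismatch s (\<xi> \<delta> w) w A)"
      then have x: "x \<in> \<M>" and ne: "(\<phi> s (\<xi> \<delta> w) x \<in> A) \<noteq> (\<phi> s w x \<in> A)" by auto
      let ?a = "\<phi> s (\<xi> \<delta> w) x" and ?b = "\<phi> s w x"
      have ab: "?a \<in> \<M>" "?b \<in> \<M>" using flow_in[OF w x] flow_in[OF w\<delta> x] by auto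
      have "dist ?a ?b < \<rho>" using elim(2) x by (simp add: dist_norm)
      then have "\<not> (?a \<in> Q \<and> ?b \<in> Q')" "\<not> (?b \<in> Q \<and> ?a \<in> Q')"
        using \<rho>(2) by (force simp: dist_commute not_le[symmetric])+
      then have "?a \<in> E \<or> ?b \<in> E" using ne ab unfolding E_def by blast
      then show "x \<in> ?X \<union> ?Y" using x by blast
    qed
    then have "measure m (mismatch s (\<xi> \<delta> w) w A) \<le> measure m (?X \<union> ?Y)"
      by (rule finite_measure_mono) (intro sets.Un flow_preimage_in_sets w w\<delta> E)
    also have "\<dots> \<le> measure m ?X + measure m ?Y"
      by (intro measure_Un_le flow_preimage_in_sets w w\<delta> E)
    also have "\<dots> \<le> C * measure m E + C * measure m E"
      using elim(1) C(3) E by (intro add_mono) blast+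
    also have "\<dots> < 4 * C * \<eta>"
      using mult_strict_left_mono[OF mE C(1)] by simp
    also have "\<dots> = \<epsilon>" using C(1) by (simp add: \<eta>_def)
    finally show ?case by simp
  qed
qed

lemma measure_flow_preimage_tendsto:
  assumes w: "w \<in> \<Xi>" and A: "A \<in> sets m" and B: "B \<in> sets m"
  shows "((\<lambda>\<delta>. measure m (B \<inter> {x\<in>\<M>. \<phi> s (\<xi> \<delta> w) x \<in> A})) \<longlongrightarrow> measure m (B \<inter> {x\<in>\<M>. \<phi> s w x \<in> A})) (at_right 0)"
proof (rule Lim_null[THEN iffD2], rule Lim_null_comparison)
  let ?S = "\<lambda>\<delta>. (mismatch s (\<xi> \<delta> w) w A)"
  show "\<forall>\<^sub>F \<delta> in at_right 0. norm (measure m (B \<inter> {x\<in>\<M>. \<phi> s (\<xi> \<delta> w) x \<in> A}) - measure m (B \<inter> {x\<in>\<M>. \<phi> s w x \<in> A}))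
      \<le> measure m (?S \<delta>)"
  proof (rule always_eventually, rule allI)
    fix \<delta>
    note w\<delta> = driving_in[OF w, of \<delta>]
    let ?X = "B \<inter> {x\<in>\<M>. \<phi> s (\<xi> \<delta> w) x \<in> A}" and ?Y = "B \<inter> {x\<in>\<M>. \<phi> s w x \<in> A}"
    have ms: "?X \<in> sets m" "?Y \<in> sets m" "?S \<delta> \<in> sets m"
      using B flow_preimage_in_sets[OF _ A] w w\<delta> flow_symmetric_difference_in_sets[OF w\<delta> w A] by auto
    have "measure m ?X \<le> measure m (?Y \<union> ?S \<delta>)" "measure m ?Y \<le> measure m (?X \<union> ?S \<delta>)"
      by (rule finite_measure_mono; use ms in auto)+
    moreover have "measure m (?Y \<union> ?S \<delta>) \<le> measure m ?Y + measure m (?S \<delta>)" "measure m (?X \<union> ?S \<delta>) \<le> measure m ?X + measure m (?S \<delta>)"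
      by (rule measure_Un_le; use ms in auto)+
    ultimately show "norm (measure m ?X - measure m ?Y) \<le> measure m (?S \<delta>)" by simp
  qed
qed (rule measure_symmetric_difference_tendsto[OF w A])

lemma pf_matrix_tendsto:
  fixes B :: "'n::finite \<Rightarrow> (real^'D) set"
  assumes w: "w \<in> \<Xi>" and B: "\<And>i. B i \<in> sets m"
  shows "((\<lambda>\<delta>. pf_matrix m B \<xi> \<phi> t (\<xi> \<delta> w)) \<longlongrightarrow> pf_matrix m B \<xi> \<phi> t w) (at_right 0)"
proof -
  have eq: "pf_matrix m B \<xi> \<phi> t w' = (\<chi> i j. measure m (B j \<inter> {x\<in>\<M>. \<phi> t w' x \<in> B i}) / measure m (B i))" if "w' \<in> \<Xi>" for w'
    unfolding pf_matrix_def using flow_preimage_eq_image[OF that sets_volume_subset[OF B]] by simp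
  show ?thesis
    unfolding eq[OF w] eq[OF driving_in[OF w]] divide_inverse
    by (intro tendsto_vec_lambda tendsto_mult measure_flow_preimage_tendsto[OF w B B] tendsto_const)
qed

abbreviation J :: "real \<Rightarrow> 'z \<Rightarrow> real^'D \<Rightarrow> real" where
  "J s w x \<equiv> abs_det_deriv d \<M> (\<phi> s w) x"

lemma J_chart:
  fixes \<psi> :: "real^'d \<Rightarrow> real^'D"
  assumes w: "w \<in> \<Xi>" and lp: "local_param \<M> U \<psi>" and u: "u \<in> U"
  shows "J s w (\<psi> u) = sqrt (det (gram (\<lambda>i. D\<phi> s w (\<psi> u) (Dat \<psi> u (axis i 1))))) / volume_density \<psi> u"
proof -
  have "\<psi> u \<in> \<M>" using local_param_sub[OF lp] u by auto
  then have "\<phi> s w differentiable (at (\<psi> u) within \<M>)"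
    using flow_differentiable[OF w] by (simp add: differentiable_on_def)
  then show ?thesis by (rule abs_det_deriv_chart[OF manifold lp u flow_image[OF w]])
qed

text \<open>
  In every chart \<open>J\<close> is a quotient of continuous functions.
\<close>

lemma J_measurable:
  assumes w: "w \<in> \<Xi>"
  shows "J s w \<in> borel_measurable m"
proof (rule borel_measurable_chartwise_continuous[OF volume_type])
  fix U and \<psi> :: "real^'d \<Rightarrow> real^'D" assume lp: "local_param \<M> U \<psi>"
  have "continuous_on U (\<lambda>u. (s, \<psi> u))" by (intro continuous_intros local_param_cont[OF lp])
  then have c1: "continuous_on U (\<lambda>u. matrix (D\<phi> s w (\<psi> u)))"
    using continuous_on_compose2[OF continuous_on_D_flow_matrix[OF w], of U "\<lambda>u. (s, \<psi> u)"] local_param_sub[OF lp]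
    by (simp add: image_subset_iff)
  have c2: "continuous_on U (\<lambda>u. D\<phi> s w (\<psi> u) (Dat \<psi> u (axis i 1)))" for i
  proof -
    have "continuous_on U (\<lambda>u. matrix (D\<phi> s w (\<psi> u)) *v Dat \<psi> u (axis i 1))"
      unfolding matrix_vector_mult_def
      by (intro continuous_intros c1 local_param_deriv_cont[OF lp])
    then show ?thesis
      by (rule continuous_on_eq) (use local_param_sub[OF lp] in \<open>auto intro!: D_flow_matrix[OF w]\<close>)
  qed
  have "continuous_on U (\<lambda>u. sqrt (det (gram (\<lambda>i. D\<phi> s w (\<psi> u) (Dat \<psi> u (axis i 1))))) / volume_density \<psi> u)"
  proof (intro continuous_on_divide continuous_on_real_sqrt continuous_on_det continuous_on_volume_density[OF lp])
    show "\<forall>u\<in>U. volume_density \<psi> u \<noteq> 0" using volume_density_pos[OF manifold_type lp] by force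
  qed (auto simp: gram_def intro!: continuous_intros c2)
  then show "continuous_on U (\<lambda>u. J s w (\<psi> u))"
    by (rule continuous_on_eq) (simp add: J_chart[OF w lp])
qed

lemma J_bound:
  assumes w: "w \<in> \<Xi>" and x: "x \<in> \<M>" and K: "\<And>v. v \<in> T x \<Longrightarrow> norm (D\<phi> s w x v) \<le> K * norm v"
  shows "\<bar>J s w x\<bar> \<le> fact CARD('d) * K ^ CARD('d)"
  using abs_det_deriv_bounds[OF manifold x flow_image[OF w, of s] _ K] flow_differentiable[OF w] x
  by (simp add: differentiable_on_def)

lemma J_bounded:
  assumes w: "w \<in> \<Xi>"
  obtains C where "C \<ge> 0" "\<forall>x\<in>\<M>. \<bar>J s w x\<bar> \<le> C"
    "\<forall>\<^sub>F \<delta> in at_right 0. \<forall>x\<in>\<M>. \<bar>J s (\<xi> \<delta> w) x\<bar> \<le> C"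
proof -
  obtain K where K: "K > 0"
    "\<forall>\<^sub>F \<delta> in at_right 0. \<forall>x\<in>\<M>. \<forall>v\<in>T x. norm (D\<phi> s (\<xi> \<delta> w) x v) \<le> K * norm v"
    "\<And>x v. x \<in> \<M> \<Longrightarrow> norm (D\<phi> s w x v) \<le> K * norm v"
    by (rule D_shifted_flow_bounded[OF w, where s = s]) (rule that)
  show thesis
  proof (rule that[of "fact CARD('d) * K ^ CARD('d)"])
    show "\<forall>\<^sub>F \<delta> in at_right 0. \<forall>x\<in>\<M>. \<bar>J s (\<xi> \<delta> w) x\<bar> \<le> fact CARD('d) * K ^ CARD('d)"
      using K(2) by eventually_elim (use J_bound[OF driving_in[OF w]] in blast)
  qed (use J_bound[OF w] K(1,3) in auto)
qed

text \<open>
  In a chart at \<open>x\<close> the Jacobian depends on \<open>\<delta>\<close> only through the images of finitely many fixed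
  tangent vectors.
\<close>

lemma J_tendsto:
  assumes w: "w \<in> \<Xi>" and x: "x \<in> \<M>"
  shows "((\<lambda>\<delta>. J s (\<xi> \<delta> w) x) \<longlongrightarrow> J s w x) (at_right 0)"
proof -
  obtain U and \<psi> :: "real^'d \<Rightarrow> real^'D" and u where c: "local_param \<M> U \<psi>" "u \<in> U" "x = \<psi> u"
    using compact_manifold_chart[OF manifold x] .
  have t: "Dat \<psi> u v \<in> T x" for v
    unfolding c(3) tangent_space_chart[OF c(1,2)] by simp
  have "((\<lambda>\<delta>. det (gram (\<lambda>i. D\<phi> s (\<xi> \<delta> w) x (Dat \<psi> u (axis i 1)))))
      \<longlongrightarrow> det (gram (\<lambda>i. D\<phi> s w x (Dat \<psi> u (axis i 1))))) (at_right 0)"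
    by (rule tendsto_det) (auto simp: gram_def intro!: tendsto_intros D_shifted_flow_tendsto[OF w x t])
  then show ?thesis
    unfolding c(3) J_chart[OF w c(1,2)] J_chart[OF driving_in[OF w] c(1,2)]
    using volume_density_pos[OF manifold_type c(1,2)] by (intro tendsto_divide tendsto_real_sqrt tendsto_const) auto
qed

lemma J_tendsto_L1:
  assumes w: "w \<in> \<Xi>"
  shows "((\<lambda>\<delta>. LINT x|m. \<bar>J s (\<xi> \<delta> w) x - J s w x\<bar>) \<longlongrightarrow> 0) (at_right 0)"
proof -
  obtain C where C: "C \<ge> 0" "\<forall>x\<in>\<M>. \<bar>J s w x\<bar> \<le> C" "\<forall>\<^sub>F \<delta> in at_right 0. \<forall>x\<in>\<M>. \<bar>J s (\<xi> \<delta> w) x\<bar> \<le> C"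
    by (rule J_bounded[OF w, where s = s]) (rule that)
  show ?thesis
  proof (rule integral_tendsto_zero_at_right[where C = "2 * C"])
    show "(\<lambda>x. \<bar>J s (\<xi> \<delta> w) x - J s w x\<bar>) \<in> borel_measurable m" for \<delta>
      using J_measurable[OF w] J_measurable[OF driving_in[OF w]] by measurable
    show "\<forall>\<^sub>F \<delta> in at_right 0. \<forall>x\<in>space m. \<bar>\<bar>J s (\<xi> \<delta> w) x - J s w x\<bar>\<bar> \<le> 2 * C"
      using C(3)
    proof eventually_elim
      case (elim \<delta>)
      show ?case
      proof
        fix x assume "x \<in> space m"
        then have "\<bar>J s (\<xi> \<delta> w) x\<bar> \<le> C" "\<bar>J s w x\<bar> \<le> C" using elim C(2) by (auto simp: space_volume)
        then show "\<bar>\<bar>J s (\<xi> \<delta> w) x - J s w x\<bar>\<bar> \<le> 2 * C" by linarith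
      qed
    qed
    show "((\<lambda>\<delta>. \<bar>J s (\<xi> \<delta> w) x - J s w x\<bar>) \<longlongrightarrow> 0) (at_right 0)" if "x \<in> space m" for x
      using J_tendsto[OF w] that by (auto simp: space_volume intro!: tendsto_rabs_zero LIM_zero)
  qed (rule finite_measure_axioms)
qed

text \<open>
  For a flow map with inverse this is the measure of \<open>A \<inter> \<phi> s w ` B\<close>; it is kept as an integral
  because that is the form in which it occurs in the projected Perron--Frobenius operator.
\<close>

definition transported_mass :: "real \<Rightarrow> (real^'D) set \<Rightarrow> (real^'D) set \<Rightarrow> 'z \<Rightarrow> real" where
  "transported_mass s B A w = (LINT y:B|m. indicator A (\<phi> s w y) * J s w y)"

lemma indicator_flow_measurable:
  assumes w: "w \<in> \<Xi>" and A: "A \<in> sets m"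
  shows "(\<lambda>y. indicator A (\<phi> s w y) :: real) \<in> borel_measurable m"
proof -
  have "(indicator {x\<in>\<M>. \<phi> s w x \<in> A} :: _ \<Rightarrow> real) \<in> borel_measurable m"
    using flow_preimage_in_sets[OF w A] by measurable
  then show ?thesis
    by (rule measurable_cong[THEN iffD1, rotated]) (auto simp: space_volume indicator_def)
qed

lemma transported_integrable:
  assumes w: "w \<in> \<Xi>" and A: "A \<in> sets m"
  shows "integrable m (\<lambda>y. indicator A (\<phi> s w y) * J s w y)"
proof -
  obtain C where C: "C \<ge> 0" "\<forall>x\<in>\<M>. \<bar>J s w x\<bar> \<le> C" "\<forall>\<^sub>F \<delta> in at_right 0. \<forall>x\<in>\<M>. \<bar>J s (\<xi> \<delta> w) x\<bar> \<le> C"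
    by (rule J_bounded[OF w, where s = s]) (rule that)
  show ?thesis
  proof (rule integrable_const_bound[where B = C])
    show "AE y in m. norm (indicator A (\<phi> s w y) * J s w y) \<le> C"
      using C(1,2) by (intro AE_I2) (auto simp: space_volume indicator_def)
    show "(\<lambda>y. indicator A (\<phi> s w y) * J s w y) \<in> borel_measurable m"
      by (intro borel_measurable_times indicator_flow_measurable J_measurable w A)
  qed
qed

text \<open>
  Split the difference into one part in which only the Jacobian changes, which tends to zero in
  \<open>L\<^sup>1\<close>, and one part in which only the preimage of \<open>A\<close> changes, which is controlled by the
  measure of the symmetric difference.
\<close>

lemma transported_mass_tendsto:
  assumes w: "w \<in> \<Xi>" and A: "A \<in> sets m" and B: "B \<in> sets m"
  shows "((\<lambda>\<delta>. transported_mass s B A (\<xi> \<delta> w)) \<longlongrightarrow> transported_mass s B A w) (at_right 0)"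
proof -
  obtain C where C: "C \<ge> 0" "\<forall>x\<in>\<M>. \<bar>J s w x\<bar> \<le> C" "\<forall>\<^sub>F \<delta> in at_right 0. \<forall>x\<in>\<M>. \<bar>J s (\<xi> \<delta> w) x\<bar> \<le> C"
    by (rule J_bounded[OF w, where s = s]) (rule that)
  let ?S = "\<lambda>\<delta>. (mismatch s (\<xi> \<delta> w) w A)"
  have "\<bar>transported_mass s B A (\<xi> \<delta> w) - transported_mass s B A w\<bar>
      \<le> (LINT x|m. \<bar>J s (\<xi> \<delta> w) x - J s w x\<bar>) + C * measure m (?S \<delta>)" for \<delta>
  proof -
    note w\<delta> = driving_in[OF w, of \<delta>]
    have S: "?S \<delta> \<in> sets m" by (rule flow_symmetric_difference_in_sets[OF w\<delta> w A])
    have top: "integrable m (\<lambda>y. J s w' y)" if "w' \<in> \<Xi>" for w'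
    proof -
      have "integrable m (\<lambda>y. indicator \<M> (\<phi> s w' y) * J s w' y) \<longleftrightarrow> integrable m (J s w')"
        by (rule Bochner_Integration.integrable_cong) (simp_all add: space_volume flow_in[OF that])
      then show ?thesis using transported_integrable[OF that manifold_in_sets] by blast
    qed
    let ?f = "\<lambda>w y. indicator B y * (indicator A (\<phi> s w y) * J s w y)"
    have int: "integrable m (?f w')" if "w' \<in> \<Xi>" for w'
      using integrable_mult_indicator[OF B transported_integrable[OF that A]] by simp
    have i1: "integrable m (\<lambda>y. \<bar>J s (\<xi> \<delta> w) y - J s w y\<bar>)"
      by (rule integrable_abs[OF Bochner_Integration.integrable_diff[OF top[OF w\<delta>] top[OF w]]])
    have i2: "integrable m (\<lambda>y. C * indicator (?S \<delta>) y)"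
      by (intro integrable_mult_right integrable_real_indicator S) (simp add: emeasure_eq_measure)
    have diff: "transported_mass s B A (\<xi> \<delta> w) - transported_mass s B A w = (LINT y|m. ?f (\<xi> \<delta> w) y - ?f w y)"
      unfolding transported_mass_def set_lebesgue_integral_def
      using int[OF w] int[OF w\<delta>] by simp
    have "\<bar>transported_mass s B A (\<xi> \<delta> w) - transported_mass s B A w\<bar> \<le> (LINT y|m. \<bar>?f (\<xi> \<delta> w) y - ?f w y\<bar>)"
      unfolding diff by (rule integral_abs_bound)
    also have "\<dots> \<le> (LINT y|m. \<bar>J s (\<xi> \<delta> w) y - J s w y\<bar> + C * indicator (?S \<delta>) y)"
    proof (rule Bochner_Integration.integral_mono)
      show "integrable m (\<lambda>y. \<bar>?f (\<xi> \<delta> w) y - ?f w y\<bar>)"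
        by (rule integrable_abs[OF Bochner_Integration.integrable_diff[OF int[OF w\<delta>] int[OF w]]])
      show "integrable m (\<lambda>y. \<bar>J s (\<xi> \<delta> w) y - J s w y\<bar> + C * indicator (?S \<delta>) y)"
        by (rule Bochner_Integration.integrable_add[OF i1 i2])
      fix y assume "y \<in> space m"
      then have y: "y \<in> \<M>" by (simp add: space_volume)
      have gen: "\<bar>indicator B y * (indicator A a * j) - indicator B y * (indicator A b * j0)\<bar>
          \<le> \<bar>j - j0\<bar> + C * (if (a \<in> A) \<noteq> (b \<in> A) then 1 else 0)" if "\<bar>j0\<bar> \<le> C" for j j0 :: real and a b
        using that C(1) by (cases "y \<in> B"; cases "a \<in> A"; cases "b \<in> A") simp_all
      have "indicator (?S \<delta>) y = (if (\<phi> s (\<xi> \<delta> w) y \<in> A) \<noteq> (\<phi> s w y \<in> A) then 1 else (0::real))"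
        using y by (simp add: indicator_def)
      then show "\<bar>?f (\<xi> \<delta> w) y - ?f w y\<bar> \<le> \<bar>J s (\<xi> \<delta> w) y - J s w y\<bar> + C * indicator (?S \<delta>) y"
        using gen[OF bspec[OF C(2) y]] by presburger
    qed
    also have "\<dots> = (LINT y|m. \<bar>J s (\<xi> \<delta> w) y - J s w y\<bar>) + (LINT y|m. C * indicator (?S \<delta>) y)"
      by (rule Bochner_Integration.integral_add[OF i1 i2])
    also have "(LINT y|m. C * indicator (?S \<delta>) y) = C * measure m (?S \<delta>)"
      using S sets.Int_space_eq2[OF S] by simp
    finally show ?thesis .
  qed
  note le = this
  have "((\<lambda>\<delta>. (LINT x|m. \<bar>J s (\<xi> \<delta> w) x - J s w x\<bar>) + C * measure m (?S \<delta>)) \<longlongrightarrow> 0 + C * 0) (at_right 0)"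
    by (intro tendsto_intros J_tendsto_L1[OF w] measure_symmetric_difference_tendsto[OF w A])
  then have lim: "((\<lambda>\<delta>. (LINT x|m. \<bar>J s (\<xi> \<delta> w) x - J s w x\<bar>) + C * measure m (?S \<delta>)) \<longlongrightarrow> 0) (at_right 0)"
    by simp
  have "((\<lambda>\<delta>. transported_mass s B A (\<xi> \<delta> w) - transported_mass s B A w) \<longlongrightarrow> 0) (at_right 0)"
    by (rule Lim_null_comparison[OF _ lim], rule always_eventually) (unfold real_norm_def, intro allI le)
  then show ?thesis by (rule Lim_null[THEN iffD2])
qed

lemma integral_perron_frobenius_step:
  fixes B :: "'n::finite \<Rightarrow> (real^'D) set"
  assumes w: "w \<in> \<Xi>" and B: "\<And>i. B i \<in> sets m" and t: "\<xi> t w' = w"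
  shows "(LINT y:B i|m. perron_frobenius d \<M> \<xi> \<phi> t w' (step_function B u) y) =
    (\<Sum>j\<in>UNIV. u $ j * transported_mass (-t) (B i) (B j) w)"
proof -
  have int: "set_integrable m (B i) (\<lambda>y. u $ j * (indicator (B j) (\<phi> (-t) w y) * J (-t) w y))" for j
    unfolding set_integrable_def
    using integrable_mult_indicator[OF B integrable_mult_right[OF transported_integrable[OF w B]]] by blast
  have "perron_frobenius d \<M> \<xi> \<phi> t w' (step_function B u) y =
      (\<Sum>j\<in>UNIV. u $ j * (indicator (B j) (\<phi> (-t) w y) * J (-t) w y))" for y
    unfolding perron_frobenius_def step_function_def t by (simp only: sum_distrib_right mult.assoc)
  then have "(LINT y:B i|m. perron_frobenius d \<M> \<xi> \<phi> t w' (step_function B u) y) =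
      (LINT y:B i|m. (\<Sum>j\<in>UNIV. u $ j * (indicator (B j) (\<phi> (-t) w y) * J (-t) w y)))"
    by simp
  also have "\<dots> = (\<Sum>j\<in>UNIV. LINT y:B i|m. u $ j * (indicator (B j) (\<phi> (-t) w y) * J (-t) w y))"
    unfolding set_lebesgue_integral_def scaleR_sum_right
    by (rule Bochner_Integration.integral_sum) (use int in \<open>simp add: set_integrable_def\<close>)
  finally show ?thesis by (simp add: transported_mass_def)
qed

end

section \<open>Continuity of the approximate Oseledets functions\<close>

lemma abs_step_function:
  fixes B :: "'n::finite \<Rightarrow> 'a set"
  assumes "disjoint_family B"
  shows "\<bar>step_function B v x\<bar> = (\<Sum>i\<in>UNIV. \<bar>v $ i\<bar> * indicator (B i) x)"
proof (cases "\<exists>i. x \<in> B i")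
  case True
  then obtain i where i: "x \<in> B i" by blast
  have "x \<notin> B j" if "j \<noteq> i" for j
    using assms i that unfolding disjoint_family_on_def by blast
  then have ind: "(indicator (B j) x :: real) = (if j = i then 1 else 0)" for j using i by auto
  show ?thesis by (simp add: step_function_def ind if_distrib cong: if_cong)
next
  case False
  then show ?thesis by (simp add: step_function_def)
qed

lemma L1_norm_step_function:
  fixes B :: "'n::finite \<Rightarrow> 'a set"
  assumes "finite_measure m" "disjoint_family B" "\<And>i. B i \<in> sets m"
  shows "L1_norm m (step_function B v) = (\<Sum>i\<in>UNIV. \<bar>v $ i\<bar> * measure m (B i))"
proof -
  interpret finite_measure m by fact
  have "L1_norm m (step_function B v) = (LINT x|m. (\<Sum>i\<in>UNIV. \<bar>v $ i\<bar> * indicator (B i) x))"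
    unfolding L1_norm_def abs_step_function[OF assms(2)] ..
  also have "\<dots> = (\<Sum>i\<in>UNIV. LINT x|m. \<bar>v $ i\<bar> * indicator (B i) x)"
    by (rule Bochner_Integration.integral_sum)
      (intro integrable_mult_right integrable_real_indicator assms(3), simp add: emeasure_eq_measure)
  also have "\<dots> = (\<Sum>i\<in>UNIV. \<bar>v $ i\<bar> * measure m (B i))"
    using sets.Int_space_eq2[OF assms(3)] by simp
  finally show ?thesis .
qed

lemma transpose_mult_self_symmetric: "transpose (transpose P ** P) = transpose P ** P" for P :: "real^'n^'m"
  by (simp add: matrix_transpose_mul)

lemma transpose_mult_self_psd: "0 \<le> v \<bullet> ((transpose P ** P) *v v)" for P :: "real^'n^'m"
proof -
  have "v \<bullet> ((transpose P ** P) *v v) = (P *v v) \<bullet> (P *v v)"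
    by (metis dot_lmul_matrix inner_commute matrix_vector_mul_assoc transpose_matrix_vector transpose_transpose)
  then show ?thesis by simp
qed

theorem proposition2:
  fixes \<M> :: "(real^'D) set"
    and m :: "(real^'D) measure"
    and \<Xi> :: "(real^'e) set"
    and g :: "real^'e \<Rightarrow> real^'e"
    and \<xi> :: "real \<Rightarrow> real^'e \<Rightarrow> real^'e"
    and \<P> :: "(real^'e) measure"
    and F :: "real^'e \<Rightarrow> real^'D \<Rightarrow> real^'D"
    and \<phi> :: "real \<Rightarrow> real^'e \<Rightarrow> real^'D \<Rightarrow> real^'D"
    and B :: "'n::finite \<Rightarrow> (real^'D) set"
    and M N :: real
    and z :: "real^'e"
    and u2 :: "real^'e \<Rightarrow> real^'n"
    and l :: nat
  assumes "CARD('d::finite) \<le> CARD('D)"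
    and "compact_manifold TYPE('d) \<M>"
    and "normalised_lebesgue TYPE('d) \<M> m"
    and "CARD('e) \<ge> 3"
    and "ode_flow_on \<Xi> g \<xi>"
    and "ergodic_flow \<Xi> \<xi> \<P>"
    and "nonautonomous_flow TYPE('d) \<M> \<Xi> \<xi> F \<phi>"
    and "connected_partition m B"
    and "M > 0" and "N \<ge> 0" and "z \<in> \<Xi>"
    and "card (eigenvalues (Psi m B \<xi> \<phi> M (\<xi> (-N) z))) = l"
    and "\<forall>\<^sub>F \<delta> in at_right 0. card (eigenvalues (Psi m B \<xi> \<phi> M (\<xi> (-N + \<delta>) z))) = l"
    and "dim (W_space m B \<xi> \<phi> M N 2 z) = 1"
    and "dim (U_space m B \<xi> \<phi> M 2 (\<xi> (-N) z)) = 1"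
    and "\<forall>\<^sub>F \<delta> in at_right 0. dim (U_space m B \<xi> \<phi> M 2 (\<xi> (-N + \<delta>) z)) = 1"
    and "normalised_second_vector m B \<xi> \<phi> M (\<xi> (-N) z) (u2 (\<xi> (-N) z))"
    and "\<forall>\<^sub>F \<delta> in at_right 0.
           normalised_second_vector m B \<xi> \<phi> M (\<xi> (-N + \<delta>) z) (u2 (\<xi> (-N + \<delta>) z))"
  shows "\<exists>\<sigma> :: real^'e \<Rightarrow> real. (\<forall>y. \<sigma> y = 1 \<or> \<sigma> y = -1) \<and>
           ((\<lambda>\<delta>. L1_norm m (\<lambda>x.
                f_hat TYPE('d) \<M> m B \<xi> \<phi> N (\<lambda>y. \<sigma> y *\<^sub>R u2 y) (\<xi> \<delta> z) x -
                f_hat TYPE('d) \<M> m B \<xi> \<phi> N (\<lambda>y. \<sigma> y *\<^sub>R u2 y) z x))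
             \<longlongrightarrow> 0) (at_right 0)"
proof -
  note cm = assms(2) and nl = assms(3) and ode = assms(5) and flow = assms(7) and part = assms(8)
  note zX = \<open>z \<in> \<Xi>\<close>
  interpret measured_cocycle "TYPE('d)" \<M> \<Xi> g \<xi> F \<phi> m
    by unfold_locales (rule cm ode flow nl)+
  have disj: "disjoint_family B" and Bm: "\<And>i. B i \<in> sets m" and Bpos: "\<And>i. measure m (B i) > 0"
    using part by (auto simp: connected_partition_def)
  define y0 where "y0 = \<xi> (-N) z"
  have y0: "y0 \<in> \<Xi>" unfolding y0_def by (rule driving_in[OF zX])
  have y\<delta>: "\<xi> (-N + \<delta>) z = \<xi> \<delta> y0" for \<delta>
    unfolding y0_def by (simp add: driving_add[OF zX] add.commute)
  have base_eq: "\<xi> (-N) (\<xi> \<delta> z) = \<xi> \<delta> y0" for \<delta>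
    unfolding y0_def by (simp add: driving_add[OF zX] add.commute)
  define G where "G y = transpose (pf_matrix m B \<xi> \<phi> M y) ** pf_matrix m B \<xi> \<phi> M y" for y
  have symG: "transpose (G y) = G y" for y unfolding G_def by (rule transpose_mult_self_symmetric)
  have psdG: "0 \<le> v \<bullet> (G y *v v)" for y v unfolding G_def by (rule transpose_mult_self_psd)
  have s: "1 / (2 * M) > 0" using \<open>M > 0\<close> by simp
  have Psi_card: "card (eigenvalues (Psi m B \<xi> \<phi> M y)) = card (eigenvalues (G y))" for y
    unfolding Psi_def G_def[symmetric] by (rule card_eigenvalues_psd_powr[OF symG psdG s])
  have Psi_space: "U_space m B \<xi> \<phi> M 2 y = eigenspace (G y) 2" for y
    unfolding U_space_def Psi_def G_def[symmetric] by (rule eigenspace_psd_powr[OF symG psdG s])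
  define p where "p v = (\<Sum>i\<in>UNIV. \<bar>v $ i\<bar> * measure m (B i))" for v :: "real^'n"
  have L1: "L1_norm m (step_function B v) = p v" for v
    unfolding p_def by (rule L1_norm_step_function[OF finite_measure_axioms disj Bm])
  define c where "c = Min (range (\<lambda>i. measure m (B i)))"
  have c: "c > 0" "\<And>i. c \<le> measure m (B i)" using Bpos by (auto simp: c_def)
  have lowp: "c * norm v \<le> p v" for v
  proof -
    have "c * norm v \<le> c * (\<Sum>i\<in>UNIV. \<bar>v $ i\<bar>)" using c(1) norm_le_l1_cart[of v] by (intro mult_left_mono) auto
    also have "\<dots> \<le> p v" unfolding p_def sum_distrib_left
    proof (rule sum_mono)
      fix i
      show "c * \<bar>v $ i\<bar> \<le> \<bar>v $ i\<bar> * measure m (B i)"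
        using mult_right_mono[OF c(2)[of i], of "\<bar>v $ i\<bar>"] by (simp add: mult.commute)
    qed
    finally show ?thesis .
  qed
  let ?u0 = "u2 y0"
  \<comment> \<open>The sign depends on the base point only, not on \<open>\<delta>\<close>, so it is well defined even if the
    orbit is periodic; at \<open>y0\<close> itself it is \<open>1\<close>.\<close>
  define \<sigma> :: "real^'e \<Rightarrow> real" where "\<sigma> y = (if norm (u2 y - ?u0) \<le> norm (u2 y + ?u0) then 1 else -1)" for y
  have \<sigma>0: "\<sigma> y0 = 1" by (simp add: \<sigma>_def)
  have near: "\<forall>\<^sub>F \<delta> in at_right 0. norm (u2 (\<xi> \<delta> y0) - ?u0) < \<epsilon> \<or> norm (u2 (\<xi> \<delta> y0) + ?u0) < \<epsilon>" if "\<epsilon> > 0" for \<epsilon>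
  proof (rule simple_eigenvector_continuous_up_to_sign[where A = "\<lambda>\<delta>. G (\<xi> \<delta> y0)" and ?A0.0 = "G y0" and j = 2 and p = p and c = c])
    show "((\<lambda>\<delta>. G (\<xi> \<delta> y0)) \<longlongrightarrow> G y0) (at_right 0)"
    proof -
      have P: "((\<lambda>\<delta>. pf_matrix m B \<xi> \<phi> M (\<xi> \<delta> y0)) \<longlongrightarrow> pf_matrix m B \<xi> \<phi> M y0) (at_right 0)"
        by (rule pf_matrix_tendsto[OF y0 Bm])
      show ?thesis
        unfolding G_def matrix_matrix_mult_def transpose_def
        by (intro tendsto_vec_lambda tendsto_sum tendsto_mult) (auto intro!: tendsto_vec_nth P)
    qed
    show "\<forall>\<^sub>F \<delta> in at_right 0. card (eigenvalues (G (\<xi> \<delta> y0))) = card (eigenvalues (G y0))"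
      using assms(12,13) unfolding y\<delta> y0_def[symmetric] Psi_card by simp
    show "dim (eigenspace (G y0) 2) = 1"
      using assms(15) unfolding y0_def[symmetric] Psi_space .
    show "?u0 \<in> eigenspace (G y0) 2" "p ?u0 = 1"
      using assms(17) unfolding y0_def[symmetric] normalised_second_vector_def Psi_space L1 by auto
    show "\<forall>\<^sub>F \<delta> in at_right 0. u2 (\<xi> \<delta> y0) \<in> eigenspace (G (\<xi> \<delta> y0)) 2 \<and> p (u2 (\<xi> \<delta> y0)) = 1"
      using assms(18) unfolding y\<delta> normalised_second_vector_def Psi_space L1 .
    show "continuous_on UNIV p" unfolding p_def by (intro continuous_intros)
    show "p (a *\<^sub>R v) = \<bar>a\<bar> * p v" for a v by (simp add: p_def abs_mult sum_distrib_left mult.assoc)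
  qed (use symG c lowp that in auto)
  have u_lim: "((\<lambda>\<delta>. \<sigma> (\<xi> \<delta> y0) *\<^sub>R u2 (\<xi> \<delta> y0)) \<longlongrightarrow> ?u0) (at_right 0)"
  proof (rule tendstoI)
    fix \<epsilon> :: real assume "\<epsilon> > 0"
    from near[OF this] show "\<forall>\<^sub>F \<delta> in at_right 0. dist (\<sigma> (\<xi> \<delta> y0) *\<^sub>R u2 (\<xi> \<delta> y0)) ?u0 < \<epsilon>"
    proof eventually_elim
      case (elim \<delta>)
      have "norm (- u2 (\<xi> \<delta> y0) - ?u0) = norm (u2 (\<xi> \<delta> y0) + ?u0)"
        using norm_minus_cancel[of "u2 (\<xi> \<delta> y0) + ?u0"] by simp
      then show ?case using elim by (auto simp: \<sigma>_def dist_norm)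
    qed
  qed
  define k where "k \<delta> i = (\<Sum>j\<in>UNIV. (\<sigma> (\<xi> \<delta> y0) *\<^sub>R u2 (\<xi> \<delta> y0)) $ j * transported_mass (-N) (B i) (B j) (\<xi> \<delta> z)) / measure m (B i)" for \<delta> i
  define k0 where "k0 i = (\<Sum>j\<in>UNIV. ?u0 $ j * transported_mass (-N) (B i) (B j) z) / measure m (B i)" for i
  have k_lim: "((\<lambda>\<delta>. k \<delta> i) \<longlongrightarrow> k0 i) (at_right 0)" for i
    unfolding k_def k0_def
    by (intro tendsto_divide tendsto_sum tendsto_mult tendsto_const tendsto_vec_nth[OF u_lim]
        transported_mass_tendsto[OF zX Bm Bm]) (use Bpos[of i] in simp)
  let ?f = "f_hat TYPE('d) \<M> m B \<xi> \<phi> N (\<lambda>y. \<sigma> y *\<^sub>R u2 y)"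
  have f\<delta>: "?f (\<xi> \<delta> z) x = (\<Sum>i\<in>UNIV. k \<delta> i * indicator (B i) x)" for \<delta> x
  proof -
    have "\<xi> N (\<xi> \<delta> y0) = \<xi> \<delta> z"
      unfolding y0_def by (simp add: driving_add zX driving_in)
    then show ?thesis
      unfolding f_hat_def step_projection_def base_eq k_def
      by (subst integral_perron_frobenius_step[OF driving_in[OF zX] Bm]) auto
  qed
  have f0: "?f z x = (\<Sum>i\<in>UNIV. k0 i * indicator (B i) x)" for x
  proof -
    have "\<xi> N y0 = z"
      unfolding y0_def by (simp add: driving_add zX driving_zero)
    then show ?thesis
      unfolding f_hat_def step_projection_def y0_def[symmetric] k0_def \<sigma>0
      by (subst integral_perron_frobenius_step[OF zX Bm]) auto
  qed
  have norm_eq: "L1_norm m (\<lambda>x. ?f (\<xi> \<delta> z) x - ?f z x) = p (\<chi> i. k \<delta> i - k0 i)" for \<delta>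
  proof -
    have "(\<lambda>x. ?f (\<xi> \<delta> z) x - ?f z x) = step_function B (\<chi> i. k \<delta> i - k0 i)"
      by (rule ext) (simp add: f\<delta> f0 step_function_def left_diff_distrib sum_subtractf)
    then show ?thesis by (simp only: L1)
  qed
  have "((\<lambda>\<delta>. p (\<chi> i. k \<delta> i - k0 i)) \<longlongrightarrow> (\<Sum>i\<in>UNIV. \<bar>k0 i - k0 i\<bar> * measure m (B i))) (at_right 0)"
    unfolding p_def vec_lambda_beta by (intro tendsto_intros k_lim)
  then have "((\<lambda>\<delta>. p (\<chi> i. k \<delta> i - k0 i)) \<longlongrightarrow> 0) (at_right 0)" by simp
  then show ?thesis
    unfolding norm_eq[symmetric] by (intro exI[of _ \<sigma>] conjI) (auto simp: \<sigma>_def)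
qed

end
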